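(* Let $u$ belong to the elliptic De Giorgi class $DG(B_{R}(x_{0}))$ (defined in the context). Then $u$ is H\"older continuous at $x_{0}$.
   Context: Let $x_0\in\mathbb{R}^n$, $n\geqslant2$, $L>0$, $0<R<1/e$, and for $0<s<1/e$ put $p(s):=L\,\dfrac{\log\log\frac1s}{\log\frac1s}$. Definition of $DG(B_R(x_0))$: a measurable function $u:B_R(x_0)\to\mathbb{R}$ belongs to $DG(B_R(x_0))$ if $u\in W^{1,p}(B_R(x_0))\cap L^\infty(B_R(x_0))$, $\operatorname{ess\,sup}_{B_R(x_0)}|u|\leqslant M$, and there exist numbers $1<p<q$, $c_1>0$ such that for any ball $B_{8r}(x_0)\subset B_R(x_0)$, any $k\in\mathbb{R}$ with $|k|<M$, any $\sigma\in(0,1)$ and any $\zeta\in C_0^\infty(B_r(x_0))$ with $0\leqslant\zeta\leqslant1$, $\zeta=1$ in $B_{r(1-\sigma)}(x_0)$, $|\nabla\zeta|\leqslant(\sigma r)^{-1}$, the following inequalities hold (for both signs): $$\int_{A^{\pm}_{k,r}}\Big(\frac{M_{\pm}(u,k,r)}{r}\Big)^{p(|x-x_{0}|)}|\nabla u|^{p}\,\zeta^{q}\,dx\leqslant c_{1}\,\sigma^{-q}\Big(\frac{M_{\pm}(u,k,r)}{r}\Big)^{p}\int_{A^{\pm}_{k,r}}\Big(\frac{M_{\pm}(u,k,r)}{r}\Big)^{p(|x-x_{0}|)}dx,$$ where $(u-k)_\pm:=\max\{\pm(u-k),0\}$, $A^\pm_{k,r}:=B_r(x_0)\cap\{(u-k)_\pm>0\}$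 and $M_\pm(u,k,r):=\sup_{B_r(x_0)}(u-k)_\pm$ (essential supremum). H\"older continuity at $x_0$ means: there exist $\beta\in(0,1)$, $C>0$ and $r_0>0$ such that $\operatorname{ess\,sup}_{B_r(x_0)}u-\operatorname{ess\,inf}_{B_r(x_0)}u\leqslant C r^\beta$ for all $0<r<r_0$.
   Formalization: The cutoff bound |∇ζ| ≤ (σr)^{-1} is replaced by |∇ζ| ≤ γ(σr)^{-1} for some γ > 1 (chosen with p, q, c_1), since with the literal bound no such ζ exists and the claim fails, e.g. for x_1/|x|. *)

theory Defs
  imports "HOL-Analysis.Analysis" "HOL-Probability.Essential_Supremum"
begin

primrec Ck :: "nat \<Rightarrow> ('a::euclidean_space \<Rightarrow> real) \<Rightarrow> bool" where
  "Ck 0 f \<longleftrightarrow> continuous_on UNIV f"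
| "Ck (Suc m) f \<longleftrightarrow> (\<forall>x. f differentiable (at x)) \<and>
     (\<forall>i\<in>Basis. Ck m (\<lambda>x. frechet_derivative f (at x) i))"

text \<open>A function in \<open>C_0^\<infinity>(\<Omega>)\<close> is represented by its extension by zero to the whole space.\<close>

definition test_functions :: "'a::euclidean_space set \<Rightarrow> ('a \<Rightarrow> real) set" where
  "test_functions \<Omega> = {f. (\<forall>m. Ck m f) \<and>
     compact (closure {x. f x \<noteq> 0}) \<and> closure {x. f x \<noteq> 0} \<subseteq> \<Omega>}"

definition grad :: "('a::euclidean_space \<Rightarrow> real) \<Rightarrow> 'a \<Rightarrow> 'a" where
  "grad f x = (\<Sum>i\<in>Basis. frechet_derivative f (at x) i *\<^sub>R i)"

definition Lp_on :: "real \<Rightarrow> 'a::euclidean_space set \<Rightarrow> ('a \<Rightarrow> 'b::euclidean_space) set" where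
  "Lp_on p \<Omega> = {f \<in> borel_measurable (lebesgue_on \<Omega>).
     integrable (lebesgue_on \<Omega>) (\<lambda>x. norm (f x) powr p)}"

text \<open>\<open>W1p_with_gradient p \<Omega> u g\<close>: \<open>u \<in> W\<^sup>1\<^sup>,\<^sup>p(\<Omega>)\<close> and \<open>g\<close> is (a representative of) its weak gradient.\<close>

definition W1p_with_gradient ::
    "real \<Rightarrow> 'a::euclidean_space set \<Rightarrow> ('a \<Rightarrow> real) \<Rightarrow> ('a \<Rightarrow> 'a) \<Rightarrow> bool" where
  "W1p_with_gradient p \<Omega> u g \<longleftrightarrow> u \<in> Lp_on p \<Omega> \<and> g \<in> Lp_on p \<Omega> \<and>
     (\<forall>\<phi>\<in>test_functions \<Omega>. \<forall>i\<in>Basis.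
        (LINT x|lebesgue_on \<Omega>. u x * frechet_derivative \<phi> (at x) i) =
        - (LINT x|lebesgue_on \<Omega>. (g x \<bullet> i) * \<phi> x))"

definition ess_sup_on :: "'a::euclidean_space set \<Rightarrow> ('a \<Rightarrow> real) \<Rightarrow> ereal" where
  "ess_sup_on A f = esssup (lebesgue_on A) (\<lambda>x. ereal (f x))"

definition ess_inf_on :: "'a::euclidean_space set \<Rightarrow> ('a \<Rightarrow> real) \<Rightarrow> ereal" where
  "ess_inf_on A f = - ess_sup_on A (\<lambda>x. - f x)"

text \<open>In the next three definitions the sign \<open>\<plusminus>\<close> is encoded by a real number \<open>s \<in> {1, -1}\<close>.\<close>

definition trunc :: "real \<Rightarrow> ('a \<Rightarrow> real) \<Rightarrow> real \<Rightarrow> 'a \<Rightarrow> real" where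
  "trunc s u k x = max (s * (u x - k)) 0"

definition level_set :: "real \<Rightarrow> 'a::euclidean_space \<Rightarrow> ('a \<Rightarrow> real) \<Rightarrow> real \<Rightarrow> real \<Rightarrow> 'a set" where
  "level_set s x\<^sub>0 u k r = {x \<in> ball x\<^sub>0 r. trunc s u k x > 0}"

text \<open>The essential supremum is finite, so \<open>real_of_ereal\<close> is harmless: it is only used for
  essentially bounded \<open>u\<close>.\<close>

definition M_trunc :: "real \<Rightarrow> 'a::euclidean_space \<Rightarrow> ('a \<Rightarrow> real) \<Rightarrow> real \<Rightarrow> real \<Rightarrow> real" where
  "M_trunc s x\<^sub>0 u k r = real_of_ereal (ess_sup_on (ball x\<^sub>0 r) (trunc s u k))"

definition var_exp :: "real \<Rightarrow> real \<Rightarrow> real" where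
  "var_exp L s = L * (ln (ln (1 / s)) / ln (1 / s))"

definition cutoffs :: "real \<Rightarrow> 'a::euclidean_space \<Rightarrow> real \<Rightarrow> real \<Rightarrow> ('a \<Rightarrow> real) set" where
  "cutoffs \<gamma> x\<^sub>0 r \<sigma> = {\<zeta> \<in> test_functions (ball x\<^sub>0 r).
     (\<forall>x. 0 \<le> \<zeta> x \<and> \<zeta> x \<le> 1) \<and> (\<forall>x\<in>ball x\<^sub>0 (r * (1 - \<sigma>)). \<zeta> x = 1) \<and>
     (\<forall>x. norm (grad \<zeta> x) \<le> \<gamma> / (\<sigma> * r))}"

text \<open>The bound \<open>|\<nabla>\<zeta>| \<le> (\<sigma>r)\<^sup>-\<^sup>1\<close> has to be read up to a constant \<open>\<gamma> > 1\<close>. With \<open>\<gamma> = 1\<close>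
  there are no cutoffs at all, since such a \<open>\<zeta>\<close> would have to fall from 1 to 0 over a distance
  strictly smaller than \<open>\<sigma>r\<close>. The class would then contain every bounded \<open>u \<in> W\<^sup>1\<^sup>,\<^sup>p\<close>, for instance
  \<open>x\<^sub>1/|x|\<close> around the origin. Any \<open>\<gamma> > 1\<close> is allowed below: \<open>cutoffs\<close> grows with \<open>\<gamma>\<close>, so every
  fixed choice of \<open>\<gamma> > 1\<close> gives a smaller class.\<close>

lemma frechet_derivative_eq_grad:
  fixes f :: "'a::euclidean_space \<Rightarrow> real"
  assumes "f differentiable (at x)"
  shows "frechet_derivative f (at x) v = grad f x \<bullet> v"
proof -
  have lin: "linear (frechet_derivative f (at x))"
    using assms by (rule linear_frechet_derivative)
  have "frechet_derivative f (at x) v = frechet_derivative f (at x) (\<Sum>i\<in>Basis. (v \<bullet> i) *\<^sub>R i)"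
    by (simp add: euclidean_representation)
  also have "\<dots> = (\<Sum>i\<in>Basis. (v \<bullet> i) * frechet_derivative f (at x) i)"
    by (simp add: linear_sum[OF lin] linear_cmul[OF lin])
  finally show ?thesis
    by (simp add: grad_def inner_sum_left inner_commute[of v] mult.commute)
qed

lemma cutoffs_1_empty:
  assumes "r > 0" "0 < \<sigma>" "\<sigma> < 1"
  shows "cutoffs 1 (x\<^sub>0::'a::euclidean_space) r \<sigma> = {}"
proof (rule ccontr)
  assume "cutoffs 1 x\<^sub>0 r \<sigma> \<noteq> {}"
  then obtain \<zeta> where z: "\<zeta> \<in> cutoffs 1 x\<^sub>0 r \<sigma>" by blast
  have "Ck (Suc 0) \<zeta>" using z by (auto simp: cutoffs_def test_functions_def simp del: Ck.simps)
  then have diff: "\<zeta> differentiable (at x)" for x by simp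
  have supp: "closure {x. \<zeta> x \<noteq> 0} \<subseteq> ball x\<^sub>0 r"
    and one: "\<And>x. x \<in> ball x\<^sub>0 (r * (1 - \<sigma>)) \<Longrightarrow> \<zeta> x = 1"
    and gb: "\<And>x. norm (grad \<zeta> x) \<le> 1 / (\<sigma> * r)"
    using z by (auto simp: cutoffs_def test_functions_def)
  have lip: "norm (\<zeta> x - \<zeta> y) \<le> 1 / (\<sigma> * r) * norm (x - y)" for x y
  proof (rule differentiable_bound[where S=UNIV and f'="\<lambda>x. frechet_derivative \<zeta> (at x)"])
    fix w :: 'a
    show "(\<zeta> has_derivative frechet_derivative \<zeta> (at w)) (at w within UNIV)"
      using diff frechet_derivative_works by auto
    show "onorm (frechet_derivative \<zeta> (at w)) \<le> 1 / (\<sigma> * r)"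
    proof (rule onorm_le)
      fix v
      have "norm (frechet_derivative \<zeta> (at w) v) \<le> norm (grad \<zeta> w) * norm v"
        by (simp add: frechet_derivative_eq_grad[OF diff] Cauchy_Schwarz_ineq2)
      also have "\<dots> \<le> 1 / (\<sigma> * r) * norm v"
        using gb by (intro mult_right_mono) auto
      finally show "norm (frechet_derivative \<zeta> (at w) v) \<le> 1 / (\<sigma> * r) * norm v" .
    qed
  qed auto
  obtain b :: 'a where b: "b \<in> Basis" using nonempty_Basis by blast
  define y where "y t = x\<^sub>0 + t *\<^sub>R b" for t :: real
  have nz: "\<zeta> (y t) \<noteq> 0" if t: "max 0 (\<sigma> * r) < t" "t < r" for t
  proof -
    have "max 0 (t - \<sigma> * r) < r * (1 - \<sigma>)" using t assms by (auto simp: algebra_simps)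
    then obtain s where s: "0 < s" "t - \<sigma> * r < s" "s < r * (1 - \<sigma>)"
      using dense[of "max 0 (t - \<sigma> * r)" "r * (1 - \<sigma>)"] by auto
    have "y s \<in> ball x\<^sub>0 (r * (1 - \<sigma>))" using s b by (simp add: y_def dist_norm)
    then have 1: "\<zeta> (y s) = 1" by (rule one)
    have "y s - y t = (s - t) *\<^sub>R b" by (simp add: y_def algebra_simps)
    then have n: "norm (y s - y t) = \<bar>s - t\<bar>" using b by simp
    have "\<bar>s - t\<bar> < \<sigma> * r \<or> s > t" using s by auto
    then have "\<bar>s - t\<bar> < \<sigma> * r \<or> (s > t \<and> t < r * (1 - \<sigma>))" using s by auto
    then show ?thesis
    proof
      assume "\<bar>s - t\<bar> < \<sigma> * r"
      then have "1 / (\<sigma> * r) * norm (y s - y t) < 1" using n assms by (simp add: field_simps)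
      then show ?thesis using lip[of "y s" "y t"] 1 by auto
    next
      assume "s > t \<and> t < r * (1 - \<sigma>)"
      then have "y t \<in> ball x\<^sub>0 (r * (1 - \<sigma>))" using t b by (simp add: y_def dist_norm)
      then show ?thesis using one by force
    qed
  qed
  have lt: "max 0 (\<sigma> * r) < r" using assms by auto
  have "y r \<in> closure (y ` {max 0 (\<sigma> * r)<..<r})"
  proof -
    have "continuous_on (closure {max 0 (\<sigma> * r)<..<r}) y"
      unfolding y_def by (intro continuous_intros)
    then have "y ` closure {max 0 (\<sigma> * r)<..<r} \<subseteq> closure (y ` {max 0 (\<sigma> * r)<..<r})"
      by (rule image_closure_subset) (auto simp: closure_subset)
    then show ?thesis using lt by auto
  qed
  also have "\<dots> \<subseteq> closure {x. \<zeta> x \<noteq> 0}" using nz by (intro closure_mono) auto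
  also have "\<dots> \<subseteq> ball x\<^sub>0 r" by (rule supp)
  finally show False using b assms by (simp add: y_def dist_norm)
qed

definition DG_class :: "real \<Rightarrow> real \<Rightarrow> 'a::euclidean_space \<Rightarrow> real \<Rightarrow> ('a \<Rightarrow> real) set" where
  "DG_class L M x\<^sub>0 R = {u \<in> borel_measurable (lebesgue_on (ball x\<^sub>0 R)).
     ess_sup_on (ball x\<^sub>0 R) (\<lambda>x. \<bar>u x\<bar>) \<le> ereal M \<and>
     (\<exists>p q c\<^sub>1 \<gamma> g. 1 < p \<and> p < q \<and> 0 < c\<^sub>1 \<and> 1 < \<gamma> \<and>
        W1p_with_gradient p (ball x\<^sub>0 R) u g \<and>
        (\<forall>r k \<sigma>. \<forall>\<zeta>\<in>cutoffs \<gamma> x\<^sub>0 r \<sigma>. \<forall>s\<in>{1, -1}.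
           0 < r \<and> ball x\<^sub>0 (8 * r) \<subseteq> ball x\<^sub>0 R \<and> \<bar>k\<bar> < M \<and> 0 < \<sigma> \<and> \<sigma> < 1 \<longrightarrow>
           (LINT x|lebesgue_on (level_set s x\<^sub>0 u k r).
              (M_trunc s x\<^sub>0 u k r / r) powr var_exp L (norm (x - x\<^sub>0)) *
              norm (g x) powr p * \<zeta> x powr q)
           \<le> c\<^sub>1 * \<sigma> powr (- q) * (M_trunc s x\<^sub>0 u k r / r) powr p *
              (LINT x|lebesgue_on (level_set s x\<^sub>0 u k r).
                 (M_trunc s x\<^sub>0 u k r / r) powr var_exp L (norm (x - x\<^sub>0)))))}"

definition ess_holder_at :: "('a::euclidean_space \<Rightarrow> real) \<Rightarrow> 'a \<Rightarrow> bool" where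
  "ess_holder_at u x\<^sub>0 \<longleftrightarrow> (\<exists>\<beta> C r\<^sub>0. 0 < \<beta> \<and> \<beta> < 1 \<and> 0 < C \<and> 0 < r\<^sub>0 \<and>
     (\<forall>r. 0 < r \<and> r < r\<^sub>0 \<longrightarrow>
        ess_sup_on (ball x\<^sub>0 r) u - ess_inf_on (ball x\<^sub>0 r) u \<le> ereal (C * r powr \<beta>)))"

end

theory Submission
  imports Defs
begin

text \<open>
  On \<open>B\<^sub>r(x\<^sub>0)\<close> the weight \<open>(M\<^sub>\<plusminus>/r)\<^bsup>p(|x-x\<^sub>0|)\<^esup>\<close> is at most its value \<open>T\<close> at \<open>|x - x\<^sub>0| = r\<close>, and for small
  \<open>r\<close>, at least \<open>T\<close> times an arbitrarily small fixed power of \<open>|x - x\<^sub>0|/r\<close>. Dividing by \<open>T\<close> gives an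
  energy inequality with a mild power weight, and a Young-type inequality turns it into a bound for the
  \<open>L\<^sup>1\<close> norm of the gradient between two levels that loses only a small power of the measure of the
  set. This loss is absorbed by the gain in De Giorgi's isoperimetric inequality
  \<open>(l - k) |E| |F| \<le> C r |B\<^sub>r| (|E|/|B\<^sub>r|)\<^bsup>1/(n+1)\<^esup> \<integral>|\<nabla>u|\<close>, the integral being over \<open>{k < u < l}\<close>, with
  \<open>E = {u \<ge> l}\<close> and \<open>F = {u \<le> k}\<close>. A pigeonhole argument over dyadic levels
  makes a superlevel set small and De Giorgi's iteration removes it, so the oscillation decreases by a fixed
  factor from \<open>B\<^sub>r\<close> to \<open>B\<^bsub>r/4\<^esub>\<close> unless it is already of order \<open>r\<close>.

  No mollification is needed: testing the weak gradient with translates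
  of a test function shows that \<open>u\<close> is absolutely continuous along almost every segment, and a segment
  from \<open>E\<close> to \<open>F\<close> must cross the layer \<open>{k < u < l}\<close>.
\<close>

section \<open>Smooth functions and cutoffs\<close>

text \<open>The class controls \<open>u\<close> only through inequalities quantified over cutoffs,
  so a cutoff must be produced for every \<gamma> > 1, however close to 1; an arbitrary smooth step
  is too steep for that.

  The exponents form one chain. Averaging over pairs of points gives the isoperimetric gain \<theta>
  = 1/(n+1), weaker than the classical 1/n but positive, which is enough. The weight exponent
  (p-1)/4 is chosen so that the Young-type step produces |x - x0|^(-1/4); over a set of relative
  measure d this costs a factor d^(-1/(4n)), at most d^(-\<theta>/2). Half of the gain survives: the
  level sets satisfy a recursion with power 1 - \<theta>/2 on the right against 1 - \<theta> on the
  left.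

  If the height of the truncation is below r, the value of the weight at |x - x0| = r is its minimum
  instead of its maximum. Replacing the height by some m \<ge> r in the power (m/r)^p compensates
  for this. All later steps therefore require heights of at least r, and this is why the oscillation
  decays only until it is of order r.\<close>

lemma Ck_SucI:
  assumes "\<And>x. (f has_derivative f' x) (at x)" and "\<And>i. i \<in> Basis \<Longrightarrow> Ck m (\<lambda>x. f' x i)"
  shows "Ck (Suc m) f"
proof -
  have "frechet_derivative f (at x) = f' x" for x
    using frechet_derivative_at[OF assms(1)[of x]] by simp
  then show ?thesis using assms by (auto simp: differentiable_def)
qed

lemma Ck_SucD:
  assumes "Ck (Suc m) f"
  shows "Ck m f"
  using assms
proof (induction m arbitrary: f)
  case 0
  then show ?case
    by (auto simp: continuous_on_eq_continuous_at differentiable_imp_continuous_within)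
next
  case (Suc m)
  then show ?case by (subst Ck.simps(2)) (auto simp del: Ck.simps simp: Ck.simps(2)[of "Suc m"])
qed

lemma Ck_Suc_has_derivative:
  assumes "Ck (Suc m) f"
  shows "(f has_derivative frechet_derivative f (at x)) (at x)"
  using assms frechet_derivative_works by auto

lemma Ck_continuous_on:
  assumes "Ck m f"
  shows "continuous_on S f"
proof -
  have "Ck 0 f" using assms by (induction m) (auto dest: Ck_SucD simp del: Ck.simps)
  then show ?thesis by (auto intro: continuous_on_subset)
qed

lemma Ck_const: "Ck m (\<lambda>x. c)"
proof (induction m arbitrary: c)
  case (Suc m)
  show ?case by (rule Ck_SucI[where f'="\<lambda>x h. 0"]) (auto intro: Suc simp del: Ck.simps)
qed simp

lemma Ck_add: "Ck m f \<Longrightarrow> Ck m g \<Longrightarrow> Ck m (\<lambda>x. f x + g x)"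
proof (induction m arbitrary: f g)
  case 0
  then show ?case by (auto intro: continuous_intros)
next
  case (Suc m)
  show ?case
    by (rule Ck_SucI, rule has_derivative_add[OF Ck_Suc_has_derivative[OF Suc.prems(1)]
          Ck_Suc_has_derivative[OF Suc.prems(2)]]) (use Suc in auto)
qed

lemma Ck_mult: "Ck m f \<Longrightarrow> Ck m g \<Longrightarrow> Ck m (\<lambda>x. f x * g x)"
proof (induction m arbitrary: f g)
  case 0
  then show ?case by (auto intro: continuous_intros)
next
  case (Suc m)
  have *: "Ck m f" "Ck m g" using Suc.prems by (auto dest: Ck_SucD simp del: Ck.simps)
  show ?case
    by (rule Ck_SucI, rule has_derivative_mult[OF Ck_Suc_has_derivative[OF Suc.prems(1)]
          Ck_Suc_has_derivative[OF Suc.prems(2)]]) (use Suc * in \<open>auto intro!: Ck_add\<close>)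
qed

lemma Ck_diff: "Ck m f \<Longrightarrow> Ck m g \<Longrightarrow> Ck m (\<lambda>x. f x - g x)"
  using Ck_add[OF _ Ck_mult[OF Ck_const[of m "-1"]], of f g] by simp

lemma Ck_prod: "(\<And>i. i \<in> I \<Longrightarrow> Ck m (f i)) \<Longrightarrow> Ck m (\<lambda>x. \<Prod>i\<in>I. f i x)"
  by (induction I rule: infinite_finite_induct) (auto intro: Ck_const Ck_mult)

lemma Ck_inner: "Ck m (\<lambda>x. x \<bullet> v)"
proof (induction m)
  case (Suc m)
  show ?case by (rule Ck_SucI, rule has_derivative_inner_left[OF has_derivative_ident])
    (simp_all add: Ck_const)
qed (auto intro: continuous_intros)

lemma Ck_translate: "Ck m f \<Longrightarrow> Ck m (\<lambda>x. f (x + c))"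
proof (induction m arbitrary: f)
  case 0
  then show ?case by (auto intro!: continuous_on_compose2[of UNIV f] continuous_intros)
next
  case (Suc m)
  have shift: "((\<lambda>x. x + c) has_derivative (\<lambda>h. h)) (at x)" for x
    by (auto intro!: derivative_eq_intros)
  have "Ck m (\<lambda>x. frechet_derivative f (at (x + c)) i)" if "i \<in> Basis" for i
    by (rule Suc.IH) (use Suc.prems that in simp)
  then show ?case
    by (rule Ck_SucI[OF has_derivative_compose[OF shift Ck_Suc_has_derivative[OF Suc.prems]]])
qed

section \<open>Smooth functions of one real variable: flat exponentials, primitives, steps\<close>

lemma frechet_derivative_real:
  fixes f :: "real \<Rightarrow> real"
  assumes "f differentiable (at t)"
  shows "(f has_real_derivative frechet_derivative f (at t) 1) (at t)"
proof -
  obtain D where "(f has_real_derivative D) (at t)"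
    using assms by (rule real_differentiableE)
  moreover from this have "frechet_derivative f (at t) = (*) D"
    using frechet_derivative_at[of f "(*) D" t] by (simp add: has_field_derivative_def)
  ultimately show ?thesis by simp
qed

lemma Ck_compose:
  fixes h :: "real \<Rightarrow> real"
  assumes "Ck m h" "Ck m f"
  shows "Ck m (\<lambda>x. h (f x))"
  using assms
proof (induction m arbitrary: h)
  case 0
  then show ?case by (auto intro!: continuous_on_compose2[of UNIV h])
next
  case (Suc m)
  have h: "(h has_real_derivative frechet_derivative h (at t) 1) (at t)" for t
    using Suc.prems(1) by (intro frechet_derivative_real) auto
  have "((\<lambda>x. h (f x)) has_derivative
      (\<lambda>v. frechet_derivative h (at (f x)) 1 * frechet_derivative f (at x) v)) (at x)" for x
    using has_derivative_compose[OF Ck_Suc_has_derivative[OF Suc.prems(2)]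
        h[unfolded has_field_derivative_def]] by simp
  moreover have "Ck m (\<lambda>x. frechet_derivative h (at (f x)) 1)"
    by (rule Suc.IH) (use Suc.prems Ck_SucD in \<open>simp_all del: Ck.simps add: Ck.simps(2)[of m h]\<close>)
  ultimately show ?case
    using Suc.prems(2) by (intro Ck_SucI) (assumption, auto intro!: Ck_mult)
qed

lemma Ck_real_SucI:
  fixes f :: "real \<Rightarrow> real"
  assumes "\<And>x. (f has_real_derivative f' x) (at x)" and "Ck m f'"
  shows "Ck (Suc m) f"
  by (rule Ck_SucI[OF assms(1)[unfolded has_field_derivative_def]]) (use assms(2) in simp)

lemma Ck_real_SucD:
  fixes f :: "real \<Rightarrow> real"
  assumes "Ck (Suc m) f"
  obtains f' where "\<And>x. (f has_real_derivative f' x) (at x)" and "Ck m f'"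
proof
  show "Ck m (\<lambda>x. frechet_derivative f (at x) 1)" using assms by simp
  show "(f has_real_derivative frechet_derivative f (at x) 1) (at x)" for x
    using assms by (intro frechet_derivative_real) auto
qed

text \<open>The flat function exp(-1/t) times powers of 1/t. The derivative of a member is a
  combination of two members, so a single induction over the order gives smoothness of the whole
  family.\<close>

definition exp_bump :: "nat \<Rightarrow> real \<Rightarrow> real" where
  "exp_bump k t = (if t > 0 then inverse t ^ k * exp (- inverse t) else 0)"

lemma exp_bump_DERIV:
  "(exp_bump k has_real_derivative (exp_bump (k + 2) t - real k * exp_bump (k + 1) t)) (at t)"
proof (cases t "0::real" rule: linorder_cases)
  case less
  have "((\<lambda>t. 0) has_real_derivative (exp_bump (k + 2) t - real k * exp_bump (k + 1) t)) (at t)"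
    using less by (auto simp: exp_bump_def)
  then show ?thesis
    by (rule has_field_derivative_transform_within_open[where S="{..<0}"])
      (use less in \<open>auto simp: exp_bump_def\<close>)
next
  case greater
  have "((\<lambda>t. inverse t ^ k * exp (- inverse t)) has_real_derivative
      (exp_bump (k + 2) t - real k * exp_bump (k + 1) t)) (at t)"
  proof -
    have 1: "((\<lambda>t. inverse t ^ k) has_real_derivative - real k * inverse t ^ (k + 1)) (at t)"
    proof (cases k)
      case (Suc j)
      have "((\<lambda>t. inverse t ^ Suc j) has_real_derivative
          (1 + real j) * (- (inverse t ^ Suc (Suc 0)) * inverse t ^ j)) (at t)"
        using greater by (intro DERIV_power_Suc DERIV_inverse) auto
      then show ?thesis unfolding Suc by (rule DERIV_cong) (simp add: algebra_simps del: power_inverse)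
    qed simp
    show ?thesis
      using greater
      by (intro DERIV_cong[OF DERIV_mult[OF 1 DERIV_chain2[OF DERIV_exp DERIV_minus[OF DERIV_inverse]]]])
        (simp_all add: exp_bump_def algebra_simps power2_eq_square del: power_inverse)
  qed
  then show ?thesis
    by (rule has_field_derivative_transform_within_open[where S="{0<..}"])
      (use greater in \<open>auto simp: exp_bump_def\<close>)
next
  case equal
  have "((\<lambda>h. exp_bump k h / h) \<longlongrightarrow> 0) (at_right 0)"
  proof -
    \<comment> \<open>With x = 1/h the difference quotient at 0 from the right becomes x^(k+1) / exp
      x.\<close>
    have "((\<lambda>x::real. x ^ (Suc k) / exp x) \<longlongrightarrow> 0) at_top" by (rule tendsto_power_div_exp_0)
    then have "((\<lambda>x::real. inverse x ^ (Suc k) / exp (inverse x)) \<longlongrightarrow> 0) (at_right 0)"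
      by (simp add: filterlim_at_top_to_right)
    then show ?thesis
      by (rule Lim_transform_eventually)
        (auto simp: eventually_at_filter exp_bump_def exp_minus field_simps)
  qed
  moreover have "((\<lambda>h. exp_bump k h / h) \<longlongrightarrow> 0) (at_left 0)"
    by (rule Lim_transform_eventually[OF tendsto_const])
      (auto simp: eventually_at_filter exp_bump_def)
  ultimately have "((\<lambda>h. exp_bump k h / h) \<longlongrightarrow> 0) (at 0)"
    by (simp add: filterlim_split_at)
  then show ?thesis using equal by (simp add: DERIV_def exp_bump_def)
qed

lemma Ck_exp_bump: "Ck m (exp_bump k)"
proof (induction m arbitrary: k)
  case 0
  show ?case using DERIV_continuous_on[OF exp_bump_DERIV[THEN DERIV_subset]] by auto
next
  case (Suc m)
  show ?case by (rule Ck_real_SucI[OF exp_bump_DERIV]) (intro Ck_diff Ck_mult Ck_const Suc)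
qed

lemma Ck_primitive:
  fixes f :: "real \<Rightarrow> real"
  assumes "\<And>m. Ck m f"
  obtains F where "F a = 0" "\<And>x. (F has_real_derivative f x) (at x)" "\<And>m. Ck m F"
proof -
  obtain F where F: "\<And>x. (F has_real_derivative f x) (at x)"
  proof -
    have "\<exists>F. \<forall>x. -\<infinity> < ereal x \<longrightarrow> ereal x < \<infinity> \<longrightarrow> (F has_vector_derivative f x) (at x)"
      by (rule einterval_antiderivative) (use Ck_continuous_on[OF assms[of 0], of UNIV] in
        \<open>auto simp: continuous_on_eq_continuous_at\<close>)
    then show ?thesis using that by (auto simp: has_real_derivative_iff_has_vector_derivative)
  qed
  have "((\<lambda>x. F x - F a) has_real_derivative f x) (at x)" for x
    by (auto intro!: derivative_eq_intros F)
  moreover from this have "Ck m (\<lambda>x. F x - F a)" for m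
    by (cases m) (auto intro!: Ck_real_SucI[where f'=f] assms Ck_SucD[of 0 f for f] simp del: Ck.simps)
  ultimately show ?thesis using that[of "\<lambda>x. F x - F a"] by auto
qed

lemma Ck_ident: "Ck m (\<lambda>x::real. x)"
  using Ck_inner[of m "1::real"] by simp

lemma Ck_affine:
  fixes f :: "real \<Rightarrow> real"
  assumes "Ck m f"
  shows "Ck m (\<lambda>t. f (a * t + b))"
  by (rule Ck_compose[OF assms]) (intro Ck_add Ck_mult Ck_const Ck_ident)

lemma const_from_DERIV_0:
  fixes f :: "real \<Rightarrow> real"
  assumes "\<And>t. a \<le> t \<Longrightarrow> t \<le> b \<Longrightarrow> (f has_real_derivative 0) (at t)" "a \<le> b"
  shows "f a = f b"
proof (cases "a = b")
  case False
  show ?thesis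
    by (rule DERIV_isconst_end[symmetric])
      (use assms False in \<open>auto intro!: DERIV_continuous_on DERIV_subset[OF assms(1)]\<close>)
qed simp

lemma smooth_step:
  obtains \<psi> :: "real \<Rightarrow> real" where "\<And>m. Ck m \<psi>" "mono \<psi>"
    "\<And>t. t \<le> 0 \<Longrightarrow> \<psi> t = 0" "\<And>t. t \<ge> 1 \<Longrightarrow> \<psi> t = 1"
proof -
  \<comment> \<open>Positive exactly on (0, 1), so its primitive is constant on either side.\<close>
  define b where "b t = exp_bump 0 t * exp_bump 0 (1 - t)" for t
  have "Ck m b" for m
    using Ck_mult[OF Ck_exp_bump Ck_affine[OF Ck_exp_bump, of m 0 "-1" 1], of 0]
    by (simp add: b_def[abs_def])
  then obtain F where F: "F 0 = 0" "\<And>x. (F has_real_derivative b x) (at x)" "\<And>m. Ck m F"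
    by (rule Ck_primitive[of b 0]) blast
  have b0: "b t \<ge> 0" for t by (simp add: b_def exp_bump_def)
  have b_out: "b t = 0" if "t \<le> 0 \<or> t \<ge> 1" for t using that by (auto simp: b_def exp_bump_def)
  have "F 0 < F 1"
    by (rule DERIV_pos_imp_increasing_open)
      (use F(2) in \<open>auto simp: b_def exp_bump_def intro!: exI DERIV_continuous_on DERIV_subset[OF F(2)]\<close>)
  then have F1: "F 1 > 0" using F by simp
  have monoF: "F s \<le> F t" if "s \<le> t" for s t
    by (rule DERIV_nonneg_imp_nondecreasing[OF that]) (use F(2) b0 in blast)
  show ?thesis
  proof
    show "Ck m (\<lambda>t. inverse (F 1) * F t)" for m by (intro Ck_mult Ck_const F)
    show "mono (\<lambda>t. inverse (F 1) * F t)"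
      using F1 monoF by (auto intro!: monoI mult_left_mono)
    show "inverse (F 1) * F t = 0" if "t \<le> 0" for t
      using const_from_DERIV_0[of t 0 F] F b_out that by (metis mult_zero_right)
    show "inverse (F 1) * F t = 1" if "t \<ge> 1" for t
      using const_from_DERIV_0[of 1 t F] F(2) b_out that F1
      by (metis left_inverse less_irrefl)
  qed
qed

text \<open>If \<open>G\<close> is a primitive of a smooth step \<open>\<psi>\<close>, then G(s) -
  G(s - K) climbs from 0 to K with slope \<psi>(s) - \<psi>(s - K), which never exceeds 1. For large
  \<open>K\<close> this climb is nearly linear, so the rescaled slope can be as close to 1 as
  desired.\<close>

lemma nearly_linear_step:
  fixes \<gamma> :: real
  assumes "\<gamma> > 1"
  obtains \<eta> \<eta>' c where "\<And>m. Ck m \<eta>" "c < 1" "\<And>t. t \<le> 0 \<Longrightarrow> \<eta> t = 0" "\<And>t. t \<ge> c \<Longrightarrow> \<eta> t = 1"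
    "\<And>t. (\<eta> has_real_derivative \<eta>' t) (at t)" "\<And>t. 0 \<le> \<eta>' t" "\<And>t. \<eta>' t \<le> \<gamma>"
    "\<And>t. 0 \<le> \<eta> t" "\<And>t. \<eta> t \<le> 1"
proof -
  obtain \<psi> :: "real \<Rightarrow> real" where \<psi>: "\<And>m. Ck m \<psi>" "mono \<psi>"
    "\<And>t. t \<le> 0 \<Longrightarrow> \<psi> t = 0" "\<And>t. t \<ge> 1 \<Longrightarrow> \<psi> t = 1" by (rule smooth_step) blast
  have \<psi>01: "0 \<le> \<psi> t" "\<psi> t \<le> 1" for t
    using monoD[OF \<psi>(2), of "min 0 t" t] monoD[OF \<psi>(2), of t "max 1 t"] \<psi>(3,4) by auto
  obtain G where G: "G 0 = 0" "\<And>x. (G has_real_derivative \<psi> x) (at x)" "\<And>m. Ck m G"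
    by (rule Ck_primitive[of \<psi> 0, OF \<psi>(1)]) blast
  \<comment> \<open>N / K = 1 + 2 / K = \<gamma> is the maximal slope after rescaling, and N > K + 1
    makes the transition end at (K + 1) / N < 1.\<close>
  define K where "K = 2 / (\<gamma> - 1)"
  define N where "N = K + 2"
  have K: "K > 0" and N: "N / K = \<gamma>" "N > 0"
    using assms by (auto simp: K_def N_def field_simps add_pos_pos)
  define \<eta> where "\<eta> t = (G (N * t) - G (N * t - K)) / K" for t
  define \<eta>' where "\<eta>' t = N * (\<psi> (N * t) - \<psi> (N * t - K)) / K" for t
  have d: "(\<eta> has_real_derivative \<eta>' t) (at t)" for t
    unfolding \<eta>_def[abs_def] \<eta>'_def
    using K by (auto intro!: derivative_eq_intros DERIV_chain2[OF G(2)] simp: field_simps)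
  have d0: "0 \<le> \<eta>' t" for t
    using monoD[OF \<psi>(2), of "N * t - K" "N * t"] K N by (auto simp: \<eta>'_def)
  have d1: "\<eta>' t \<le> \<gamma>" for t
  proof -
    have "\<psi> (N * t) - \<psi> (N * t - K) \<le> 1" using \<psi>01[of "N * t"] \<psi>01[of "N * t - K"] by linarith
    then have "N / K * (\<psi> (N * t) - \<psi> (N * t - K)) \<le> N / K * 1"
      using K N by (intro mult_left_mono) auto
    moreover have "\<eta>' t = N / K * (\<psi> (N * t) - \<psi> (N * t - K))" by (simp add: \<eta>'_def)
    ultimately show ?thesis using N(1) by simp
  qed
  have lo: "\<eta> t = 0" if "t \<le> 0" for t
  proof -
    have "N * t \<le> 0" using that N by (simp add: mult_nonneg_nonpos)
    moreover have "G s = 0" if "s \<le> 0" for s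
      using const_from_DERIV_0[of s 0 G] G(1,2) \<psi>(3) that by (metis)
    ultimately show ?thesis using K by (simp add: \<eta>_def)
  qed
  have hi: "\<eta> t = 1" if "t \<ge> (K + 1) / N" for t
  proof -
    have *: "N * t - K \<ge> 1" using that N by (simp add: field_simps)
    \<comment> \<open>\<open>\<psi>\<close> is 1 on the interval from N t - K to N t, so
      \<open>G\<close> grows there by exactly its length \<open>K\<close>.\<close>
    have "G (N * t - K) - (N * t - K) = G (N * t) - N * t"
    proof (rule const_from_DERIV_0[of "N * t - K" "N * t" "\<lambda>s. G s - s"])
      fix s assume "N * t - K \<le> s"
      then show "((\<lambda>s. G s - s) has_real_derivative 0) (at s)"
        using * \<psi>(4)[of s] by (auto intro!: derivative_eq_intros G(2))
    qed (use K in auto)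
    then show ?thesis using K by (simp add: \<eta>_def)
  qed
  have mono: "\<eta> s \<le> \<eta> t" if "s \<le> t" for s t
    by (rule DERIV_nonneg_imp_nondecreasing[OF that]) (use d d0 in blast)
  show ?thesis
  proof (rule that[of \<eta> "(K + 1) / N" \<eta>'])
    have "Ck m (\<lambda>t. inverse K * (G (N * t + 0) - G (N * t + (- K))))" for m
      by (rule Ck_mult[OF Ck_const Ck_diff[OF Ck_affine[OF G(3)] Ck_affine[OF G(3)]]])
    then show "Ck m \<eta>" for m
      by (simp add: \<eta>_def[abs_def] divide_inverse mult.commute)
    show "(K + 1) / N < 1" using N by (simp add: N_def)
    show "0 \<le> \<eta> t" for t using mono[of "min 0 t" t] lo[of "min 0 t"] by simp
    show "\<eta> t \<le> 1" for t using mono[of t "max t ((K+1)/N)"] hi[of "max t ((K+1)/N)"] by simp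
  qed (use d d0 d1 lo hi in auto)
qed

section \<open>Radial functions and the construction of cutoffs\<close>

lemma DERIV_zero_of_vanishing:
  fixes H :: "real \<Rightarrow> real"
  assumes "(H has_real_derivative D) (at t)" "\<And>t. t \<le> a \<Longrightarrow> H t = 0" "t < a"
  shows "D = 0"
proof -
  have "((\<lambda>t. 0) has_real_derivative D) (at t)"
    by (rule has_field_derivative_transform_within_open[OF assms(1), of "{..<a}"]) (use assms in auto)
  then show ?thesis using DERIV_const DERIV_unique by blast
qed

text \<open>Division by t is harmless because the numerator vanishes around 0, where x / 0 = 0 is
  the right value. The quotient rule yields two quotients of the same kind, so the induction
  closes.\<close>

lemma Ck_divide_ident:
  fixes H :: "real \<Rightarrow> real"
  assumes "Ck m H" "a > 0" "\<And>t. t \<le> a \<Longrightarrow> H t = 0"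
  shows "Ck m (\<lambda>t. H t / t)"
  using assms
proof (induction m arbitrary: H a)
  case 0
  have "isCont (\<lambda>t. H t / t) t" for t
  proof (cases "t < a")
    case True
    have "isCont (\<lambda>t. 0::real) t" by simp
    moreover have "eventually (\<lambda>s. H s / s = 0) (nhds t)"
      unfolding eventually_nhds by (intro exI[of _ "{..<a}"]) (use 0 True in auto)
    ultimately show ?thesis using isCont_cong[of "\<lambda>t. H t / t" "\<lambda>t. 0" t] by blast
  next
    case False
    then show ?thesis using 0 by (auto intro!: continuous_intros simp: continuous_on_eq_continuous_at)
  qed
  then show ?case by (simp add: continuous_on_eq_continuous_at)
next
  case (Suc m)
  obtain H' where H': "\<And>x. (H has_real_derivative H' x) (at x)" "Ck m H'"
    using Ck_real_SucD[OF Suc.prems(1)] by blast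
  have z: "H' t = 0" if "t < a" for t
    using that Suc.prems(3) by (intro DERIV_zero_of_vanishing[OF H'(1)])
  have q: "Ck m (\<lambda>t. H t / t)" by (rule Suc.IH[OF Ck_SucD[OF Suc.prems(1)] Suc.prems(2,3)])
  have "((\<lambda>t. H t / t) has_real_derivative H' t / t - H t / t / t) (at t)" for t
  proof (cases "t < a")
    case True
    have "((\<lambda>t. 0) has_real_derivative 0) (at t)" by simp
    then have "((\<lambda>t. H t / t) has_real_derivative 0) (at t)"
      by (rule has_field_derivative_transform_within_open[of _ _ _ "{..<a}"])
        (use True Suc.prems(3) in auto)
    then show ?thesis using True z Suc.prems by simp
  next
    case False
    then show ?thesis using Suc.prems(2)
      by (auto intro!: derivative_eq_intros H' simp: field_simps)
  qed
  \<comment> \<open>\<open>H'\<close> is known to vanish only for t < a, while the induction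
    hypothesis wants a closed half-line; hence the threshold a/2.\<close>
  moreover have "Ck m (\<lambda>t. H' t / t)"
    by (rule Suc.IH[of _ "a/2"]) (use H' z Suc.prems in auto)
  moreover have "Ck m (\<lambda>t. H t / t / t)"
    by (rule Suc.IH[OF q, of a]) (use Suc.prems in auto)
  ultimately show ?case by (rule Ck_real_SucI[OF _ Ck_diff])
qed

text \<open>The norm is not differentiable at 0, but the composite is identically 0 on a ball there,
  and the formula also gives 0 at that point.\<close>

lemma has_derivative_radial:
  fixes H :: "real \<Rightarrow> real"
  assumes H: "(H has_real_derivative H') (at (norm x))" and "a > 0" "\<And>t. t \<le> a \<Longrightarrow> H t = 0"
  shows "((\<lambda>x. H (norm x)) has_derivative (\<lambda>v. H' / norm x * (x \<bullet> v))) (at (x::'a::euclidean_space))"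
proof (cases "x = 0")
  case True
  have "((\<lambda>x. 0) has_derivative (\<lambda>v. H' / norm x * (x \<bullet> v))) (at x)" using True by simp
  then show ?thesis
    by (rule has_derivative_transform_within_open[of _ _ _ _ "ball 0 a"]) (use assms True in auto)
next
  case False
  show ?thesis
    by (rule has_derivative_eq_rhs[OF has_derivative_compose[OF has_derivative_norm[OF False]
          H[unfolded has_field_derivative_def]]]) (auto simp: sgn_div_norm field_simps inner_commute)
qed

text \<open>The partial derivative along \<open>i\<close> is the radial factor H'(|x|)/|x| times the
  linear function x . i, and that factor again comes from a profile vanishing near 0.\<close>

lemma Ck_radial:
  fixes H :: "real \<Rightarrow> real"
  assumes "Ck m H" "a > 0" "\<And>t. t \<le> a \<Longrightarrow> H t = 0"
  shows "Ck m (\<lambda>x::'a::euclidean_space. H (norm x))"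
  using assms
proof (induction m arbitrary: H a)
  case 0
  then show ?case by (auto intro!: continuous_on_compose2[of UNIV H] continuous_intros)
next
  case (Suc m)
  obtain H' where H': "\<And>x. (H has_real_derivative H' x) (at x)" "Ck m H'"
    using Ck_real_SucD[OF Suc.prems(1)] by blast
  have z: "H' t = 0" if "t < a" for t
    using that Suc.prems(3) by (intro DERIV_zero_of_vanishing[OF H'(1)])
  have "Ck m (\<lambda>t. H' t / t)"
    by (rule Ck_divide_ident[of _ _ "a/2"]) (use H' z Suc.prems in auto)
  then have "Ck m (\<lambda>x::'a. H' (norm x) / norm x)"
    by (rule Suc.IH[of "\<lambda>t. H' t / t" "a/2"]) (use z Suc.prems in auto)
  then show ?case
    by (intro Ck_SucI[OF has_derivative_radial[OF H'(1) Suc.prems(2,3)]] Ck_mult Ck_inner)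
qed

lemma grad_eqI:
  assumes "(f has_derivative (\<lambda>v. w \<bullet> v)) (at x)"
  shows "grad f x = w"
proof -
  have "frechet_derivative f (at x) = (\<bullet>) w" using frechet_derivative_at[OF assms] by simp
  then show ?thesis by (simp add: grad_def euclidean_representation)
qed

text \<open>Without a cutoff the inequalities of \<open>DG_class\<close> would be void. The one used
  is 1 - H(|x - x0|), with \<open>H\<close> the nearly linear step stretched to the radii between
  \<open>r * (1 - \<sigma>)\<close> and \<open>r\<close>.\<close>

lemma cutoffs_nonempty:
  assumes "\<gamma> > 1" "r > 0" "0 < \<sigma>" "\<sigma> < 1"
  shows "cutoffs \<gamma> (x0::'a::euclidean_space) r \<sigma> \<noteq> {}"
proof -
  obtain \<eta> \<eta>' c where \<eta>: "\<And>m. Ck m \<eta>" "c < 1" "\<And>t. t \<le> 0 \<Longrightarrow> \<eta> t = 0" "\<And>t. t \<ge> c \<Longrightarrow> \<eta> t = 1"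
    "\<And>t. (\<eta> has_real_derivative \<eta>' t) (at t)" "\<And>t. 0 \<le> \<eta>' t" "\<And>t. \<eta>' t \<le> \<gamma>"
    "\<And>t. 0 \<le> \<eta> t" "\<And>t. \<eta> t \<le> 1"
    by (rule nearly_linear_step[OF assms(1)]) blast
  define a where "a = r * (1 - \<sigma>)"
  have a: "a > 0" using assms by (simp add: a_def)
  define d where "d = \<sigma> * r"
  have d: "d > 0" "a + d = r" using assms by (auto simp: d_def a_def algebra_simps)
  define H where "H t = \<eta> ((t - a) / d)" for t
  have H0: "H t = 0" if "t \<le> a" for t using that \<eta>(3)[of "(t - a) / d"] d by (simp add: H_def divide_nonpos_pos)
  have H1: "H t = 1" if "t \<ge> a + c * d" for t
    using that \<eta>(4)[of "(t - a) / d"] d by (simp add: H_def field_simps)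
  have dH: "(H has_real_derivative \<eta>' ((t - a) / d) / d) (at t)" for t
  proof -
    have "((\<lambda>t. (t - a) / d) has_real_derivative 1 / d) (at t)"
      using d by (auto intro!: derivative_eq_intros)
    from DERIV_chain2[OF \<eta>(5) this] show ?thesis by (simp add: H_def[abs_def])
  qed
  define \<zeta> where "\<zeta> x = 1 - H (norm (x - x0))" for x
  have CkH: "Ck m H" for m
    using Ck_affine[OF \<eta>(1), of m "1 / d" "- (a / d)"] by (simp add: H_def[abs_def] diff_divide_distrib)
  have Ck: "Ck m \<zeta>" for m
    using Ck_diff[OF Ck_const[of _ 1] Ck_translate[OF Ck_radial[OF CkH a H0], of _ "- x0"], of m]
    by (simp add: \<zeta>_def[abs_def])
  \<comment> \<open>Since c < 1, the cutoff vanishes from radius a + c d < r on, so its closed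
    support stays in the open ball.\<close>
  have "{x. \<zeta> x \<noteq> 0} \<subseteq> cball x0 (a + c * d)"
  proof
    fix x assume "x \<in> {x. \<zeta> x \<noteq> 0}"
    then have "\<not> a + c * d \<le> norm (x - x0)" using H1 by (auto simp: \<zeta>_def)
    then show "x \<in> cball x0 (a + c * d)" by (simp add: dist_norm norm_minus_commute)
  qed
  then have cl: "closure {x. \<zeta> x \<noteq> 0} \<subseteq> cball x0 (a + c * d)" by (intro closure_minimal) auto
  have "c * d < d" using d \<eta>(2) by simp
  then have "cball x0 (a + c * d) \<subseteq> ball x0 r" using d(2) by auto
  with cl have sub: "closure {x. \<zeta> x \<noteq> 0} \<subseteq> ball x0 r" by blast
  have "norm (grad \<zeta> x) \<le> \<gamma> / (\<sigma> * r)" for x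
  proof -
    let ?y = "x - x0"
    let ?h = "\<eta>' ((norm ?y - a) / d) / d"
    have "((\<lambda>x. x - x0) has_derivative (\<lambda>v. v)) (at x)" by (auto intro!: derivative_eq_intros)
    from has_derivative_compose[OF this has_derivative_radial[OF dH a H0]]
    have "(\<zeta> has_derivative (\<lambda>v. (- (?h / norm ?y) *\<^sub>R ?y) \<bullet> v)) (at x)"
      unfolding \<zeta>_def[abs_def]
      by (intro has_derivative_eq_rhs[OF has_derivative_diff[OF has_derivative_const]]) auto
    then have g: "grad \<zeta> x = - (?h / norm ?y) *\<^sub>R ?y" by (rule grad_eqI)
    have "norm (grad \<zeta> x) \<le> \<bar>?h\<bar>"
      unfolding g by (cases "?y = 0") (auto simp: abs_mult)
    also have "\<dots> = ?h" using \<eta>(6) d by simp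
    also have "\<dots> \<le> \<gamma> / d" using \<eta>(7) d by (simp add: divide_right_mono)
    finally show ?thesis by (simp add: d_def)
  qed
  moreover have "compact (closure {x. \<zeta> x \<noteq> 0})"
    using cl compact_cball by (metis bounded_cball bounded_subset closed_closure compact_eq_bounded_closed)
  moreover have "\<zeta> x = 1" if "x \<in> ball x0 (r * (1 - \<sigma>))" for x
    using that H0[of "norm (x - x0)"] by (simp add: \<zeta>_def a_def dist_norm norm_minus_commute)
  ultimately have "\<zeta> \<in> cutoffs \<gamma> x0 r \<sigma>"
    using Ck sub \<eta>(8,9) by (auto simp: cutoffs_def test_functions_def \<zeta>_def[abs_def] H_def)
  then show ?thesis by blast
qed

section \<open>Weak gradients along lines\<close>

text \<open>Products over the coordinates of steps sharpened by the factor j. As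
  \<open>\<psi>\<close> vanishes at 0, the faces never count: the limit is the indicator of the open
  box, while the supports stay in the closed one.\<close>

lemma box_approx_by_test_functions:
  fixes a b :: "'a::euclidean_space"
  assumes "cbox a b \<subseteq> \<Omega>"
  obtains \<phi> :: "nat \<Rightarrow> 'a \<Rightarrow> real" where "\<And>j. \<phi> j \<in> test_functions \<Omega>"
    "\<And>j x. \<bar>\<phi> j x\<bar> \<le> 1" "\<And>x. (\<lambda>j. \<phi> j x) \<longlonglongrightarrow> indicator (box a b) x"
proof -
  obtain \<psi> :: "real \<Rightarrow> real" where \<psi>: "\<And>m. Ck m \<psi>" "mono \<psi>"
    "\<And>t. t \<le> 0 \<Longrightarrow> \<psi> t = 0" "\<And>t. t \<ge> 1 \<Longrightarrow> \<psi> t = 1" by (rule smooth_step) blast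
  have \<psi>01: "0 \<le> \<psi> t" "\<psi> t \<le> 1" for t
    using monoD[OF \<psi>(2), of "min 0 t" t] monoD[OF \<psi>(2), of t "max 1 t"] \<psi>(3,4) by auto
  let ?l = "\<lambda>j x i. real j * (x \<bullet> i) + (- real j * (a \<bullet> i))"
  let ?r = "\<lambda>j x i. - real j * (x \<bullet> i) + real j * (b \<bullet> i)"
  define \<phi> where "\<phi> j x = (\<Prod>i\<in>Basis. \<psi> (?l j x i) * \<psi> (?r j x i))" for j :: nat and x
  have Ck: "Ck m (\<phi> j)" for m j
    unfolding \<phi>_def[abs_def]
    by (intro Ck_prod Ck_mult Ck_compose[OF Ck_affine[OF \<psi>(1)] Ck_inner])
  have supp: "{x. \<phi> j x \<noteq> 0} \<subseteq> cbox a b" for j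
  proof
    fix x assume x: "x \<in> {x. \<phi> j x \<noteq> 0}"
    show "x \<in> cbox a b"
      unfolding mem_box
    proof
      fix i :: 'a assume i: "i \<in> Basis"
      then have "\<psi> (?l j x i) \<noteq> 0"
        "\<psi> (?r j x i) \<noteq> 0"
        using x by (auto simp: \<phi>_def)
      then have "0 < ?l j x i" "0 < ?r j x i"
        using \<psi>(3) not_le by blast+
      then have "real j * (a \<bullet> i) \<le> real j * (x \<bullet> i)" "real j * (x \<bullet> i) \<le> real j * (b \<bullet> i)" "real j > 0"
        by (auto simp: zero_less_mult_iff intro: Nat.gr0I)
      then show "a \<bullet> i \<le> x \<bullet> i \<and> x \<bullet> i \<le> b \<bullet> i" by simp
    qed
  qed
  then have cl: "closure {x. \<phi> j x \<noteq> 0} \<subseteq> cbox a b" for j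
    by (intro closure_minimal) auto
  have "compact (closure {x. \<phi> j x \<noteq> 0})" for j
    using cl[of j] by (metis bounded_cbox bounded_subset closed_closure compact_eq_bounded_closed)
  then have test: "\<phi> j \<in> test_functions \<Omega>" for j
    using Ck cl[of j] assms by (auto simp: test_functions_def)
  have bd: "\<bar>\<phi> j x\<bar> \<le> 1" for j x
    unfolding \<phi>_def abs_prod using \<psi>01 by (intro prod_le_1) (auto simp: abs_mult mult_le_one)
  have lim: "(\<lambda>j. \<phi> j x) \<longlonglongrightarrow> indicator (box a b) x" for x
  proof (cases "x \<in> box a b")
    case True
    have "(\<lambda>j. \<psi> (?l j x i) * \<psi> (?r j x i))
        \<longlonglongrightarrow> 1" if i: "i \<in> Basis" for i
    proof -
      have "a \<bullet> i < x \<bullet> i" "x \<bullet> i < b \<bullet> i" using True i by (auto simp: mem_box)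
      define d where "d = min (x \<bullet> i - a \<bullet> i) (b \<bullet> i - x \<bullet> i)"
      have d: "d > 0" using \<open>a \<bullet> i < x \<bullet> i\<close> \<open>x \<bullet> i < b \<bullet> i\<close> by (simp add: d_def)
      have "eventually (\<lambda>j. real j \<ge> 1 / d) sequentially"
        using eventually_ge_at_top[of "nat \<lceil>1 / d\<rceil>"] by eventually_elim linarith
      then have "eventually (\<lambda>j. \<psi> (?l j x i)
          * \<psi> (?r j x i) = 1) sequentially"
      proof eventually_elim
        case (elim j)
        then have "1 \<le> real j * d" using d by (simp add: field_simps)
        also have "real j * d \<le> real j * (x \<bullet> i - a \<bullet> i)" by (intro mult_left_mono) (auto simp: d_def)
        finally have 1: "1 \<le> ?l j x i" by (simp add: algebra_simps)
        have "1 \<le> real j * d" using d elim by (simp add: field_simps)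
        also have "real j * d \<le> real j * (b \<bullet> i - x \<bullet> i)" by (intro mult_left_mono) (auto simp: d_def)
        finally have "1 \<le> ?r j x i" by (simp add: algebra_simps)
        then show ?case using 1 \<psi>(4) by simp
      qed
      then show ?thesis by (rule tendsto_eventually)
    qed
    then have "(\<lambda>j. \<phi> j x) \<longlonglongrightarrow> (\<Prod>i\<in>(Basis::'a set). 1)"
      unfolding \<phi>_def by (rule tendsto_prod)
    then show ?thesis using True by simp
  next
    case False
    then obtain i where i: "i \<in> Basis" "x \<bullet> i \<le> a \<bullet> i \<or> b \<bullet> i \<le> x \<bullet> i"
      by (auto simp: mem_box not_less)
    have "\<phi> j x = 0" for j
    proof -
      have "?l j x i \<le> 0 \<or> ?r j x i \<le> 0"
        using i(2) by (auto simp: mult_left_mono)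
      then have "\<psi> (?l j x i) * \<psi> (?r j x i) = 0"
        using \<psi>(3) by auto
      then show ?thesis unfolding \<phi>_def using i(1) by (meson finite_Basis prod_zero)
    qed
    then show ?thesis using False by simp
  qed
  show ?thesis by (rule that[of \<phi>]) (use test bd lim in auto)
qed

lemma test_function_measurable:
  assumes "\<phi> \<in> test_functions \<Omega>"
  shows "\<phi> \<in> borel_measurable borel"
  using assms Ck_continuous_on[of 0 \<phi> UNIV]
  by (intro borel_measurable_continuous_onI) (auto simp: test_functions_def simp del: Ck.simps)

text \<open>Dominated convergence makes the integral of \<open>w\<close> over every closed box in
  \<Omega> vanish. The positive and the negative part of \<open>w\<close> are then densities of
  measures that agree on boxes, an intersection-stable generator, so they coincide.\<close>

lemma du_bois_reymond:
  fixes w :: "'a::euclidean_space \<Rightarrow> real"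
  assumes w: "integrable lborel w" and "open \<Omega>"
    and zero: "\<And>\<phi>. \<phi> \<in> test_functions \<Omega> \<Longrightarrow> (LINT x|lborel. w x * \<phi> x) = 0"
  shows "AE x in lborel. x \<in> \<Omega> \<longrightarrow> w x = 0"
proof -
  have [measurable]: "w \<in> borel_measurable borel" using w by auto
  have box0: "(LINT x|lborel. w x * indicator (box a b) x) = 0" if ab: "cbox a b \<subseteq> \<Omega>" for a b
  proof -
    obtain \<phi> :: "nat \<Rightarrow> 'a \<Rightarrow> real" where \<phi>: "\<And>j. \<phi> j \<in> test_functions \<Omega>"
      "\<And>j x. \<bar>\<phi> j x\<bar> \<le> 1" "\<And>x. (\<lambda>j. \<phi> j x) \<longlonglongrightarrow> indicator (box a b) x"
      by (rule box_approx_by_test_functions[OF ab]) blast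
    have [measurable]: "\<phi> j \<in> borel_measurable borel" for j
      using \<phi>(1) by (rule test_function_measurable)
    have "(\<lambda>j. LINT x|lborel. w x * \<phi> j x) \<longlonglongrightarrow> (LINT x|lborel. w x * indicator (box a b) x)"
    proof (rule integral_dominated_convergence[where w="\<lambda>x. \<bar>w x\<bar>"])
      show "AE x in lborel. (\<lambda>j. w x * \<phi> j x) \<longlonglongrightarrow> w x * indicator (box a b) x"
        using \<phi>(3) by (auto intro!: tendsto_intros)
      show "AE x in lborel. norm (w x * \<phi> j x) \<le> \<bar>w x\<bar>" for j
        using \<phi>(2) by (auto simp: abs_mult mult_left_le)
    qed (use w in auto)
    then show ?thesis by (simp add: zero[OF \<phi>(1)] LIMSEQ_const_iff)
  qed
  have AE_box: "AE x in lborel. x \<in> box c d \<longrightarrow> w x = 0" if cd: "cbox c d \<subseteq> \<Omega>" for c d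
  proof -
    define p where "p x = ennreal (max (w x) 0 * indicator (box c d) x)" for x
    define n where "n x = ennreal (max (- w x) 0 * indicator (box c d) x)" for x
    have [measurable]: "p \<in> borel_measurable borel" "n \<in> borel_measurable borel"
      by (auto simp: p_def[abs_def] n_def[abs_def])
    have int: "integrable lborel (\<lambda>x. max (f x) 0 * indicator A x)"
      if f: "integrable lborel f" and [measurable]: "A \<in> sets borel" for f :: "'a \<Rightarrow> real" and A
    proof -
      have [measurable]: "f \<in> borel_measurable borel" using f by auto
      show ?thesis
        by (auto intro!: Bochner_Integration.integrable_bound[OF f] AE_I2 simp: indicator_def)
    qed
    have em: "emeasure (density lborel (\<lambda>x. ennreal (max (f x) 0 * indicator (box c d) x))) A =
        ennreal (LINT x|lborel. max (f x) 0 * indicator (box c d \<inter> A) x)"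
      if f: "integrable lborel f" and [measurable]: "A \<in> sets borel" for f :: "'a \<Rightarrow> real" and A
    proof -
      have [measurable]: "f \<in> borel_measurable borel" using f by auto
      have "emeasure (density lborel (\<lambda>x. ennreal (max (f x) 0 * indicator (box c d) x))) A =
          (\<integral>\<^sup>+x. ennreal (max (f x) 0 * indicator (box c d \<inter> A) x) \<partial>lborel)"
        by (auto simp: emeasure_density intro!: nn_integral_cong split: split_indicator)
      also have "\<dots> = ennreal (LINT x|lborel. max (f x) 0 * indicator (box c d \<inter> A) x)"
        by (rule nn_integral_eq_integral) (auto intro!: int f)
      finally show ?thesis .
    qed
    have w': "integrable lborel (\<lambda>x. - w x)" using w by simp
    note emp = em[OF w, folded p_def] and emn = em[OF w', folded n_def]
    let ?E = "range (\<lambda>(a, b). box a b::'a set)"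
    \<comment> \<open>Both densities are cut off to a fixed box, so the measures are finite and each
      generating box meets it in a box whose closure lies in \<Omega>.\<close>
    have "density lborel p = density lborel n"
    proof (rule measure_eqI_generator_eq)
      show "Int_stable ?E" by (auto simp: Int_stable_def box_Int_box)
      show "?E \<subseteq> Pow (UNIV::'a set)" "sets (density lborel p) = sigma_sets UNIV ?E"
        "sets (density lborel n) = sigma_sets UNIV ?E"
        by (simp_all add: borel_eq_box)
      let ?A = "\<lambda>n::nat. box (- (real n *\<^sub>R One)) (real n *\<^sub>R One) :: 'a set"
      show "range ?A \<subseteq> ?E" "(\<Union>i. ?A i) = UNIV" unfolding UN_box_eq_UNIV by auto
      show "emeasure (density lborel p) (?A i) \<noteq> \<infinity>" for i by (simp add: emp)
      show "emeasure (density lborel p) X = emeasure (density lborel n) X" if X: "X \<in> ?E" for X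
      proof -
        obtain a b where "X = box a b" using X by auto
        then obtain a' b' where eq: "box c d \<inter> X = box a' b'" using box_Int_box by blast
        have "(LINT x|lborel. w x * indicator (box a' b') x) = 0"
        proof (cases "box a' b' = {}")
          case False
          have "cbox a' b' = closure (box a' b')" using False by simp
          also have "\<dots> \<subseteq> closure (box c d)" using eq by (intro closure_mono) auto
          also have "\<dots> \<subseteq> cbox c d" by (intro closure_minimal) (auto simp: box_subset_cbox)
          finally show ?thesis using cd by (intro box0) auto
        qed simp
        also have "(LINT x|lborel. w x * indicator (box a' b') x) =
            (LINT x|lborel. max (w x) 0 * indicator (box a' b') x - max (- w x) 0 * indicator (box a' b') x)"
          by (intro Bochner_Integration.integral_cong) (auto split: split_indicator)
        also have "\<dots> = (LINT x|lborel. max (w x) 0 * indicator (box a' b') x)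
            - (LINT x|lborel. max (- w x) 0 * indicator (box a' b') x)"
          by (rule Bochner_Integration.integral_diff) (auto intro!: int[OF w] int[OF w'])
        finally show ?thesis using X by (subst emp emn, force)+ (simp add: eq)
      qed
    qed
    moreover have "integral\<^sup>N lborel p \<noteq> \<infinity>"
      using emp[of UNIV] by (simp add: emeasure_density)
    ultimately have "AE x in lborel. p x = n x"
      by (subst (asm) finite_density_unique) auto
    then show ?thesis
      by eventually_elim (auto simp: p_def n_def max_def split: if_splits)
  qed
  define \<F> where "\<F> = {box c d | c d. cbox c d \<subseteq> \<Omega>}"
  \<comment> \<open>Countably many boxes suffice, so the exceptional null sets can be
    united.\<close>
  obtain \<G> where \<G>: "\<G> \<subseteq> \<F>" "countable \<G>" "\<Union>\<G> = \<Union>\<F>"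
    by (rule Lindelof[of \<F>]) (auto simp: \<F>_def)
  have sub: "\<Omega> \<subseteq> \<Union>\<F>"
  proof
    fix x assume "x \<in> \<Omega>"
    from open_contains_cbox[OF \<open>open \<Omega>\<close> this] show "x \<in> \<Union>\<F>" by (metis (mono_tags, lifting) UnionI \<F>_def mem_Collect_eq)
  qed
  have "\<forall>X\<in>\<G>. AE x in lborel. x \<in> X \<longrightarrow> w x = 0"
    using \<G>(1) AE_box by (auto simp: \<F>_def)
  then have "AE x in lborel. \<forall>X\<in>\<G>. x \<in> X \<longrightarrow> w x = 0"
    using \<G>(2) by (subst AE_ball_countable) auto
  then show ?thesis
  proof eventually_elim
    case (elim x)
    then show ?case using sub \<G>(3) by blast
  qed
qed

section \<open>Translations and line integrals of the weak gradient\<close>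

lemma nn_integral_lborel_affine:
  fixes f :: "'a::euclidean_space \<Rightarrow> ennreal"
  assumes [measurable]: "f \<in> borel_measurable borel" and "c \<noteq> 0"
  shows "(\<integral>\<^sup>+x. f x \<partial>lborel) = ennreal (\<bar>c\<bar> ^ DIM('a)) * (\<integral>\<^sup>+h. f (t + c *\<^sub>R h) \<partial>lborel)"
  by (subst lborel_affine[OF \<open>c \<noteq> 0\<close>, of t])
    (simp add: nn_integral_density nn_integral_distr nn_integral_cmult)

lemma nn_integral_lborel_shift:
  fixes f :: "'a::euclidean_space \<Rightarrow> ennreal"
  assumes "f \<in> borel_measurable borel"
  shows "(\<integral>\<^sup>+x. f (x + c) \<partial>lborel) = (\<integral>\<^sup>+x. f x \<partial>lborel)"
  using nn_integral_lborel_affine[OF assms, of 1 c] by (simp add: add.commute)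

lemma integrable_lborel_shift:
  fixes f :: "'a::euclidean_space \<Rightarrow> 'b::euclidean_space"
  assumes f: "integrable lborel f"
  shows "integrable lborel (\<lambda>x. f (x + c))"
proof -
  have [measurable]: "f \<in> borel_measurable borel" using f by auto
  show ?thesis
    using f nn_integral_lborel_shift[of "\<lambda>x. ennreal (norm (f x))" c]
    by (auto simp: integrable_iff_bounded)
qed

lemma integral_lborel_shift:
  fixes f :: "'a::euclidean_space \<Rightarrow> real"
  assumes [measurable]: "f \<in> borel_measurable borel"
  shows "(LINT x|lborel. f (x + c)) = (LINT x|lborel. f x)"
  by (subst (2) lborel_affine[of 1 c])
    (simp_all add: integral_distr integral_density density_1 add.commute)

lemma frechet_derivative_translate:
  fixes f :: "'a::euclidean_space \<Rightarrow> real"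
  assumes "\<And>x. f differentiable (at x)"
  shows "frechet_derivative (\<lambda>x. f (x - c)) (at x) = frechet_derivative f (at (x - c))"
proof -
  have "((\<lambda>x. x - c) has_derivative (\<lambda>h. h)) (at x)" by (auto intro!: derivative_eq_intros)
  then have "((\<lambda>x. f (x - c)) has_derivative frechet_derivative f (at (x - c))) (at x)"
    by (rule has_derivative_compose) (use assms frechet_derivative_works in blast)
  then show ?thesis by (rule frechet_derivative_at[symmetric])
qed

lemma test_functions_translate:
  assumes \<phi>: "\<phi> \<in> test_functions \<Omega>" and sub: "\<And>x. x \<in> \<Omega> \<Longrightarrow> x + c \<in> \<Omega>'"
  shows "(\<lambda>x. \<phi> (x - c)) \<in> test_functions \<Omega>'"
proof -
  have *: "{x. \<phi> (x - c) \<noteq> 0} = (+) c ` {x. \<phi> x \<noteq> 0}"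
    by (auto intro!: image_eqI[of _ _ "x - c" for x])
  have cl: "closure {x. \<phi> (x - c) \<noteq> 0} = (+) c ` closure {x. \<phi> x \<noteq> 0}"
    unfolding * by (rule closure_translation)
  show ?thesis
    unfolding test_functions_def mem_Collect_eq cl
  proof (intro conjI allI)
    show "Ck m (\<lambda>x. \<phi> (x - c))" for m
      using Ck_translate[of m \<phi> "- c"] \<phi> by (simp add: test_functions_def del: Ck.simps)
    show "compact ((+) c ` closure {x. \<phi> x \<noteq> 0})"
      using \<phi> by (intro compact_translation) (simp add: test_functions_def)
    show "(+) c ` closure {x. \<phi> x \<noteq> 0} \<subseteq> \<Omega>'"
      using \<phi> sub by (auto simp: test_functions_def add.commute)
  qed
qed

lemma test_function_bounded:
  assumes "\<phi> \<in> test_functions \<Omega>"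
  obtains C where "\<And>x. \<bar>\<phi> x\<bar> \<le> C" "\<And>x. \<bar>frechet_derivative \<phi> (at x) h\<bar> \<le> C" "C \<ge> 0"
    "continuous_on UNIV (\<lambda>x. frechet_derivative \<phi> (at x) h)"
    "\<And>x. \<phi> differentiable (at x)" "continuous_on UNIV \<phi>"
proof -
  let ?K = "closure {x. \<phi> x \<noteq> 0}"
  let ?D = "\<lambda>x. frechet_derivative \<phi> (at x) h"
  have Ck: "Ck (Suc 0) \<phi>" "Ck 0 \<phi>" and K: "compact ?K"
    using assms by (auto simp: test_functions_def simp del: Ck.simps)
  then have diff: "\<phi> differentiable (at x)" for x by simp
  have cont: "continuous_on UNIV \<phi>" using Ck by simp
  have D: "?D x = (\<Sum>i\<in>Basis. (h \<bullet> i) * frechet_derivative \<phi> (at x) i)" for x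
    using frechet_derivative_eq_grad[OF diff, of x h]
    by (simp add: grad_def inner_sum_left inner_commute[of h] mult.commute)
  have contD: "continuous_on UNIV ?D"
    unfolding D using Ck by (intro continuous_on_sum continuous_on_mult_left) auto
  have out: "\<phi> x = 0" "?D x = 0" if "x \<notin> ?K" for x
  proof -
    show "\<phi> x = 0" using that closure_subset[of "{x. \<phi> x \<noteq> 0}"] by blast
    have "((\<lambda>x. 0) has_derivative (\<lambda>h. 0)) (at x)" by simp
    then have "(\<phi> has_derivative (\<lambda>h. 0)) (at x)"
      by (rule has_derivative_transform_within_open[of _ _ _ _ "- ?K"])
        (use that closure_subset[of "{x. \<phi> x \<noteq> 0}"] in auto)
    then show "?D x = 0" using frechet_derivative_at by metis
  qed
  obtain C1 where C1: "\<And>x. x \<in> ?K \<Longrightarrow> \<bar>\<phi> x\<bar> \<le> C1"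
    using compact_imp_bounded[OF compact_continuous_image[OF continuous_on_subset[OF cont] K]]
    by (auto simp: bounded_iff)
  obtain C2 where C2: "\<And>x. x \<in> ?K \<Longrightarrow> \<bar>?D x\<bar> \<le> C2"
    using compact_imp_bounded[OF compact_continuous_image[OF continuous_on_subset[OF contD] K]]
    by (auto simp: bounded_iff)
  show ?thesis
  proof (rule that[of "max 0 (max C1 C2)"])
    show "\<bar>\<phi> x\<bar> \<le> max 0 (max C1 C2)" for x
      using C1[of x] out(1)[of x] by (cases "x \<in> ?K") auto
    show "\<bar>?D x\<bar> \<le> max 0 (max C1 C2)" for x
      using C2[of x] out(2)[of x] by (cases "x \<in> ?K") auto
  qed (use contD diff cont in auto)
qed

lemma integrable_indicator_Icc: "integrable lborel (indicator {a..b::real} :: real \<Rightarrow> real)"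
  by (rule integrable_real_indicator) (auto simp: emeasure_lborel_Icc_eq)

text \<open>Integrability on the whole space lets translates of \<open>u\<close> and
  \<open>g\<close> be integrated without tracking domains; only the weak identity is tied to
  \<Omega>.\<close>

locale weak_gradient =
  fixes \<Omega> :: "'a::euclidean_space set" and u :: "'a \<Rightarrow> real" and g :: "'a \<Rightarrow> 'a"
  assumes u_integrable: "integrable lborel u" and g_integrable: "integrable lborel g"
    and weak: "\<And>\<phi> i. \<phi> \<in> test_functions \<Omega> \<Longrightarrow> i \<in> Basis \<Longrightarrow>
      (LINT x|lborel. u x * frechet_derivative \<phi> (at x) i) = - (LINT x|lborel. (g x \<bullet> i) * \<phi> x)"
begin

lemma u_measurable [measurable]: "u \<in> borel_measurable borel"
  and g_measurable [measurable]: "g \<in> borel_measurable borel"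
  using u_integrable g_integrable by auto

lemma weak_direction:
  assumes \<phi>: "\<phi> \<in> test_functions \<Omega>"
  shows "(LINT x|lborel. u x * frechet_derivative \<phi> (at x) h) = - (LINT x|lborel. (g x \<bullet> h) * \<phi> x)"
proof -
  let ?d = "\<lambda>i x. frechet_derivative \<phi> (at x) i"
  have diff: "\<phi> differentiable (at x)" and cont: "continuous_on UNIV \<phi>" for x
    using \<phi> test_function_bounded by metis+
  have [measurable]: "\<phi> \<in> borel_measurable borel" using cont by (rule borel_measurable_continuous_onI)
  obtain C where C: "\<And>x. \<bar>\<phi> x\<bar> \<le> C" by (rule test_function_bounded[OF \<phi>]) blast
  have D: "?d h x = (\<Sum>i\<in>Basis. (h \<bullet> i) * ?d i x)" for x
    using frechet_derivative_eq_grad[OF diff, of x h]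
    by (simp add: grad_def inner_sum_left inner_commute[of h] mult.commute)
  have int1: "integrable lborel (\<lambda>x. u x * ?d i x)" for i
  proof -
    obtain C where C: "\<And>x. \<bar>?d i x\<bar> \<le> C" "C \<ge> 0"
      and c: "continuous_on UNIV (\<lambda>x. ?d i x)"
      by (rule test_function_bounded[OF \<phi>, of i]) blast
    have [measurable]: "(\<lambda>x. ?d i x) \<in> borel_measurable borel"
      using c by (rule borel_measurable_continuous_onI)
    have "integrable lborel (\<lambda>x. C * u x)" using u_integrable by simp
    then show ?thesis
      by (rule Bochner_Integration.integrable_bound)
        (use C in \<open>auto intro!: AE_I2 mult_mono simp: abs_mult mult.commute[of C]\<close>)
  qed
  have int2: "integrable lborel (\<lambda>x. (g x \<bullet> i) * \<phi> x)" for i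
  proof -
    have "integrable lborel (\<lambda>x. C * (g x \<bullet> i))" using g_integrable by simp
    then show ?thesis
      by (rule Bochner_Integration.integrable_bound)
        (use C in \<open>auto intro!: AE_I2 mult_mono simp: abs_mult mult.commute[of C] order_trans[OF C abs_ge_self]\<close>)
  qed
  have "(LINT x|lborel. u x * ?d h x) =
      (LINT x|lborel. (\<Sum>i\<in>Basis. (h \<bullet> i) * (u x * ?d i x)))"
    by (simp add: D sum_distrib_left mult.left_commute)
  also have "\<dots> = (\<Sum>i\<in>Basis. (h \<bullet> i) * (LINT x|lborel. u x * ?d i x))"
    using int1 by (simp add: Bochner_Integration.integral_sum)
  also have "\<dots> = - (\<Sum>i\<in>Basis. (h \<bullet> i) * (LINT x|lborel. (g x \<bullet> i) * \<phi> x))"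
    using weak[OF \<phi>] by (simp add: sum_negf)
  also have "(\<Sum>i\<in>Basis. (h \<bullet> i) * (LINT x|lborel. (g x \<bullet> i) * \<phi> x)) =
      (LINT x|lborel. (\<Sum>i\<in>Basis. (h \<bullet> i) * ((g x \<bullet> i) * \<phi> x)))"
    using int2 by (simp add: Bochner_Integration.integral_sum)
  also have "\<dots> = (LINT x|lborel. (g x \<bullet> h) * \<phi> x)"
  proof (rule Bochner_Integration.integral_cong[OF refl])
    show "(\<Sum>i\<in>Basis. (h \<bullet> i) * ((g x \<bullet> i) * \<phi> x)) = (g x \<bullet> h) * \<phi> x" for x
      unfolding euclidean_inner[of "g x" h] sum_distrib_right by (simp add: mult_ac)
  qed
  finally show ?thesis .
qed

abbreviation line_integral :: "real \<Rightarrow> 'a \<Rightarrow> 'a \<Rightarrow> real" where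
  "line_integral \<tau> h x \<equiv> LINT t|lborel. indicator {0..\<tau>} t * (g (x + t *\<^sub>R h) \<bullet> h)"

lemma line_integrable:
  "integrable (lborel \<Otimes>\<^sub>M lborel) (\<lambda>(t::real, x). indicator {0..\<tau>} t * (g (x + t *\<^sub>R h) \<bullet> h))"
proof (rule lborel_pair.Fubini_integrable)
  have gh: "integrable lborel (\<lambda>x. g x \<bullet> h)" using g_integrable by simp
  have "(LINT x|lborel. norm (indicator {0..\<tau>} t * (g (x + t *\<^sub>R h) \<bullet> h))) =
      indicator {0..\<tau>} t * (LINT x|lborel. \<bar>g x \<bullet> h\<bar>)" for t :: real
    using integral_lborel_shift[of "\<lambda>x. \<bar>g x \<bullet> h\<bar>" "t *\<^sub>R h"] by (simp add: abs_mult)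
  moreover have "integrable lborel (\<lambda>t::real. indicator {0..\<tau>} t * (LINT x|lborel. \<bar>g x \<bullet> h\<bar>))"
    by (intro integrable_mult_left integrable_indicator_Icc)
  ultimately show "integrable lborel (\<lambda>t. LINT x|lborel.
      norm (case (t, x) of (t, x) \<Rightarrow> indicator {0..\<tau>} t * (g (x + t *\<^sub>R h) \<bullet> h)))"
    by simp
  show "AE t in lborel. integrable lborel (\<lambda>x. case (t, x) of (t, x) \<Rightarrow>
      indicator {0..\<tau>} t * (g (x + t *\<^sub>R h) \<bullet> h))"
    using integrable_lborel_shift[OF gh] by (intro AE_I2) simp
qed measurable

text \<open>The weak identity is tested with \<phi>(x - t h) and integrated over t from 0 to \<tau>.
  The derivative of \<phi> along \<open>h\<close> is minus the t-derivative of the translate, so the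
  u-term telescopes, while shifting back turns the g-term into the line integral. \<open>sub\<close>
  keeps all translated supports inside \<Omega>.\<close>

lemma difference_weak:
  assumes \<phi>: "\<phi> \<in> test_functions \<Omega>'" and "\<tau> \<ge> 0"
    and sub: "\<And>x t. x \<in> \<Omega>' \<Longrightarrow> 0 \<le> t \<Longrightarrow> t \<le> \<tau> \<Longrightarrow> x + t *\<^sub>R h \<in> \<Omega>"
  shows "(LINT x|lborel. (u (x + \<tau> *\<^sub>R h) - u x - line_integral \<tau> h x) * \<phi> x) = 0"
proof -
  let ?D = "\<lambda>x. frechet_derivative \<phi> (at x) h"
  let ?K = "\<lambda>t x. indicator {0..\<tau>} t * (u x * ?D (x - t *\<^sub>R h))"
  let ?G = "line_integral \<tau> h"
  obtain C where C: "\<And>x. \<bar>\<phi> x\<bar> \<le> C" "\<And>x. \<bar>?D x\<bar> \<le> C" "C \<ge> 0"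
    and contD: "continuous_on UNIV ?D"
    and diff: "\<And>x. \<phi> differentiable (at x)" and cont: "continuous_on UNIV \<phi>"
    by (rule test_function_bounded[OF \<phi>, of h]) blast
  have [measurable]: "\<phi> \<in> borel_measurable borel" "?D \<in> borel_measurable borel"
    using cont contD by (auto intro: borel_measurable_continuous_onI)
  have test: "(\<lambda>x. \<phi> (x - t *\<^sub>R h)) \<in> test_functions \<Omega>" if "t \<in> {0..\<tau>}" for t
    using that by (intro test_functions_translate[OF \<phi>] sub) auto
  have w: "(LINT x|lborel. (g (x + t *\<^sub>R h) \<bullet> h) * \<phi> x) = - (LINT x|lborel. u x * ?D (x - t *\<^sub>R h))"
    if t: "t \<in> {0..\<tau>}" for t
    using weak_direction[OF test[OF t], of h]
      integral_lborel_shift[of "\<lambda>x. (g x \<bullet> h) * \<phi> (x - t *\<^sub>R h)" "t *\<^sub>R h"]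
    by (simp add: frechet_derivative_translate[OF diff])
  have int1: "integrable (lborel \<Otimes>\<^sub>M lborel)
      (\<lambda>(t::real, x). indicator {0..\<tau>} t * (g (x + t *\<^sub>R h) \<bullet> h) * \<phi> x)"
  proof -
    have "integrable (lborel \<Otimes>\<^sub>M lborel)
        (\<lambda>z. C * (case z of (t::real, x) \<Rightarrow> indicator {0..\<tau>} t * (g (x + t *\<^sub>R h) \<bullet> h)))"
      using line_integrable[of \<tau> h] by simp
    then show ?thesis
      by (rule Bochner_Integration.integrable_bound)
        (use C in \<open>auto intro!: AE_I2 mult_left_mono simp: abs_mult mult.commute[of "\<bar>C\<bar>"] mult.commute[of C] split: split_indicator\<close>)
  qed
  have int2: "integrable (lborel \<Otimes>\<^sub>M lborel) (\<lambda>(t::real, x). ?K t x)"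
  proof (rule lborel_pair.Fubini_integrable)
    have *: "integrable lborel (\<lambda>x. u x * ?D (x - t *\<^sub>R h))" for t :: real
      by (rule Bochner_Integration.integrable_bound[OF integrable_mult_right[OF u_integrable, of C]])
        (use C in \<open>auto intro!: AE_I2 mult_left_mono simp: abs_mult mult.commute[of "\<bar>C\<bar>"] mult.commute[of C]\<close>)
    then show "AE t in lborel. integrable lborel (\<lambda>x. case (t, x) of (t::real, x) \<Rightarrow>
        ?K t x)" by simp
    have "integrable lborel (\<lambda>t::real. indicator {0..\<tau>} t * (C * (LINT x|lborel. \<bar>u x\<bar>)))"
      by (intro integrable_mult_left integrable_indicator_Icc)
    then show "integrable lborel (\<lambda>t. LINT x|lborel. norm (case (t, x) of (t, x) \<Rightarrow> ?K t x))"
    proof (rule Bochner_Integration.integrable_bound)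
      have "\<bar>LINT x|lborel. \<bar>u x * ?D (x - t *\<^sub>R h)\<bar>\<bar> \<le> C * (LINT x|lborel. \<bar>u x\<bar>)" for t :: real
      proof -
        have "(LINT x|lborel. \<bar>u x * ?D (x - t *\<^sub>R h)\<bar>) \<le> (LINT x|lborel. C * \<bar>u x\<bar>)"
          by (rule integral_mono) (use integrable_abs[OF *[of t]] u_integrable C in \<open>auto simp: abs_mult mult.commute[of C] intro!: mult_left_mono\<close>)
        then show ?thesis by simp
      qed
      then show "AE t in lborel. norm (LINT x|lborel. norm (case (t, x) of (t, x) \<Rightarrow> ?K t x)) \<le>
          norm (indicator {0..\<tau>} t * (C * (LINT x|lborel. \<bar>u x\<bar>)))"
        using C by (auto intro!: AE_I2 simp: abs_mult split: split_indicator)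
    qed measurable
  qed measurable
  have ftc: "(LINT t|lborel. indicator {0..\<tau>} t * ?D (x - t *\<^sub>R h)) = \<phi> x - \<phi> (x - \<tau> *\<^sub>R h)" for x
  proof -
    have "(LINT t|lborel. indicator {0..\<tau>} t *\<^sub>R ?D (x - t *\<^sub>R h)) = - \<phi> (x - \<tau> *\<^sub>R h) - - \<phi> (x - 0 *\<^sub>R h)"
    proof (rule integral_FTC_atLeastAtMost[OF \<open>\<tau> \<ge> 0\<close>])
      fix t
      have "((\<lambda>t. x - t *\<^sub>R h) has_derivative (\<lambda>s. - s *\<^sub>R h)) (at t within {0..\<tau>})"
        by (auto intro!: derivative_eq_intros)
      then have "((\<lambda>t. \<phi> (x - t *\<^sub>R h)) has_derivative (\<lambda>s. frechet_derivative \<phi> (at (x - t *\<^sub>R h)) (- s *\<^sub>R h)))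
          (at t within {0..\<tau>})"
        by (rule has_derivative_compose) (use diff frechet_derivative_works in blast)
      moreover have "frechet_derivative \<phi> (at (x - t *\<^sub>R h)) (- s *\<^sub>R h) = - (s * ?D (x - t *\<^sub>R h))" for s
        by (simp add: frechet_derivative_eq_grad[OF diff])
      ultimately have "((\<lambda>t. \<phi> (x - t *\<^sub>R h)) has_derivative (\<lambda>s. - (s * ?D (x - t *\<^sub>R h))))
          (at t within {0..\<tau>})" by simp
      from has_derivative_minus[OF this]
      show "((\<lambda>t. - \<phi> (x - t *\<^sub>R h)) has_vector_derivative ?D (x - t *\<^sub>R h)) (at t within {0..\<tau>})"
        by (simp add: has_vector_derivative_def)
    next
      show "continuous_on {0..\<tau>} (\<lambda>t. ?D (x - t *\<^sub>R h))"
        by (rule continuous_on_compose2[OF contD]) (auto intro!: continuous_intros)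
    qed
    then show ?thesis by simp
  qed
  have "(LINT x|lborel. ?G x * \<phi> x) =
      (LINT x|lborel. LINT t|lborel. indicator {0..\<tau>} t * (g (x + t *\<^sub>R h) \<bullet> h) * \<phi> x)" by simp
  also have "\<dots> = (LINT t|lborel. LINT x|lborel. indicator {0..\<tau>} t * (g (x + t *\<^sub>R h) \<bullet> h) * \<phi> x)"
    by (rule lborel_pair.Fubini_integral[OF int1])
  also have "\<dots> = (LINT t|lborel. LINT x|lborel. - ?K t x)"
  proof (rule Bochner_Integration.integral_cong[OF refl])
    show "(LINT x|lborel. indicator {0..\<tau>} t * (g (x + t *\<^sub>R h) \<bullet> h) * \<phi> x) =
        (LINT x|lborel. - ?K t x)" for t
      using w[of t] by (auto simp: mult.assoc split: split_indicator)
  qed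
  also have "\<dots> = - (LINT t|lborel. LINT x|lborel. ?K t x)"
    by simp
  also have "(LINT t|lborel. LINT x|lborel. ?K t x) =
      (LINT x|lborel. LINT t|lborel. ?K t x)"
    by (rule lborel_pair.Fubini_integral[OF int2, symmetric])
  also have "\<dots> = (LINT x|lborel. u x * (\<phi> x - \<phi> (x - \<tau> *\<^sub>R h)))"
    unfolding ftc[symmetric] by (simp add: mult.left_commute)
  finally have G: "(LINT x|lborel. ?G x * \<phi> x) = - (LINT x|lborel. u x * (\<phi> x - \<phi> (x - \<tau> *\<^sub>R h)))" .
  have intu: "integrable lborel (\<lambda>x. f x * \<phi> (x - c))" if "integrable lborel f" for f c
    by (rule Bochner_Integration.integrable_bound[OF integrable_mult_right[OF that, of C]])
      (use C that in \<open>auto intro!: AE_I2 mult_left_mono simp: abs_mult mult.commute[of "\<bar>C\<bar>"] mult.commute[of C]\<close>)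
  have intG: "integrable lborel ?G"
    using lborel_pair.integrable_snd[OF line_integrable[of \<tau> h]] by simp
  have "(LINT x|lborel. (u (x + \<tau> *\<^sub>R h) - u x - ?G x) * \<phi> x) =
      (LINT x|lborel. u (x + \<tau> *\<^sub>R h) * \<phi> x) - (LINT x|lborel. u x * \<phi> x) - (LINT x|lborel. ?G x * \<phi> x)"
    using intu[OF integrable_lborel_shift[OF u_integrable], of _ 0] intu[OF u_integrable, of 0] intu[OF intG, of 0]
    by (simp add: left_diff_distrib)
  also have "(LINT x|lborel. u (x + \<tau> *\<^sub>R h) * \<phi> x) = (LINT x|lborel. u x * \<phi> (x - \<tau> *\<^sub>R h))"
    using integral_lborel_shift[of "\<lambda>x. u x * \<phi> (x - \<tau> *\<^sub>R h)" "\<tau> *\<^sub>R h"] by simp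
  finally show ?thesis
    unfolding G using intu[OF u_integrable, of 0] intu[OF u_integrable, of "\<tau> *\<^sub>R h"]
    by (simp add: right_diff_distrib)
qed

lemma AE_difference:
  assumes "open B" "convex B" "B \<subseteq> \<Omega>" "0 \<le> \<tau>" "\<tau> \<le> 1"
  shows "AE x in lborel. x \<in> B \<and> x + h \<in> B \<longrightarrow>
    u (x + \<tau> *\<^sub>R h) = u x + line_integral \<tau> h x"
proof -
  \<comment> \<open>By convexity, \<open>x\<close> and \<open>x + h\<close> in \<open>B\<close> put
    the whole segment into \<Omega>, which is the condition on translates.\<close>
  let ?B = "B \<inter> (\<lambda>x. x + h) -` B"
  let ?G = "line_integral \<tau> h"
  have "AE x in lborel. x \<in> ?B \<longrightarrow> u (x + \<tau> *\<^sub>R h) - u x - ?G x = 0"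
  proof (rule du_bois_reymond)
    have intG: "integrable lborel ?G"
      using lborel_pair.integrable_snd[OF line_integrable[of \<tau> h]] by simp
    show "integrable lborel (\<lambda>x. u (x + \<tau> *\<^sub>R h) - u x - ?G x)"
      using intG u_integrable integrable_lborel_shift by (intro Bochner_Integration.integrable_diff) auto
    show "open ?B"
      by (intro open_Int open_vimage continuous_intros assms)
    show "(LINT x|lborel. (u (x + \<tau> *\<^sub>R h) - u x - ?G x) * \<phi> x) = 0" if "\<phi> \<in> test_functions ?B" for \<phi>
    proof (rule difference_weak[OF that \<open>0 \<le> \<tau>\<close>])
      fix x t assume x: "x \<in> ?B" and t: "0 \<le> t" "t \<le> \<tau>"
      have "x + t *\<^sub>R h = (1 - t) *\<^sub>R x + t *\<^sub>R (x + h)" by (simp add: algebra_simps)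
      also have "\<dots> \<in> B" using x t assms by (intro convexD_alt) auto
      finally show "x + t *\<^sub>R h \<in> \<Omega>" using assms by auto
    qed
  qed
  then show ?thesis by eventually_elim auto
qed

end

section \<open>The isoperimetric inequality of De Giorgi\<close>

text \<open>Take the first time \<open>b\<close> at which \<open>U\<close> is at most
  \<open>k\<close>, then the last time \<open>a\<close> before \<open>b\<close> at which
  \<open>U\<close> is at least \<open>l\<close>. Strictly between them \<open>U\<close> stays in the
  layer, and the drop of at least l - k is paid by the integral of |G| there.\<close>

lemma crossing_integral:
  fixes G U :: "real \<Rightarrow> real"
  assumes G: "integrable lborel (\<lambda>t. indicator {0..1} t * G t)"
    and U: "\<And>\<tau>. 0 \<le> \<tau> \<Longrightarrow> \<tau> \<le> 1 \<Longrightarrow> U \<tau> = c + (LINT t|lborel. indicator {0..\<tau>} t * G t)"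
    and "l \<le> U 0" "U 1 \<le> k" "k < l"
  shows "ennreal (l - k) \<le> (\<integral>\<^sup>+t. indicator {0..1} t * (indicator {s. k < U s \<and> U s < l} t * ennreal \<bar>G t\<bar>) \<partial>lborel)" (is "_ \<le> ?rhs")
proof -
  have set_int: "set_integrable lborel {0..1} G" using G by (simp add: set_integrable_def)
  have int_sub: "integrable lborel (\<lambda>t. indicator A t * G t)" if "A \<subseteq> {0..1}" "A \<in> sets borel" for A
    using set_integrable_subset[OF set_int, of A] that by (simp add: set_integrable_def)
  have HK: "(LINT t|lborel. indicator {0..\<tau>} t * G t) = integral {0..\<tau>} G" if "\<tau> \<le> 1" for \<tau>
    using set_borel_integral_eq_integral(2)[of "{0..\<tau>}" G] int_sub[of "{0..\<tau>}"] that
    by (simp add: set_lebesgue_integral_def set_integrable_def)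
  have "continuous_on {0..1} (\<lambda>\<tau>. c + integral {0..\<tau>} G)"
    using set_borel_integral_eq_integral(1)[OF set_int]
    by (intro continuous_intros indefinite_integral_continuous_1)
  then have cont: "continuous_on {0..1} U"
    by (rule continuous_on_eq) (simp add: U HK)
  define S where "S = {0..1} \<inter> U -` {..k}"
  have "closed S" unfolding S_def by (intro continuous_closed_preimage cont) auto
  moreover have "bounded S" unfolding S_def by (meson bounded_closed_interval bounded_subset inf_le1)
  ultimately have "compact S" by (simp add: compact_eq_bounded_closed)
  moreover have "1 \<in> S" using \<open>U 1 \<le> k\<close> by (simp add: S_def)
  ultimately obtain b where b: "b \<in> S" "\<And>t. t \<in> S \<Longrightarrow> b \<le> t"
    using compact_attains_inf[of S] by blast
  define T where "T = {0..b} \<inter> U -` {l..}"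
  have "continuous_on {0..b} U" using b(1) by (intro continuous_on_subset[OF cont]) (auto simp: S_def)
  then have "closed T" unfolding T_def by (intro continuous_closed_preimage) auto
  moreover have "bounded T" unfolding T_def by (meson bounded_closed_interval bounded_subset inf_le1)
  ultimately have "compact T" by (simp add: compact_eq_bounded_closed)
  moreover have "0 \<in> T" using \<open>l \<le> U 0\<close> b(1) by (simp add: S_def T_def)
  ultimately obtain a where a: "a \<in> T" "\<And>t. t \<in> T \<Longrightarrow> t \<le> a"
    using compact_attains_sup[of T] by blast
  have ab: "0 \<le> a" "a \<le> b" "b \<le> 1" "l \<le> U a" "U b \<le> k"
    using a(1) b(1) by (auto simp: S_def T_def)
  have between: "k < U t \<and> U t < l" if "a < t" "t < b" for t
    using a(2)[of t] b(2)[of t] that ab by (auto simp: S_def T_def not_le[symmetric])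
  have "l - k \<le> U a - U b" using ab by simp
  also have "\<dots> = (LINT t|lborel. indicator {0..a} t * G t) - (LINT t|lborel. indicator {0..b} t * G t)"
    using ab by (simp add: U)
  also have "\<dots> = (LINT t|lborel. indicator {0..a} t * G t - indicator {0..b} t * G t)"
    using ab int_sub by (intro Bochner_Integration.integral_diff[symmetric]) auto
  also have "\<dots> \<le> (LINT t|lborel. \<bar>indicator {a<..b} t * G t\<bar>)"
    using ab by (intro integral_mono Bochner_Integration.integrable_diff integrable_abs int_sub)
      (auto split: split_indicator)
  finally have "ennreal (l - k) \<le> ennreal (LINT t|lborel. \<bar>indicator {a<..b} t * G t\<bar>)"
    by (rule ennreal_leI)
  also have "\<dots> = (\<integral>\<^sup>+t. ennreal \<bar>indicator {a<..b} t * G t\<bar> \<partial>lborel)"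
    using ab by (intro nn_integral_eq_integral[symmetric] integrable_abs int_sub) auto
  \<comment> \<open>Only the endpoint \<open>b\<close> of \<open>{a<..b}\<close> may lie outside the
    layer, and a single point is null.\<close>
  also have "\<dots> \<le> ?rhs"
    using ab between AE_lborel_singleton[of b]
    by (intro nn_integral_mono_AE) (auto elim!: eventually_mono split: split_indicator)
  finally show ?thesis .
qed

context weak_gradient
begin

text \<open>Valued in \<open>ennreal\<close>, so that orders of integration can be exchanged without
  integrability checks.\<close>

definition layer :: "'a set \<Rightarrow> real \<Rightarrow> real \<Rightarrow> 'a \<Rightarrow> ennreal" where
  "layer B k l z = indicator {z \<in> B. k < u z \<and> u z < l} z * ennreal (norm (g z))"

lemma layer_measurable [measurable]:
  assumes [measurable]: "B \<in> sets borel"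
  shows "layer B k l \<in> borel_measurable borel"
  unfolding layer_def[abs_def] by measurable

text \<open>\<open>AE_difference\<close> has an exceptional null set for each \<tau> separately;
  exchanging the two almost-everywhere quantifiers gives one null set of starting points.\<close>

lemma AE_line_absolutely_continuous:
  assumes "open B" "convex B" "B \<subseteq> \<Omega>"
  shows "AE x in lborel. x \<in> B \<and> x + h \<in> B \<longrightarrow> (AE \<tau> in lborel. 0 \<le> \<tau> \<and> \<tau> \<le> 1 \<longrightarrow>
    u (x + \<tau> *\<^sub>R h) = u x + line_integral \<tau> h x)"
proof -
  \<comment> \<open>Writing the indicator of {0..\<tau>} as a conditional makes joint measurability
    in \<tau>, x and t automatic, as the exchange requires.\<close>
  let ?P = "\<lambda>(\<tau>::real) x. x \<in> B \<and> x + h \<in> B \<longrightarrow> 0 \<le> \<tau> \<and> \<tau> \<le> 1 \<longrightarrow>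
    u (x + \<tau> *\<^sub>R h) = u x + (LINT t|lborel. (if 0 \<le> t \<and> t \<le> \<tau> then g (x + t *\<^sub>R h) \<bullet> h else 0))"
  have eq: "line_integral \<tau> h x =
      (LINT t|lborel. (if 0 \<le> t \<and> t \<le> \<tau> then g (x + t *\<^sub>R h) \<bullet> h else 0))" for x \<tau>
    by (intro Bochner_Integration.integral_cong) (auto split: split_indicator)
  have [measurable]: "B \<in> sets borel" using assms by auto
  have "AE x in lborel. ?P \<tau> x" for \<tau>
  proof (cases "0 \<le> \<tau> \<and> \<tau> \<le> 1")
    case True
    then show ?thesis using AE_difference[OF assms, of \<tau> h] unfolding eq by auto
  qed auto
  then have "AE \<tau> in lborel. AE x in lborel. ?P \<tau> x" by simp
  moreover have "(AE \<tau> in lborel. AE x in lborel. ?P \<tau> x) \<longleftrightarrow> (AE x in lborel. AE \<tau> in lborel. ?P \<tau> x)"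
  proof (rule lborel_pair.AE_commute)
    have "(\<lambda>(z, t). if 0 \<le> t \<and> t \<le> fst z then g (snd z + t *\<^sub>R h) \<bullet> h else 0)
        \<in> borel_measurable ((lborel \<Otimes>\<^sub>M lborel) \<Otimes>\<^sub>M lborel)"
      by measurable
    then have [measurable]: "(\<lambda>z. LINT t|lborel. (if 0 \<le> t \<and> t \<le> fst z then g (snd z + t *\<^sub>R h) \<bullet> h else 0))
        \<in> borel_measurable (lborel \<Otimes>\<^sub>M lborel)"
      by (rule lborel.borel_measurable_lebesgue_integral)
    show "{z \<in> space (lborel \<Otimes>\<^sub>M lborel). ?P (fst z) (snd z)} \<in> sets (lborel \<Otimes>\<^sub>M lborel)"
      by measurable
  qed
  ultimately have "AE x in lborel. AE \<tau> in lborel. ?P \<tau> x" by blast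
  then show ?thesis unfolding eq by eventually_elim auto
qed

text \<open>Along almost every segment \<open>u\<close> agrees a.e. with the continuous primitive
  \<open>U\<close>. That suffices inside the integral, but the endpoints need exact agreement; hence
  the separate use of \<open>AE_difference\<close> with \<tau> = 1.\<close>

lemma AE_crossing:
  assumes "open B" "convex B" "B \<subseteq> \<Omega>" "k < l"
  shows "AE x in lborel. x \<in> B \<and> x + h \<in> B \<and> l \<le> u x \<and> u (x + h) \<le> k \<longrightarrow>
    ennreal (l - k) \<le> ennreal (norm h) * (\<integral>\<^sup>+t. indicator {0..1} t * layer B k l (x + t *\<^sub>R h) \<partial>lborel)"
proof -
  have [measurable]: "B \<in> sets borel" using assms by auto
  have "AE x in lborel. integrable lborel (\<lambda>t::real. indicator {0..1} t * (g (x + t *\<^sub>R h) \<bullet> h))"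
    using lborel_pair.AE_integrable_snd[OF line_integrable[of 1 h]] by simp
  moreover have "AE x in lborel. x \<in> B \<and> x + h \<in> B \<longrightarrow>
      u (x + h) = u x + (LINT t|lborel. indicator {0..1} t * (g (x + t *\<^sub>R h) \<bullet> h))"
    using AE_difference[OF assms(1-3), of 1 h] by simp
  ultimately show ?thesis
    using AE_line_absolutely_continuous[OF assms(1-3), of h]
  proof eventually_elim
    case (elim x)
    show ?case
    proof
      assume x: "x \<in> B \<and> x + h \<in> B \<and> l \<le> u x \<and> u (x + h) \<le> k"
      define G where "G t = g (x + t *\<^sub>R h) \<bullet> h" for t
      define U where "U \<tau> = u x + (LINT t|lborel. indicator {0..\<tau>} t * G t)" for \<tau>
      have "U 0 = u x"
      proof -
        have "(LINT t|lborel. indicator {0..0} t * G t) = 0"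
        proof (rule integral_eq_zero_AE)
          show "AE t in lborel. indicator {0..0} t * G t = 0"
            using AE_lborel_singleton[of "0::real"] by eventually_elim (auto split: split_indicator)
        qed
        then show ?thesis by (simp add: U_def)
      qed
      moreover have "U 1 = u (x + h)" using elim(2) x by (simp add: U_def G_def)
      ultimately have "ennreal (l - k) \<le>
          (\<integral>\<^sup>+t. indicator {0..1} t * (indicator {s. k < U s \<and> U s < l} t * ennreal \<bar>G t\<bar>) \<partial>lborel)"
        using elim(1) x assms by (intro crossing_integral[of G U "u x"]) (auto simp: U_def G_def)
      also have "\<dots> \<le> (\<integral>\<^sup>+t. ennreal (norm h) * (indicator {0..1} t * layer B k l (x + t *\<^sub>R h)) \<partial>lborel)"
      proof (rule nn_integral_mono_AE)
        have ae: "AE \<tau> in lborel. 0 \<le> \<tau> \<and> \<tau> \<le> 1 \<longrightarrow> u (x + \<tau> *\<^sub>R h) = U \<tau>"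
          using elim(3) x by (simp add: U_def G_def)
        have inB: "x + t *\<^sub>R h \<in> B" if "0 \<le> t" "t \<le> 1" for t
        proof -
          have "x + t *\<^sub>R h = (1 - t) *\<^sub>R x + t *\<^sub>R (x + h)" by (simp add: algebra_simps)
          also have "\<dots> \<in> B" using x that assms by (intro convexD_alt) auto
          finally show ?thesis .
        qed
        have cs: "ennreal \<bar>G t\<bar> \<le> ennreal (norm h) * ennreal (norm (g (x + t *\<^sub>R h)))" for t
          using Cauchy_Schwarz_ineq2[of "g (x + t *\<^sub>R h)" h]
          by (simp add: G_def mult.commute ennreal_leI flip: ennreal_mult)
        show "AE t in lborel. indicator {0..1} t * (indicator {s. k < U s \<and> U s < l} t * ennreal \<bar>G t\<bar>)
            \<le> ennreal (norm h) * (indicator {0..1} t * layer B k l (x + t *\<^sub>R h))"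
          using ae by eventually_elim (use inB cs in \<open>auto simp: layer_def split: split_indicator\<close>)
      qed
      also have "\<dots> = ennreal (norm h) * (\<integral>\<^sup>+t. indicator {0..1} t * layer B k l (x + t *\<^sub>R h) \<partial>lborel)"
        by (rule nn_integral_cmult) measurable
      finally show "ennreal (l - k) \<le> ennreal (norm h) * (\<integral>\<^sup>+t. indicator {0..1} t * layer B k l (x + t *\<^sub>R h) \<partial>lborel)" .
    qed
  qed
qed

end

section \<open>Integration over all pairs of points\<close>

lemma nn_integral_pair_shift:
  fixes E F :: "'a::euclidean_space set"
  assumes [measurable]: "E \<in> sets borel" "F \<in> sets borel"
  shows "(\<integral>\<^sup>+h. \<integral>\<^sup>+x. indicator E x * indicator F (x + h) \<partial>lborel \<partial>lborel) =
    emeasure lborel E * emeasure lborel F"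
proof -
  have "(\<integral>\<^sup>+h. \<integral>\<^sup>+x. indicator E x * indicator F (x + h) \<partial>lborel \<partial>lborel) =
      (\<integral>\<^sup>+x. \<integral>\<^sup>+h. indicator E x * indicator F (x + h) \<partial>lborel \<partial>lborel)"
    by (rule lborel_pair.Fubini') measurable
  also have "\<dots> = (\<integral>\<^sup>+x. indicator E x * emeasure lborel F \<partial>lborel)"
    using nn_integral_lborel_shift[of "indicator F"]
    by (intro nn_integral_cong) (simp add: nn_integral_cmult add.commute)
  also have "(\<integral>\<^sup>+x. indicator E x * emeasure lborel F \<partial>lborel) = emeasure lborel E * emeasure lborel F"
    by (simp add: nn_integral_multc)
  finally show ?thesis .
qed

lemma nn_integral_lborel_affine':
  fixes w :: "'a::euclidean_space \<Rightarrow> ennreal"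
  assumes "w \<in> borel_measurable borel" "s \<noteq> 0"
  shows "(\<integral>\<^sup>+h. w (x + s *\<^sub>R h) \<partial>lborel) = ennreal ((1 / \<bar>s\<bar>) ^ DIM('a)) * (\<integral>\<^sup>+z. w z \<partial>lborel)"
proof -
  have "ennreal ((1 / \<bar>s\<bar>) ^ DIM('a)) * ennreal (\<bar>s\<bar> ^ DIM('a)) = 1"
    using assms(2) by (simp add: power_one_over flip: ennreal_mult)
  then show ?thesis
    unfolding nn_integral_lborel_affine[OF assms, of x] by (simp flip: mult.assoc)
qed

text \<open>The same triple integral is estimated in two ways, by the substitutions \<open>z = x + t h\<close> for fixed
  \<open>x\<close> and for fixed \<open>y = x + h\<close>; the first bound is good away from \<open>t = 0\<close>, the second near it.\<close>

lemma nn_integral_segment_bounds: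
  fixes E F :: "'a::euclidean_space set" and w :: "'a \<Rightarrow> ennreal"
  assumes [measurable]: "E \<in> sets borel" "F \<in> sets borel" "w \<in> borel_measurable borel"
  defines "I t \<equiv> \<integral>\<^sup>+h. \<integral>\<^sup>+x. indicator E x * indicator F (x + h) * w (x + t *\<^sub>R h) \<partial>lborel \<partial>lborel"
  shows "0 < t \<Longrightarrow> I t \<le> emeasure lborel E * (ennreal ((1 / t) ^ DIM('a)) * (\<integral>\<^sup>+z. w z \<partial>lborel))"
    and "t < 1 \<Longrightarrow> I t \<le> emeasure lborel F * (ennreal ((1 / (1 - t)) ^ DIM('a)) * (\<integral>\<^sup>+z. w z \<partial>lborel))"
proof -
  assume t: "0 < t"
  have "I t = (\<integral>\<^sup>+x. \<integral>\<^sup>+h. indicator E x * indicator F (x + h) * w (x + t *\<^sub>R h) \<partial>lborel \<partial>lborel)"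
    unfolding I_def by (rule lborel_pair.Fubini') measurable
  also have "\<dots> \<le> (\<integral>\<^sup>+x. \<integral>\<^sup>+h. indicator E x * w (x + t *\<^sub>R h) \<partial>lborel \<partial>lborel)"
    by (intro nn_integral_mono) (auto split: split_indicator)
  also have "\<dots> = emeasure lborel E * (ennreal ((1 / t) ^ DIM('a)) * (\<integral>\<^sup>+z. w z \<partial>lborel))"
    using t by (simp add: nn_integral_cmult nn_integral_lborel_affine' nn_integral_multc)
  finally show "I t \<le> emeasure lborel E * (ennreal ((1 / t) ^ DIM('a)) * (\<integral>\<^sup>+z. w z \<partial>lborel))" .
next
  assume t: "t < 1"
  have "I t \<le> (\<integral>\<^sup>+h. \<integral>\<^sup>+x. indicator F (x + h) * w (x + t *\<^sub>R h) \<partial>lborel \<partial>lborel)"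
    unfolding I_def by (intro nn_integral_mono) (auto split: split_indicator)
  also have "\<dots> = (\<integral>\<^sup>+h. \<integral>\<^sup>+y. indicator F y * w (y + (t - 1) *\<^sub>R h) \<partial>lborel \<partial>lborel)"
  proof (rule nn_integral_cong)
    show "(\<integral>\<^sup>+x. indicator F (x + h) * w (x + t *\<^sub>R h) \<partial>lborel) =
        (\<integral>\<^sup>+y. indicator F y * w (y + (t - 1) *\<^sub>R h) \<partial>lborel)" for h
      using nn_integral_lborel_shift[of "\<lambda>y. indicator F y * w (y + (t - 1) *\<^sub>R h)" h]
      by (simp add: algebra_simps)
  qed
  also have "\<dots> =
      (\<integral>\<^sup>+y. \<integral>\<^sup>+h. indicator F y * w (y + (t - 1) *\<^sub>R h) \<partial>lborel \<partial>lborel)"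
    by (rule lborel_pair.Fubini') measurable
  also have "\<dots> = emeasure lborel F * (ennreal ((1 / (1 - t)) ^ DIM('a)) * (\<integral>\<^sup>+z. w z \<partial>lborel))"
    using t by (simp add: nn_integral_cmult nn_integral_lborel_affine' nn_integral_multc)
  finally show "I t \<le> emeasure lborel F * (ennreal ((1 / (1 - t)) ^ DIM('a)) * (\<integral>\<^sup>+z. w z \<partial>lborel))" .
qed

text \<open>Every segment from \<open>E\<close> to \<open>F\<close> crosses the layer. After
  integrating over all pairs, the parameter is split at \<open>t0\<close>: the bound anchored at
  \<open>F\<close> costs \<open>t0 * 2^n\<close> before it, the bound anchored at \<open>E\<close>
  costs \<open>t0^(-n)\<close> after it. \<open>t0\<close> stays free and is later tuned to the
  measure of \<open>E\<close>.\<close>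

lemma (in weak_gradient) isoperimetric_nn:
  assumes B: "open B" "convex B" "B \<subseteq> \<Omega>" and "k < l" and "0 < t0" "t0 \<le> 1 / 2"
    and diam: "\<And>x y. x \<in> B \<Longrightarrow> y \<in> B \<Longrightarrow> norm (y - x) \<le> d"
  shows "ennreal (l - k) * (emeasure lborel {x \<in> B. l \<le> u x} * emeasure lborel {x \<in> B. u x \<le> k}) \<le>
    ennreal d * ((emeasure lborel {x \<in> B. u x \<le> k} * ennreal (t0 * 2 ^ DIM('a)) +
      emeasure lborel {x \<in> B. l \<le> u x} * ennreal ((1 / t0) ^ DIM('a))) * (\<integral>\<^sup>+z. layer B k l z \<partial>lborel))"
proof -
  define E where "E = {x \<in> B. l \<le> u x}"
  define F where "F = {x \<in> B. u x \<le> k}"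
  have [measurable]: "B \<in> sets borel" using B by auto
  have [measurable]: "E \<in> sets borel" "F \<in> sets borel" unfolding E_def F_def by measurable
  let ?w = "layer B k l"
  let ?W = "\<integral>\<^sup>+z. ?w z \<partial>lborel"
  let ?near = "emeasure lborel F * (ennreal (2 ^ DIM('a)) * ?W)"
  let ?far = "emeasure lborel E * (ennreal ((1 / t0) ^ DIM('a)) * ?W)"
  define I where "I t = (\<integral>\<^sup>+h. \<integral>\<^sup>+x. indicator E x * indicator F (x + h) * ?w (x + t *\<^sub>R h) \<partial>lborel \<partial>lborel)"
    for t
  let ?J = "\<lambda>t h x. ennreal d * (indicator {0..1} t * (indicator E x * indicator F (x + h) * ?w (x + t *\<^sub>R h)))"
  let ?N = "\<lambda>x h. \<integral>\<^sup>+t. indicator {0..1} t * ?w (x + t *\<^sub>R h) \<partial>lborel"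
  have wm: "?w \<in> borel_measurable borel" by measurable
  note bounds = nn_integral_segment_bounds[OF \<open>E \<in> sets borel\<close> \<open>F \<in> sets borel\<close> wm, folded I_def]
  have "ennreal (l - k) * (emeasure lborel E * emeasure lborel F) =
      (\<integral>\<^sup>+h. \<integral>\<^sup>+x. ennreal (l - k) * (indicator E x * indicator F (x + h)) \<partial>lborel \<partial>lborel)"
    by (simp add: nn_integral_pair_shift[symmetric] nn_integral_cmult)
  also have "\<dots> \<le> (\<integral>\<^sup>+h. \<integral>\<^sup>+x. indicator E x * indicator F (x + h) * (ennreal d *
      ?N x h) \<partial>lborel \<partial>lborel)"
  proof (rule nn_integral_mono, rule nn_integral_mono_AE)
    fix h
    show "AE x in lborel. ennreal (l - k) * (indicator E x * indicator F (x + h)) \<le>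
        indicator E x * indicator F (x + h) * (ennreal d *
          ?N x h)"
      using AE_crossing[OF B \<open>k < l\<close>, of h]
    proof eventually_elim
      case (elim x)
      show ?case
      proof (cases "x \<in> E \<and> x + h \<in> F")
        case True
        then have "ennreal (l - k) \<le> ennreal (norm h) * ?N x h"
          using elim by (auto simp: E_def F_def)
        also have "\<dots> \<le> ennreal d * ?N x h"
          using True diam[of x "x + h"] by (intro mult_right_mono ennreal_leI) (auto simp: E_def F_def)
        finally show ?thesis using True by simp
      qed (auto split: split_indicator)
    qed
  qed
  also have "\<dots> = (\<integral>\<^sup>+h. \<integral>\<^sup>+x. \<integral>\<^sup>+t. ?J t h x \<partial>lborel \<partial>lborel \<partial>lborel)"
    by (intro nn_integral_cong) (simp add: nn_integral_cmult[symmetric] mult_ac)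
  also have "\<dots> = (\<integral>\<^sup>+h. \<integral>\<^sup>+t. \<integral>\<^sup>+x. ?J t h x \<partial>lborel \<partial>lborel \<partial>lborel)"
    by (intro nn_integral_cong lborel_pair.Fubini') measurable
  also have "\<dots> = (\<integral>\<^sup>+t. \<integral>\<^sup>+h. \<integral>\<^sup>+x. ?J t h x \<partial>lborel \<partial>lborel \<partial>lborel)"
    by (intro lborel_pair.Fubini') measurable
  also have "\<dots> = ennreal d * (\<integral>\<^sup>+t. indicator {0..1} t * I t \<partial>lborel)"
    unfolding I_def by (simp add: nn_integral_cmult)
  also have "(\<integral>\<^sup>+t. indicator {0..1} t * I t \<partial>lborel) \<le>
      (\<integral>\<^sup>+t. indicator {0..t0} t * ?near +
        indicator {t0..1} t * ?far \<partial>lborel)"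
  proof (rule nn_integral_mono)
    fix t :: real
    consider "t < 0 \<or> t > 1" | "0 \<le> t" "t \<le> t0" | "t0 < t" "t \<le> 1" by linarith
    then show "indicator {0..1} t * I t \<le>
        indicator {0..t0} t * ?near +
        indicator {t0..1} t * ?far"
    proof cases
      case 2
      have "(1 / (1 - t)) ^ DIM('a) \<le> 2 ^ DIM('a)"
        using 2 \<open>t0 \<le> 1 / 2\<close> by (intro power_mono) (auto simp: field_simps)
      then have "I t \<le> ?near"
        using 2 \<open>t0 \<le> 1 / 2\<close> by (intro order_trans[OF bounds(2)] mult_left_mono mult_right_mono ennreal_leI) auto
      then show ?thesis using 2 by (auto split: split_indicator intro: add_increasing2)
    next
      case 3
      have "(1 / t) ^ DIM('a) \<le> (1 / t0) ^ DIM('a)"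
        using 3 \<open>0 < t0\<close> by (intro power_mono) (auto simp: field_simps)
      then have "I t \<le> ?far"
        using 3 \<open>0 < t0\<close> by (intro order_trans[OF bounds(1)] mult_left_mono mult_right_mono ennreal_leI) auto
      then show ?thesis using 3 by (auto split: split_indicator)
    qed auto
  qed
  also have "\<dots> = ennreal t0 * ?near +
      ennreal (1 - t0) * ?far"
    using \<open>0 < t0\<close> \<open>t0 \<le> 1 / 2\<close> by (simp add: nn_integral_add nn_integral_multc)
  also have "\<dots> \<le> ennreal t0 * ?near +
      1 * ?far"
    using \<open>0 < t0\<close> by (intro add_left_mono mult_right_mono) (auto intro!: ennreal_le_1)
  also have "\<dots> = (emeasure lborel F * ennreal (t0 * 2 ^ DIM('a)) +
      emeasure lborel E * ennreal ((1 / t0) ^ DIM('a))) * ?W"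
    using \<open>0 < t0\<close> by (simp add: ennreal_mult distrib_right distrib_left mult_ac)
  finally show ?thesis
    unfolding E_def F_def by (simp add: mult_left_mono)
qed

section \<open>Level set estimates\<close>

abbreviation vol :: "'a::euclidean_space set \<Rightarrow> real" where
  "vol \<equiv> measure lborel"

abbreviation AE_ball :: "'a::euclidean_space \<Rightarrow> real \<Rightarrow> ('a \<Rightarrow> bool) \<Rightarrow> bool" where
  "AE_ball x0 r P \<equiv> AE x in lborel. x \<in> ball x0 r \<longrightarrow> P x"

lemma measure_ball_scale:
  "r \<ge> 0 \<Longrightarrow> vol (ball (x0::'a::euclidean_space) r) = r ^ DIM('a) * unit_ball_vol (real DIM('a))"
  using content_ball[of r x0] by simp

lemma emeasure_ball_eq: "emeasure lborel (ball (x0::'a::euclidean_space) r) = ennreal (vol (ball x0 r))"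
  by (rule emeasure_eq_ennreal_measure) (use emeasure_lborel_ball_finite[of x0 r] in auto)

lemma emeasure_subset_ball_eq:
  assumes "A \<subseteq> ball (x0::'a::euclidean_space) r" "A \<in> sets borel"
  shows "emeasure lborel A = ennreal (vol A)"
proof (rule emeasure_eq_ennreal_measure)
  have "emeasure lborel A \<le> emeasure lborel (ball x0 r)" using assms by (intro emeasure_mono) auto
  also have "\<dots> < \<infinity>" by (rule emeasure_lborel_ball_finite)
  finally show "emeasure lborel A \<noteq> top" by simp
qed

lemma measure_mono_ball:
  assumes "A \<subseteq> A'" "A' \<subseteq> ball (x0::'a::euclidean_space) r" "A \<in> sets borel" "A' \<in> sets borel"
  shows "vol A \<le> vol A'"
proof (rule measure_mono_fmeasurable)
  show "A' \<in> fmeasurable lborel"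
    using emeasure_subset_ball_eq[OF assms(2,4)] assms(4) by (intro fmeasurableI) auto
qed (use assms in auto)

text \<open>Dyadic decomposition: where |x - x0| is about \<tau>/2^j, the volume carries a factor of
  at most 4^(-j), as the dimension is at least 2, and the weight a factor of at most 2^(j+1). The
  sum is geometric with ratio 1/2.\<close>

lemma nn_integral_ball_negative_power:
  assumes "DIM('a::euclidean_space) \<ge> 2" "\<tau> > 0"
  shows "(\<integral>\<^sup>+x. indicator (ball (x0::'a) \<tau>) x * ennreal (norm (x - x0) powr (- (1/4))) \<partial>lborel) \<le>
    ennreal (4 * \<tau> powr (- (1/4)) * vol (ball x0 \<tau>))"
proof -
  let ?r = "\<lambda>j::nat. \<tau> * (1/2) ^ j"
  let ?c = "\<lambda>j::nat. (\<tau> * (1/2) ^ Suc j) powr (- (1/4))"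
  let ?s = "\<lambda>j x. indicator (ball x0 (?r j)) x * ennreal (?c j)"
  let ?C = "2 * \<tau> powr (- (1/4)) * vol (ball x0 \<tau>)"
  have "(\<integral>\<^sup>+x. indicator (ball x0 \<tau>) x * ennreal (norm (x - x0) powr (- (1/4))) \<partial>lborel) \<le>
      (\<integral>\<^sup>+x. (\<Sum>j. ?s j x) \<partial>lborel)"
  proof (rule nn_integral_mono_AE)
    show "AE x in lborel. indicator (ball x0 \<tau>) x * ennreal (norm (x - x0) powr (- (1/4))) \<le>
        (\<Sum>j. ?s j x)"
      using AE_lborel_singleton[of x0]
    proof eventually_elim
      case (elim x)
      show ?case
      proof (cases "x \<in> ball x0 \<tau>")
        case True
        define s where "s = norm (x - x0)"
        have s: "0 < s" "s < \<tau>" using elim True by (auto simp: s_def dist_norm norm_minus_commute)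
        have "\<exists>j. \<tau> * (1/2) ^ Suc j \<le> s"
        proof -
          obtain j where "(1/2) ^ j < s / \<tau>" using real_arch_pow_inv[of "s / \<tau>" "1/2"] s assms by auto
          then have "\<tau> * (1/2) ^ j < s" using assms by (simp add: field_simps)
          moreover have "\<tau> * (1/2) ^ Suc j \<le> \<tau> * (1/2) ^ j" using assms by simp
          ultimately show ?thesis by (intro exI[of _ j]) linarith
        qed
        then obtain j where j: "\<tau> * (1/2) ^ Suc j \<le> s" "\<And>i. i < j \<Longrightarrow> \<not> \<tau> * (1/2) ^ Suc i \<le> s"
          using exists_least_iff[of "\<lambda>j. \<tau> * (1/2) ^ Suc j \<le> s"] by blast
        have "s < ?r j" using s j(2)[of "j - 1"] by (cases j) auto
        then have x: "x \<in> ball x0 (?r j)" by (simp add: s_def dist_norm norm_minus_commute)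
        have "s powr (- (1/4)) \<le> ?c j" using j(1) s assms by (intro powr_mono2') auto
        then have "indicator (ball x0 \<tau>) x * ennreal (norm (x - x0) powr (- (1/4))) \<le>
            ?s j x"
          using x True by (simp add: s_def ennreal_leI)
        also have "\<dots> \<le> (\<Sum>j. ?s j x)"
        proof -
          have "f j \<le> suminf f" for f :: "nat \<Rightarrow> ennreal"
            using sum_le_suminf[of f "{j}"] by simp
          then show ?thesis .
        qed
        finally show ?thesis .
      qed simp
    qed
  qed
  also have "\<dots> = (\<Sum>j. emeasure lborel (ball x0 (?r j)) * ennreal (?c j))"
  proof (subst nn_integral_suminf)
    have "(\<integral>\<^sup>+x. indicator (ball x0 s) x * ennreal a \<partial>lborel) = emeasure lborel (ball x0 s) * ennreal a" for s a
      using nn_integral_cmult_indicator[of "ball x0 s" lborel "ennreal a"] by (simp add: mult.commute)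
    then show "(\<Sum>j. \<integral>\<^sup>+x. ?s j x \<partial>lborel) =
        (\<Sum>j. emeasure lborel (ball x0 (?r j)) * ennreal (?c j))" by simp
    show "(\<lambda>x. ?s j x) \<in> borel_measurable lborel" for j
      by (intro borel_measurable_times_ennreal borel_measurable_indicator borel_measurable_const) auto
  qed
  also have "\<dots> \<le> (\<Sum>j. ennreal (?C * (1/2) ^ j))"
  proof (rule suminf_le)
    fix j
    let ?n = "DIM('a)"
    have "vol (ball x0 (?r j)) = (1/2) ^ (j * ?n) * vol (ball x0 \<tau>)"
      using assms by (simp add: measure_ball_scale power_mult_distrib power_mult)
    also have "(1/2) ^ (j * ?n) \<le> (1/2::real) ^ (j * 2)"
      by (rule power_decreasing) (use assms in auto)
    finally have 1: "vol (ball x0 (?r j)) \<le> (1/2) ^ (j * 2) * vol (ball x0 \<tau>)"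
      by (simp add: mult_right_mono)
    have "?c j = \<tau> powr (- (1/4)) * ((1/2) ^ Suc j) powr (- (1/4))"
      by (rule powr_mult)
    \<comment> \<open>The crude passage from exponent -1/4 to -1 is affordable against the volume
      factor 4^(-j).\<close>
    also have "((1/2::real) ^ Suc j) powr (- (1/4)) \<le> ((1/2) ^ Suc j) powr (- 1)"
      by (rule powr_mono'[OF _ _ power_le_one]) auto
    also have "((1/2::real) ^ Suc j) powr (- 1) = 2 ^ Suc j"
      by (simp add: powr_minus power_one_over)
    finally have 2: "?c j \<le> \<tau> powr (- (1/4)) * 2 ^ Suc j" by (simp add: mult_left_mono)
    have "vol (ball x0 (?r j)) * ?c j \<le>
        (1/2) ^ (j * 2) * vol (ball x0 \<tau>) * (\<tau> powr (- (1/4)) * 2 ^ Suc j)"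
      using 1 2 by (intro mult_mono) auto
    also have "\<dots> = ?C * (1/2) ^ j"
      by (simp add: power_mult power2_eq_square power_mult_distrib power_one_over field_simps)
    finally show "emeasure lborel (ball x0 (?r j)) * ennreal (?c j) \<le>
        ennreal (?C * (1/2) ^ j)"
      by (simp add: emeasure_ball_eq ennreal_leI flip: ennreal_mult)
  qed auto
  also have "\<dots> = ennreal (\<Sum>j. ?C * (1/2) ^ j)"
    by (rule suminf_ennreal2) (auto intro!: summable_mult summable_geometric)
  also have "(\<Sum>j. ?C * (1/2) ^ j) =
      4 * \<tau> powr (- (1/4)) * vol (ball x0 \<tau>)"
    by (subst suminf_mult) (auto simp: suminf_geometric intro!: summable_geometric)
  finally show ?thesis .
qed

lemma norm_diff_powr_measurable [measurable]:
  "(\<lambda>x::'a::euclidean_space. ennreal (norm (x - x0) powr a)) \<in> borel_measurable borel"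
  "(\<lambda>x::'a::euclidean_space. ennreal ((norm (x - x0) / r) powr a)) \<in> borel_measurable borel"
proof -
  have n: "(\<lambda>x. norm (x - x0)) \<in> borel_measurable borel"
    by (intro borel_measurable_continuous_onI continuous_intros)
  have "(\<lambda>t::real. ennreal (t powr a)) \<in> borel_measurable borel"
    "(\<lambda>t::real. ennreal ((t / r) powr a)) \<in> borel_measurable borel" by measurable
  from this[THEN measurable_compose[OF n]]
  show "(\<lambda>x. ennreal (norm (x - x0) powr a)) \<in> borel_measurable borel"
    "(\<lambda>x. ennreal ((norm (x - x0) / r) powr a)) \<in> borel_measurable borel" by simp_all
qed

text \<open>\<open>D\<close> is compared with the ball of equal volume, whose radius is \<tau> = r
  d^(1/n). Outside that ball the weight is at most its value at \<tau>; inside, the bound for balls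
  applies. The constant is 5 = 1 + 4.\<close>

lemma nn_integral_subset_negative_power:
  fixes x0 :: "'a::euclidean_space"
  assumes "DIM('a) \<ge> 2" "r > 0" "D \<subseteq> ball x0 r" and [measurable]: "D \<in> sets borel"
    and d: "d = vol D / vol (ball x0 r)" "d > 0"
  shows "(\<integral>\<^sup>+x. indicator D x * ennreal ((norm (x - x0) / r) powr (- (1/4))) \<partial>lborel) \<le>
    ennreal (5 * vol (ball x0 r) * d powr (1 - 1 / (4 * DIM('a))))"
proof -
  let ?n = "real DIM('a)"
  let ?V = "vol (ball x0 r)"
  have n: "?n > 0" by simp
  define \<tau> where "\<tau> = r * d powr (1 / ?n)"
  let ?b = "\<lambda>x. indicator (ball x0 \<tau>) x * ennreal (norm (x - x0) powr (- (1/4)))"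
  let ?t = "ennreal ((\<tau> / r) powr (- (1/4)))"
  have \<tau>: "\<tau> > 0" using assms(2) d(2) by (simp add: \<tau>_def)
  have V: "?V > 0" using \<open>r > 0\<close> by (simp add: measure_ball_scale)
  have m: "(\<lambda>x. ?b x) \<in> borel_measurable lborel"
    by (intro borel_measurable_times_ennreal borel_measurable_indicator)
      (simp_all add: norm_diff_powr_measurable)
  have \<tau>d: "(\<tau> / r) powr (- (1/4)) = d powr (- (1 / (4 * ?n)))"
    using \<open>r > 0\<close> d(2) by (simp add: \<tau>_def powr_powr mult.commute)
  have "(\<integral>\<^sup>+x. indicator D x * ennreal ((norm (x - x0) / r) powr (- (1/4))) \<partial>lborel) \<le>
      (\<integral>\<^sup>+x. indicator D x * ?t +
        ennreal (r powr (1/4)) * ?b x \<partial>lborel)"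
  proof (rule nn_integral_mono)
    fix x
    show "indicator D x * ennreal ((norm (x - x0) / r) powr (- (1/4))) \<le>
        indicator D x * ?t +
        ennreal (r powr (1/4)) * ?b x"
    proof (cases "x \<in> ball x0 \<tau>")
      case True
      have "(norm (x - x0) / r) powr (- (1/4)) = r powr (1/4) * norm (x - x0) powr (- (1/4))"
        using \<open>r > 0\<close> by (simp add: powr_divide powr_minus field_simps)
      then show ?thesis using True
        by (auto simp: ennreal_mult split: split_indicator intro: add_increasing)
    next
      case False
      then have "(norm (x - x0) / r) powr (- (1/4)) \<le> (\<tau> / r) powr (- (1/4))"
        using \<tau> \<open>r > 0\<close> by (intro powr_mono2' divide_right_mono)
          (auto simp: dist_norm norm_minus_commute)
      then show ?thesis using False by (auto split: split_indicator intro: ennreal_leI)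
    qed
  qed
  also have "\<dots> = emeasure lborel D * ?t + ennreal (r powr (1/4)) *
      (\<integral>\<^sup>+x. ?b x \<partial>lborel)"
  proof (subst nn_integral_add)
    show "(\<integral>\<^sup>+x. indicator D x * ?t \<partial>lborel) +
        (\<integral>\<^sup>+x. ennreal (r powr (1/4)) * ?b x \<partial>lborel) =
        emeasure lborel D * ?t + ennreal (r powr (1/4)) *
        (\<integral>\<^sup>+x. ?b x \<partial>lborel)"
      by (simp add: nn_integral_multc nn_integral_cmult[OF m])
    show "(\<lambda>x. indicator D x * ?t) \<in> borel_measurable lborel" by measurable
    show "(\<lambda>x. ennreal (r powr (1/4)) * ?b x)
        \<in> borel_measurable lborel"
      by (intro borel_measurable_times_ennreal m borel_measurable_const)
  qed
  also have "\<dots> \<le> emeasure lborel D * ?t + ennreal (r powr (1/4)) *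
      ennreal (4 * \<tau> powr (- (1/4)) * vol (ball x0 \<tau>))"
    using assms(1) \<tau> by (intro add_left_mono mult_left_mono nn_integral_ball_negative_power) auto
  also have "\<dots> = ennreal (vol D * (\<tau> / r) powr (- (1/4)) +
      r powr (1/4) * (4 * \<tau> powr (- (1/4)) * vol (ball x0 \<tau>)))"
    using emeasure_subset_ball_eq[OF assms(3,4)] by (simp add: ennreal_mult)
  also have "vol (ball x0 \<tau>) = d * ?V"
  proof -
    have "(d powr (1 / ?n)) ^ DIM('a) = d"
      using d(2) by (subst powr_realpow[symmetric]) (simp_all add: powr_powr)
    then show ?thesis using \<tau> \<open>r > 0\<close> by (simp add: measure_ball_scale) (simp add: \<tau>_def power_mult_distrib)
  qed
  also have "vol D = d * ?V" using d V by (simp add: field_simps)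
  also have "r powr (1/4) * (4 * \<tau> powr (- (1/4)) * (d * ?V)) = 4 * (d * ?V) * (\<tau> / r) powr (- (1/4))"
    using \<tau> \<open>r > 0\<close> by (simp add: powr_divide powr_minus field_simps)
  also have "d * ?V * (\<tau> / r) powr (- (1/4)) + 4 * (d * ?V) * (\<tau> / r) powr (- (1/4)) =
      5 * ?V * (d powr 1 * d powr (- (1 / (4 * ?n))))"
    using d(2) by (simp add: \<tau>d)
  also have "d powr 1 * d powr (- (1 / (4 * ?n))) = d powr (1 - 1 / (4 * ?n))"
    by (simp only: powr_add[symmetric]) simp
  finally show ?thesis by simp
qed

text \<open>Either s a^(p-1) \<ge> 1 and the first term alone dominates, or \<open>a\<close> is at
  most the second term.\<close>

lemma le_weighted_power_or_dual:
  fixes a s p :: real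
  assumes "a \<ge> 0" "s > 0" "p > 1"
  shows "a \<le> s * a powr p + s powr (- (1 / (p - 1)))"
proof (cases "a > 0 \<and> 1 \<le> s * a powr (p - 1)")
  case True
  then have "a * 1 \<le> a * (s * a powr (p - 1))" by (intro mult_left_mono) auto
  also have "\<dots> = s * (a powr 1 * a powr (p - 1))" using True by simp
  also have "\<dots> = s * a powr p" by (simp only: powr_add[symmetric]) simp
  finally show ?thesis by (simp add: add_increasing2)
next
  case False
  have "a \<le> s powr (- (1 / (p - 1)))"
  proof (cases "a = 0")
    case False
    then have "a powr (p - 1) \<le> s powr (- 1)"
      using \<open>\<not> (a > 0 \<and> 1 \<le> s * a powr (p - 1))\<close> assms by (simp add: powr_minus field_simps)
    then have "(a powr (p - 1)) powr (1 / (p - 1)) \<le> (s powr (- 1)) powr (1 / (p - 1))"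
      using assms by (intro powr_mono2) auto
    also have "(s powr (- 1)) powr (1 / (p - 1)) = s powr (- (1 / (p - 1)))" by (subst powr_powr) simp
    also have "(a powr (p - 1)) powr (1 / (p - 1)) = a" using assms False by (simp add: powr_powr)
    finally show ?thesis .
  qed simp
  then show ?thesis using assms by (intro add_increasing) auto
qed

text \<open>The variable exponent is already removed here. The height \<open>m\<close> is any bound
  for u - k that is at least r. The inequality is one-sided: lower levels are covered by a second
  instance for the negative of \<open>u\<close>.\<close>

locale degiorgi = weak_gradient \<Omega> u g
  for \<Omega> :: "'a::euclidean_space set" and u g +
  fixes x0 :: 'a and r1 p q c M :: real
  assumes dim: "DIM('a) \<ge> 2" and p: "1 < p" and q: "0 < q" and c: "0 < c" and r1: "0 < r1"
    and ball_sub: "ball x0 r1 \<subseteq> \<Omega>"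
    and energy: "\<And>r k m \<sigma>. 0 < r \<Longrightarrow> r \<le> r1 \<Longrightarrow> \<bar>k\<bar> < M \<Longrightarrow> 0 < \<sigma> \<Longrightarrow> \<sigma> < 1 \<Longrightarrow> r \<le> m \<Longrightarrow>
      AE_ball x0 r (\<lambda>x. u x \<le> k + m) \<Longrightarrow>
      (\<integral>\<^sup>+x. indicator {x \<in> ball x0 (r * (1 - \<sigma>)). k < u x} x *
        ennreal ((norm (x - x0) / r) powr ((p - 1) / 4) * norm (g x) powr p) \<partial>lborel) \<le>
      ennreal (c * \<sigma> powr (- q) * (m / r) powr p * vol {x \<in> ball x0 r. k < u x})"
begin

definition Y :: "real \<Rightarrow> real \<Rightarrow> real" where
  "Y k r = vol {x \<in> ball x0 r. k < u x} / vol (ball x0 r)"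

text \<open>Solves n \<theta> = 1 - \<theta>, the condition under which the two terms of
  \<open>isoperimetric_nn\<close> balance.\<close>

definition \<theta> :: real where "\<theta> = 1 / (real DIM('a) + 1)"

lemma \<theta>: "0 < \<theta>" "\<theta> < 1" "real DIM('a) * \<theta> = 1 - \<theta>" "1 / (4 * real DIM('a)) \<le> \<theta> / 2"
  using dim by (auto simp: \<theta>_def field_simps)

lemma V_pos: "r > 0 \<Longrightarrow> vol (ball x0 r) > 0"
  by (simp add: measure_ball_scale)

lemma Y_nonneg: "0 \<le> Y k r" and Y_le_1: "Y k r \<le> 1"
proof -
  show "0 \<le> Y k r" by (simp add: Y_def)
  have "vol {x \<in> ball x0 r. k < u x} \<le> vol (ball x0 r)"
    by (rule measure_mono_ball[of _ _ x0 r]) auto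
  then show "Y k r \<le> 1"
    unfolding Y_def by (metis divide_le_eq_1 measure_nonneg not_le order_less_le)
qed

lemma Y_antimono: "k \<le> l \<Longrightarrow> Y l r \<le> Y k r"
  unfolding Y_def by (intro divide_right_mono measure_mono_ball[of _ _ x0 r]) auto

lemma Y_smaller_ball:
  assumes "0 < r" "0 < \<rho>" "r \<le> 2 * \<rho>" "\<rho> \<le> r"
  shows "Y k \<rho> \<le> 2 ^ DIM('a) * Y k r"
proof -
  have "vol (ball x0 r) \<le> 2 ^ DIM('a) * vol (ball x0 \<rho>)"
    using assms power_mono[of r "2 * \<rho>" "DIM('a)"]
    by (simp add: measure_ball_scale power_mult_distrib mult_right_mono flip: mult.assoc)
  moreover have "vol {x \<in> ball x0 \<rho>. k < u x} \<le> vol {x \<in> ball x0 r. k < u x}"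
    using assms by (intro measure_mono_ball[of _ _ x0 r]) auto
  ultimately have "vol {x \<in> ball x0 \<rho>. k < u x} * vol (ball x0 r) \<le>
      vol {x \<in> ball x0 r. k < u x} * (2 ^ DIM('a) * vol (ball x0 \<rho>))"
    by (intro mult_mono) auto
  then show ?thesis
    using V_pos[OF \<open>0 < r\<close>] V_pos[OF \<open>0 < \<rho>\<close>] by (simp add: Y_def field_simps)
qed

text \<open>A weighted Hoelder inequality between the energy and the dual weight |x - x0|^(-1/4),
  obtained by optimising a scale factor in the Young-type inequality.\<close>

lemma gradient_L1_bound:
  assumes "0 < r" "r \<le> r1" "\<bar>k\<bar> < M" "0 < \<sigma>" "\<sigma> < 1" "r \<le> m"
    and ae: "AE_ball x0 r (\<lambda>x. u x \<le> k + m)"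
    and d: "d = vol {x \<in> ball x0 (r * (1 - \<sigma>)). k < u x \<and> u x < l} / vol (ball x0 r)"
  shows "(\<integral>\<^sup>+z. layer (ball x0 (r * (1 - \<sigma>))) k l z \<partial>lborel) \<le>
    ennreal (2 * (c * \<sigma> powr (- q) * (m / r) powr p * Y k r) powr (1 / p) *
      (5 * d powr (1 - \<theta> / 2)) powr (1 - 1 / p) * vol (ball x0 r))"
proof -
  let ?D = "{x \<in> ball x0 (r * (1 - \<sigma>)). k < u x \<and> u x < l}"
  let ?V = "vol (ball x0 r)"
  have V: "?V > 0" using assms V_pos by auto
  have "r * (1 - \<sigma>) \<le> r" using assms by (simp add: algebra_simps)
  then have sub: "?D \<subseteq> ball x0 r" by auto
  have [measurable]: "?D \<in> sets borel" by measurable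
  show ?thesis
  \<comment> \<open>The optimal scale factor would be 0 for a null layer.\<close>
  proof (cases "d = 0")
    case True
    then have "emeasure lborel ?D = 0"
      using emeasure_subset_ball_eq[OF sub] d V by simp
    then have "AE x in lborel. x \<notin> ?D"
      using \<open>?D \<in> sets borel\<close> by (intro AE_not_in) (auto simp: null_sets_def)
    then have "(\<integral>\<^sup>+z. layer (ball x0 (r * (1 - \<sigma>))) k l z \<partial>lborel) = (\<integral>\<^sup>+z. 0 \<partial>(lborel :: 'a measure))"
      by (intro nn_integral_cong_AE) (auto simp: layer_def elim!: eventually_mono)
    then show ?thesis by simp
  next
    case False
    then have d0: "d > 0" using d by (simp add: order_less_le)
    have dY: "d \<le> Y k r"
      unfolding d Y_def using sub by (intro divide_right_mono measure_mono_ball[of _ _ x0 r]) auto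
    have d1: "d \<le> 1" using dY Y_le_1 by (rule order_trans)
    define X where "X = c * \<sigma> powr (- q) * (m / r) powr p * Y k r"
    define Z where "Z = 5 * d powr (1 - \<theta> / 2)"
    have X: "X > 0" using d0 dY assms c by (simp add: X_def)
    have Z: "Z > 0" using d0 by (simp add: Z_def)
    \<comment> \<open>Equalises the two contributions: \<Lambda> X and \<Lambda>^(-1/(p-1)) Z are
      both X^(1/p) Z^(1-1/p).\<close>
    define \<Lambda> where "\<Lambda> = (Z / X) powr ((p - 1) / p)"
    have \<Lambda>: "\<Lambda> > 0" using X Z by (simp add: \<Lambda>_def)
    have b1: "\<Lambda> * X = X powr (1 / p) * Z powr (1 - 1 / p)"
    proof -
      have "\<Lambda> * X = Z powr ((p - 1) / p) * (X powr 1 / X powr ((p - 1) / p))"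
        using X Z by (simp add: \<Lambda>_def powr_divide)
      also have "X powr 1 / X powr ((p - 1) / p) = X powr (1 - (p - 1) / p)" by (rule powr_diff[symmetric])
      also have "1 - (p - 1) / p = 1 / p" using p by (simp add: field_simps)
      also have "(p - 1) / p = 1 - 1 / p" using p by (simp add: field_simps)
      finally show ?thesis by simp
    qed
    have b2: "\<Lambda> powr (- (1 / (p - 1))) * Z = X powr (1 / p) * Z powr (1 - 1 / p)"
    proof -
      have "\<Lambda> powr (- (1 / (p - 1))) = (Z / X) powr (- (1 / p))"
        using p by (simp add: \<Lambda>_def powr_powr field_simps)
      also have "\<dots> = X powr (1 / p) * Z powr (- (1 / p))"
        using X Z by (simp add: powr_divide powr_minus field_simps)
      finally have "\<Lambda> powr (- (1 / (p - 1))) * Z = X powr (1 / p) * (Z powr (- (1 / p)) * Z powr 1)"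
        using Z by simp
      also have "Z powr (- (1 / p)) * Z powr 1 = Z powr (1 - 1 / p)"
        by (simp only: powr_add[symmetric]) simp
      finally show ?thesis .
    qed
    let ?W = "\<lambda>x. norm (x - x0) / r"
    let ?e = "\<lambda>x. indicator {x \<in> ball x0 (r * (1 - \<sigma>)). k < u x} x *
      ennreal (?W x powr ((p - 1) / 4) * norm (g x) powr p)"
    let ?f = "\<lambda>x. indicator ?D x * ennreal (?W x powr (- (1/4)))"
    have "(\<integral>\<^sup>+z. layer (ball x0 (r * (1 - \<sigma>))) k l z \<partial>lborel) \<le>
        (\<integral>\<^sup>+x. ennreal \<Lambda> * ?e x +
          ennreal (\<Lambda> powr (- (1 / (p - 1)))) * ?f x \<partial>lborel)"
    proof (rule nn_integral_mono_AE)
      show "AE x in lborel. layer (ball x0 (r * (1 - \<sigma>))) k l x \<le>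
        ennreal \<Lambda> * ?e x +
          ennreal (\<Lambda> powr (- (1 / (p - 1)))) * ?f x"
        using AE_lborel_singleton[of x0]
      proof eventually_elim
        case (elim x)
        show ?case
        proof (cases "x \<in> ?D")
          case True
          have W: "?W x > 0" using elim assms by simp
          have "0 < ?W x powr ((p - 1) / 4)" using W by (subst powr_gt_zero) linarith
          then have sp: "0 < \<Lambda> * ?W x powr ((p - 1) / 4)" using \<Lambda> by (rule mult_pos_pos[rotated])
          have "norm (g x) \<le> \<Lambda> * ?W x powr ((p - 1) / 4) * norm (g x) powr p +
              (\<Lambda> * ?W x powr ((p - 1) / 4)) powr (- (1 / (p - 1)))"
            by (rule le_weighted_power_or_dual[OF norm_ge_zero sp p])
          also have "(\<Lambda> * ?W x powr ((p - 1) / 4)) powr (- (1 / (p - 1))) =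
              \<Lambda> powr (- (1 / (p - 1))) * ?W x powr (- (1/4))"
            using \<Lambda> p by (simp add: powr_mult powr_powr field_simps)
          finally have "ennreal (norm (g x)) \<le> ennreal (\<Lambda> * (?W x powr ((p - 1) / 4) * norm (g x) powr p) +
              \<Lambda> powr (- (1 / (p - 1))) * ?W x powr (- (1/4)))"
            by (intro ennreal_leI) (simp add: mult.assoc)
          also have "\<dots> = ennreal \<Lambda> * ennreal (?W x powr ((p - 1) / 4) * norm (g x) powr p) +
              ennreal (\<Lambda> powr (- (1 / (p - 1)))) * ennreal (?W x powr (- (1/4)))"
            using \<Lambda> by (simp add: ennreal_mult)
          finally show ?thesis using True by (simp add: layer_def)
        qed (auto simp: layer_def split: split_indicator)
      qed
    qed
    also have "\<dots> = ennreal \<Lambda> * (\<integral>\<^sup>+x. ?e x \<partial>lborel) +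
          ennreal (\<Lambda> powr (- (1 / (p - 1)))) * (\<integral>\<^sup>+x. ?f x \<partial>lborel)"
      by (subst nn_integral_add) (simp_all add: nn_integral_cmult)
    also have "\<dots> \<le> ennreal \<Lambda> * ennreal (X * ?V) + ennreal (\<Lambda> powr (- (1 / (p - 1)))) * ennreal (Z * ?V)"
    proof (intro add_mono mult_left_mono)
      have "X * ?V = c * \<sigma> powr (- q) * (m / r) powr p * vol {x \<in> ball x0 r. k < u x}"
        using V by (simp add: X_def Y_def)
      then show "(\<integral>\<^sup>+x. ?e x \<partial>lborel) \<le> ennreal (X * ?V)"
        using energy[OF assms(1-6) ae] by simp
      have "(\<integral>\<^sup>+x. ?f x \<partial>lborel) \<le>
          ennreal (5 * ?V * d powr (1 - 1 / (4 * DIM('a))))"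
        using dim assms sub d d0 by (intro nn_integral_subset_negative_power) auto
      \<comment> \<open>As d \<le> 1, the exponent loss 1/(4n) may be enlarged to
        \<theta>/2.\<close>
      also have "\<dots> \<le> ennreal (Z * ?V)"
        using V d0 d1 \<theta>(4) by (intro ennreal_leI) (auto simp: Z_def intro!: powr_mono')
      finally show "(\<integral>\<^sup>+x. ?f x \<partial>lborel) \<le> ennreal (Z * ?V)" .
    qed auto
    also have "\<dots> = ennreal (\<Lambda> * X * ?V + \<Lambda> powr (- (1 / (p - 1))) * Z * ?V)"
      using \<Lambda> X Z V by (simp add: mult.assoc flip: ennreal_mult ennreal_plus)
    also have "\<Lambda> * X * ?V + \<Lambda> powr (- (1 / (p - 1))) * Z * ?V = 2 * X powr (1 / p) * Z powr (1 - 1 / p) * ?V"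
      unfolding b1 b2 by simp
    finally show ?thesis unfolding X_def Z_def .
  qed
qed

end

text \<open>The recursion is superlinear, since 1 - \<theta>/2 > 1 - \<theta>, so the decay y j
  \<le> \<nu> b^(-j) reproduces itself from a small start. The recursion is assumed only while y j
  \<le> \<nu>, because its derivation will need that smallness.\<close>

lemma fast_geometric_convergence:
  fixes A B \<theta> \<nu>0 :: real
  assumes "A > 0" "B \<ge> 1" "0 < \<theta>" "\<theta> < 1" "\<nu>0 > 0"
  obtains \<nu> where "0 < \<nu>" "\<nu> \<le> \<nu>0"
    "\<And>y :: nat \<Rightarrow> real. y 0 \<le> \<nu> \<Longrightarrow> (\<And>j. 0 \<le> y j) \<Longrightarrow>
      (\<And>j. y j \<le> \<nu> \<Longrightarrow> y (Suc j) powr (1 - \<theta>) \<le> A * B ^ j * y j powr (1 - \<theta> / 2)) \<Longrightarrow> y \<longlonglongrightarrow> 0"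
proof -
  \<comment> \<open>b^(\<theta>/2) \<ge> B absorbs the growth B^j; the factor 2 makes b > 1.\<close>
  define b where "b = 2 * B powr (2 / \<theta>)"
  have b: "b > 1" using ge_one_powr_ge_zero[of B "2 / \<theta>"] assms by (simp add: b_def)
  \<comment> \<open>Chosen so that A \<nu>^(\<theta>/2) \<le> 1/b, the gain required in one
    step.\<close>
  define \<nu> where "\<nu> = min \<nu>0 ((1 / (A * b)) powr (2 / \<theta>))"
  have \<nu>: "0 < \<nu>" "\<nu> \<le> \<nu>0" using assms b by (auto simp: \<nu>_def)
  have "\<nu> powr (\<theta> / 2) \<le> ((1 / (A * b)) powr (2 / \<theta>)) powr (\<theta> / 2)"
    using assms \<nu> by (intro powr_mono2) (auto simp: \<nu>_def)
  also have "\<dots> = 1 / (A * b)" using assms b by (simp add: powr_powr)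
  finally have A\<nu>: "A * \<nu> powr (\<theta> / 2) \<le> 1 / b"
    using assms b by (simp add: field_simps)
  show ?thesis
  proof (rule that[OF \<nu>])
    fix y :: "nat \<Rightarrow> real"
    assume y0: "y 0 \<le> \<nu>" and pos: "\<And>j. 0 \<le> y j"
      and step: "\<And>j. y j \<le> \<nu> \<Longrightarrow> y (Suc j) powr (1 - \<theta>) \<le> A * B ^ j * y j powr (1 - \<theta> / 2)"
    have bound: "y j \<le> \<nu> * (1 / b) ^ j" for j
    proof (induction j)
      case 0
      then show ?case using y0 by simp
    next
      case (Suc j)
      let ?z = "\<nu> * (1 / b) ^ j"
      have z: "?z > 0" using \<nu> b by simp
      have "(1 / b) ^ j \<le> 1" using b by (intro power_le_one) auto
      then have "?z \<le> \<nu>" using \<nu> by (simp add: mult_left_le)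
      then have "y (Suc j) powr (1 - \<theta>) \<le> A * B ^ j * y j powr (1 - \<theta> / 2)"
        using Suc by (intro step) linarith
      also have "\<dots> \<le> A * B ^ j * ?z powr (1 - \<theta> / 2)"
        using Suc pos assms by (intro mult_left_mono powr_mono2) auto
      also have "?z powr (1 - \<theta> / 2) = ?z powr (1 - \<theta>) * ?z powr (\<theta> / 2)"
        by (simp flip: powr_add)
      also have "?z powr (\<theta> / 2) = \<nu> powr (\<theta> / 2) * ((1 / b) ^ j) powr (\<theta> / 2)"
        by (rule powr_mult)
      also have "((1 / b) ^ j) powr (\<theta> / 2) \<le> (1 / B) ^ j"
      proof -
        have "(1 / b) powr (\<theta> / 2) \<le> (1 / B powr (2 / \<theta>)) powr (\<theta> / 2)"
          using assms b by (intro powr_mono2) (auto simp: b_def intro!: frac_le)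
        also have "\<dots> = 1 / B"
          using assms by (simp add: powr_divide powr_powr)
        finally have "((1 / b) powr (\<theta> / 2)) ^ j \<le> (1 / B) ^ j" by (intro power_mono) auto
        moreover have "((1 / b) ^ j) powr (\<theta> / 2) = ((1 / b) powr (\<theta> / 2)) ^ j"
          using b by (simp add: powr_realpow[symmetric] powr_powr mult.commute)
        ultimately show ?thesis by simp
      qed
      finally have "y (Suc j) powr (1 - \<theta>) \<le>
          A * B ^ j * (?z powr (1 - \<theta>) * (\<nu> powr (\<theta> / 2) * (1 / B) ^ j))"
        using assms by (simp add: mult_left_mono)
      also have "\<dots> = (A * \<nu> powr (\<theta> / 2)) * ?z powr (1 - \<theta>)"
        using assms by (simp add: power_one_over field_simps)
      also have "\<dots> \<le> (1 / b) * ?z powr (1 - \<theta>)"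
        using A\<nu> by (intro mult_right_mono) auto
      also have "\<dots> \<le> (1 / b) powr (1 - \<theta>) * ?z powr (1 - \<theta>)"
      proof (rule mult_right_mono)
        show "1 / b \<le> (1 / b) powr (1 - \<theta>)"
          using powr_mono'[of "1 - \<theta>" 1 "1 / b"] assms b by simp
      qed simp
      also have "\<dots> = (\<nu> * (1 / b) ^ Suc j) powr (1 - \<theta>)"
        by (simp add: powr_mult[symmetric] mult_ac)
      finally have le: "y (Suc j) powr (1 - \<theta>) \<le> (\<nu> * (1 / b) ^ Suc j) powr (1 - \<theta>)" .
      show ?case
      proof (rule ccontr)
        assume "\<not> y (Suc j) \<le> \<nu> * (1 / b) ^ Suc j"
        then have "(\<nu> * (1 / b) ^ Suc j) powr (1 - \<theta>) < y (Suc j) powr (1 - \<theta>)"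
          using assms \<nu> b by (intro powr_less_mono2) auto
        then show False using le by simp
      qed
    qed
    show "y \<longlonglongrightarrow> 0"
    proof (rule tendsto_sandwich[where f="\<lambda>_. 0" and h="\<lambda>j. \<nu> * (1 / b) ^ j"])
      show "(\<lambda>j. \<nu> * (1 / b) ^ j) \<longlonglongrightarrow> 0"
        using b by (intro tendsto_mult_right_zero LIMSEQ_power_zero) simp
    qed (use pos bound in auto)
  qed
qed

section \<open>Shrinking of superlevel sets and De Giorgi's iteration\<close>

context degiorgi
begin

text \<open>16 * 4^n comes from the isoperimetric step (one 2^n from \<open>t0\<close>, one from the
  ratio of the balls), 5 from the singular weight and c^(1/p) from the energy.\<close>

definition K :: real where "K = 5 * 16 * 4 ^ DIM('a) * c powr (1 / p)"

definition \<kappa> :: real where "\<kappa> = (1 - \<theta> / 2) * (1 - 1 / p)"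

lemma K_pos: "K > 0" using c by (simp add: K_def)

text \<open>The last estimate is the decisive one: Y_k^(1/p) times Y_k^\<kappa> has total power at
  least 1 - \<theta>/2, strictly above the power 1 - \<theta> on the left of
  \<open>level_set_estimate\<close>.\<close>

lemma \<kappa>: "0 < \<kappa>" "\<kappa> \<le> 1" "1 - \<theta> / 2 \<le> 1 / p + \<kappa>"
proof -
  have t: "0 < 1 - \<theta> / 2" "1 - \<theta> / 2 \<le> 1" using \<theta> by auto
  have s: "0 < 1 - 1 / p" "1 - 1 / p \<le> 1" using p by auto
  show "0 < \<kappa>" unfolding \<kappa>_def using t s by (intro mult_pos_pos)
  show "\<kappa> \<le> 1" unfolding \<kappa>_def using t s by (intro mult_le_one) auto
  have "(1 / p) * (1 - \<theta> / 2) \<le> (1 / p) * 1" using t p by (intro mult_left_mono) auto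
  moreover have "\<kappa> = (1 - \<theta> / 2) - (1 / p) * (1 - \<theta> / 2)" unfolding \<kappa>_def by (metis mult.commute mult.right_neutral right_diff_distrib)
  ultimately show "1 - \<theta> / 2 \<le> 1 / p + \<kappa>" by linarith
qed

lemma measure_between_levels:
  assumes "k < l" "0 < \<rho>" "\<rho> \<le> r"
  shows "vol {x \<in> ball x0 \<rho>. k < u x \<and> u x < l} / vol (ball x0 r) \<le> Y k \<rho> - Y l \<rho>"
proof -
  let ?A = "{x \<in> ball x0 \<rho>. k < u x}" and ?B = "{x \<in> ball x0 \<rho>. l < u x}"
  have V: "0 < vol (ball x0 \<rho>)" "vol (ball x0 \<rho>) \<le> vol (ball x0 r)"
    using assms V_pos by (auto intro!: measure_mono_ball[of _ _ x0 r])
  have "vol {x \<in> ball x0 \<rho>. k < u x \<and> u x < l} \<le> vol (?A - ?B)"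
    by (intro measure_mono_ball[of _ _ x0 \<rho>]) auto
  also have "\<dots> = vol ?A - vol ?B"
  proof (rule measure_Diff)
    show "emeasure lborel ?A \<noteq> \<infinity>" by (subst emeasure_subset_ball_eq[of _ x0 \<rho>]) auto
  qed (use assms in auto)
  finally have le: "vol {x \<in> ball x0 \<rho>. k < u x \<and> u x < l} \<le> vol ?A - vol ?B" .
  from frac_le[OF order_trans[OF measure_nonneg le] le V]
  show ?thesis by (simp add: Y_def diff_divide_distrib)
qed

text \<open>Isoperimetric inequality and gradient bound combined; \<open>half\<close> keeps {u \<le>
  k} from being small. The right side retains both factors on purpose: the difference telescopes in
  \<open>shrinking\<close>, and with Y_k^(1/p) it gives superlinearity in
  \<open>degiorgi_iteration\<close>.\<close>

lemma level_set_estimate: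
  assumes r: "0 < r" "r \<le> r1" and k: "\<bar>k\<bar> < M" "k < l" and \<sigma>: "0 < \<sigma>" "\<sigma> \<le> 1 / 2" and "r \<le> m"
    and ae: "AE_ball x0 r (\<lambda>x. u x \<le> k + m)"
    and half: "Y k (r * (1 - \<sigma>)) \<le> 1 / 2"
  shows "(l - k) * Y l (r * (1 - \<sigma>)) powr (1 - \<theta>) \<le>
    K * \<sigma> powr (- (q / p)) * m * Y k r powr (1 / p) *
      (Y k (r * (1 - \<sigma>)) - Y l (r * (1 - \<sigma>))) powr \<kappa>"
proof -
  define \<rho> where "\<rho> = r * (1 - \<sigma>)"
  have \<rho>: "0 < \<rho>" "\<rho> \<le> r" "r \<le> 2 * \<rho>" using r \<sigma> by (auto simp: \<rho>_def algebra_simps)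
  let ?n = "DIM('a)"
  let ?E = "{x \<in> ball x0 \<rho>. l \<le> u x}" and ?F = "{x \<in> ball x0 \<rho>. u x \<le> k}"
  define V where "V = vol (ball x0 \<rho>)"
  have V: "V > 0" using V_pos \<rho> by (simp add: V_def)
  have Vr: "vol (ball x0 r) \<le> 2 ^ ?n * V"
    using \<rho> r power_mono[of r "2 * \<rho>" "?n"]
    by (simp add: V_def measure_ball_scale power_mult_distrib mult_right_mono flip: mult.assoc)
  define e where "e = vol ?E / V"
  define f where "f = vol ?F / V"
  have YE: "Y l \<rho> \<le> e"
    unfolding Y_def e_def V_def by (intro divide_right_mono measure_mono_ball[of _ _ x0 \<rho>]) auto
  have "vol ?E \<le> V" "vol ?F \<le> V"
    unfolding V_def by (intro measure_mono_ball[of _ _ x0 \<rho>]; auto)+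
  then have ef: "0 \<le> e" "e \<le> 1" "0 \<le> f" "f \<le> 1" using V by (auto simp: e_def f_def)
  have "vol ?F = V - vol {x \<in> ball x0 \<rho>. k < u x}"
  proof -
    have eq: "?F = ball x0 \<rho> - {x \<in> ball x0 \<rho>. k < u x}" by auto
    show ?thesis
      unfolding V_def by (subst eq, rule measure_Diff) (use emeasure_ball_eq[of x0 \<rho>] in auto)
  qed
  then have f: "f \<ge> 1 / 2"
    using half V unfolding \<rho>_def[symmetric] by (simp add: f_def Y_def V_def field_simps)
  define d where "d = vol {x \<in> ball x0 \<rho>. k < u x \<and> u x < l} / vol (ball x0 r)"
  have d: "0 \<le> d" "d \<le> Y k \<rho> - Y l \<rho>"
    using measure_between_levels[OF k(2) \<rho>(1,2)] by (auto simp: d_def)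
  define X where "X = (c * \<sigma> powr (- q) * (m / r) powr p * Y k r) powr (1 / p)"
  define Z where "Z = (5 * d powr (1 - \<theta> / 2)) powr (1 - 1 / p)"
  have XZ: "0 \<le> X" "0 \<le> Z" by (auto simp: X_def Z_def)
  have "(l - k) * e powr (1 - \<theta>) \<le> 16 * 4 ^ ?n * \<rho> * (X * Z)"
  proof (cases "e = 0")
    case True
    then show ?thesis using XZ \<rho> by simp
  next
    case False
    then have e: "e > 0" using ef by simp
    \<comment> \<open>Makes both terms of \<open>isoperimetric_nn\<close> at most 2^n e^\<theta> V,
      because n \<theta> = 1 - \<theta>.\<close>
    define t0 where "t0 = e powr \<theta> / 2"
    have t0: "0 < t0" "t0 \<le> 1 / 2"
      using e ef \<theta> powr_le1[of \<theta> e] by (auto simp: t0_def)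
    define G where "G = 2 * X * Z * vol (ball x0 r)"
    have G: "G \<ge> 0" using XZ by (simp add: G_def)
    have layer: "(\<integral>\<^sup>+z. layer (ball x0 \<rho>) k l z \<partial>lborel) \<le> ennreal G"
      unfolding G_def X_def Z_def \<rho>_def d_def
      using r k \<sigma> \<open>r \<le> m\<close> ae by (intro gradient_L1_bound refl) auto
    have "\<rho> \<le> r1" using r \<rho> by linarith
    then have sub: "ball x0 \<rho> \<subseteq> \<Omega>" using subset_ball[of \<rho> r1 x0] ball_sub by blast
    have diam: "norm (y - x) \<le> 2 * \<rho>" if "x \<in> ball x0 \<rho>" "y \<in> ball x0 \<rho>" for x y
      using that dist_triangle2[of y x x0] by (simp add: dist_norm dist_commute norm_minus_commute)
    have "emeasure lborel ?E = ennreal (vol ?E)" "emeasure lborel ?F = ennreal (vol ?F)"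
      by (rule emeasure_subset_ball_eq[of _ x0 \<rho>], blast, measurable)+
    moreover have "vol ?E = e * V" "vol ?F = f * V"
      using V by (simp_all add: e_def f_def)
    ultimately have eqs: "emeasure lborel ?E = ennreal (e * V)" "emeasure lborel ?F = ennreal (f * V)"
      by simp_all
    have "ennreal (l - k) * (emeasure lborel ?E * emeasure lborel ?F) \<le>
        ennreal (2 * \<rho>) * ((emeasure lborel ?F * ennreal (t0 * 2 ^ ?n) +
          emeasure lborel ?E * ennreal ((1 / t0) ^ ?n)) * (\<integral>\<^sup>+z. layer (ball x0 \<rho>) k l z \<partial>lborel))"
      by (rule isoperimetric_nn[OF open_ball convex_ball sub k(2) t0 diam])
    also have "\<dots> \<le> ennreal (2 * \<rho>) * ((emeasure lborel ?F * ennreal (t0 * 2 ^ ?n) +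
          emeasure lborel ?E * ennreal ((1 / t0) ^ ?n)) * ennreal G)"
      using layer by (intro mult_left_mono) auto
    finally have "ennreal ((l - k) * (e * V * (f * V))) \<le>
        ennreal (2 * \<rho> * ((f * V * (t0 * 2 ^ ?n) + e * V * (1 / t0) ^ ?n) * G))"
      unfolding eqs using k e ef V \<rho> t0 G by (simp add: ennreal_mult ennreal_plus del: ennreal_plus[symmetric])
    then have "(l - k) * (e * V * (f * V)) \<le> 2 * \<rho> * ((f * V * (t0 * 2 ^ ?n) + e * V * (1 / t0) ^ ?n) * G)"
      using e ef V \<rho> t0 G by (subst (asm) ennreal_le_iff) auto
    also have "e * V * (1 / t0) ^ ?n = 2 ^ ?n * e powr \<theta> * V"
    proof -
      have "(1 / t0) ^ ?n = 2 ^ ?n / (e powr \<theta>) ^ ?n" by (simp add: t0_def power_divide)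
      also have "(e powr \<theta>) ^ ?n = e powr (1 - \<theta>)"
        using e \<theta>(3) by (simp add: powr_realpow[symmetric] powr_powr mult.commute)
      also have "2 ^ ?n / e powr (1 - \<theta>) = 2 ^ ?n * e powr \<theta> / e"
        using e by (simp add: powr_diff)
      finally show ?thesis using e by simp
    qed
    also have "f * V * (t0 * 2 ^ ?n) \<le> 2 ^ ?n * e powr \<theta> * V"
    proof -
      have "f * (V * (t0 * 2 ^ ?n)) \<le> 1 * (V * (t0 * 2 ^ ?n))"
        using ef V t0 by (intro mult_right_mono) auto
      also have "\<dots> \<le> V * (e powr \<theta> * 2 ^ ?n)"
        using V by (auto simp: t0_def intro!: mult_left_mono)
      finally show ?thesis by (simp add: mult_ac)
    qed
    finally have "(l - k) * (e * V * (f * V)) \<le>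
        2 * \<rho> * ((2 ^ ?n * e powr \<theta> * V + 2 ^ ?n * e powr \<theta> * V) * G)"
      using \<rho> G by (simp add: mult_left_mono mult_right_mono)
    then have "V * ((l - k) * e * V * f) \<le> V * (4 * \<rho> * 2 ^ ?n * e powr \<theta> * G)" by (simp add: algebra_simps)
    then have 1: "(l - k) * e * V * f \<le> 4 * \<rho> * 2 ^ ?n * e powr \<theta> * G" using V by simp
    have "(l - k) * e * V * (1 / 2) \<le> (l - k) * e * V * f"
      using f k e V by (intro mult_left_mono) auto
    with 1 have "(l - k) * e * V \<le> 8 * \<rho> * 2 ^ ?n * e powr \<theta> * G" by linarith
    also have "(l - k) * e * V = (l - k) * (e powr (1 - \<theta>) * e powr \<theta>) * V"
      using e by (simp flip: powr_add)
    finally have "e powr \<theta> * ((l - k) * e powr (1 - \<theta>) * V) \<le> e powr \<theta> * (8 * \<rho> * 2 ^ ?n * G)"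
      by (simp add: mult_ac)
    then have "(l - k) * e powr (1 - \<theta>) * V \<le> 8 * \<rho> * 2 ^ ?n * G"
      using e by simp
    also have "\<dots> = 16 * \<rho> * 2 ^ ?n * (X * Z) * vol (ball x0 r)" by (simp add: G_def)
    also have "\<dots> \<le> 16 * \<rho> * 2 ^ ?n * (X * Z) * (2 ^ ?n * V)"
      using Vr XZ \<rho> by (intro mult_left_mono) auto
    also have "\<dots> = 16 * 4 ^ ?n * \<rho> * (X * Z) * V"
      by (simp add: power_mult_distrib[symmetric] mult_ac)
    finally show ?thesis using V by simp
  qed
  moreover have "(l - k) * Y l \<rho> powr (1 - \<theta>) \<le> (l - k) * e powr (1 - \<theta>)"
    using YE Y_nonneg \<theta> k by (intro mult_left_mono powr_mono2) auto
  moreover have "X = c powr (1 / p) * \<sigma> powr (- (q / p)) * (m / r) * Y k r powr (1 / p)"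
    using p r \<open>r \<le> m\<close> c \<sigma> Y_nonneg[of k r] by (simp add: X_def powr_mult powr_powr)
  moreover have "Z \<le> 5 * (Y k \<rho> - Y l \<rho>) powr \<kappa>"
  proof -
    have "Z = 5 powr (1 - 1 / p) * d powr \<kappa>" by (simp add: Z_def \<kappa>_def powr_mult powr_powr)
    also have "\<dots> \<le> 5 powr 1 * (Y k \<rho> - Y l \<rho>) powr \<kappa>"
      using d p \<kappa> by (intro mult_mono powr_mono powr_mono2) auto
    finally show ?thesis by simp
  qed
  ultimately have "(l - k) * Y l \<rho> powr (1 - \<theta>) \<le> 16 * 4 ^ ?n * \<rho> *
      ((c powr (1 / p) * \<sigma> powr (- (q / p)) * (m / r) * Y k r powr (1 / p)) *
        (5 * (Y k \<rho> - Y l \<rho>) powr \<kappa>))"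
    using XZ \<rho> by (smt (verit) mult_left_mono mult_nonneg_nonneg zero_le_power)
  also have "\<dots> \<le> 16 * 4 ^ ?n * r *
      ((c powr (1 / p) * \<sigma> powr (- (q / p)) * (m / r) * Y k r powr (1 / p)) *
        (5 * (Y k \<rho> - Y l \<rho>) powr \<kappa>))"
    using \<rho> r \<open>r \<le> m\<close> by (intro mult_right_mono mult_left_mono) auto
  also have "\<dots> = K * \<sigma> powr (- (q / p)) * m * Y k r powr (1 / p) * (Y k \<rho> - Y l \<rho>) powr \<kappa>"
    using r by (simp add: K_def)
  finally show ?thesis unfolding \<rho>_def .
qed

text \<open>Among S dyadic steps, one lowers the density by at most 1/S. There height and level gap
  are both proportional to H/2^s, which cancels and leaves only (1/S)^\<kappa>; monotonicity carries
  the bound to the last level.\<close>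

lemma shrinking:
  assumes r: "0 < r" "r \<le> r1" and H: "H > 0" and ae: "AE_ball x0 r (\<lambda>x. u x \<le> \<mu>)"
    and half: "Y (\<mu> - H) (r / 2) \<le> 1 / 2" and \<mu>: "- M < \<mu> - H" "\<mu> \<le> M" and S: "S > 0" "r \<le> H / 2 ^ S"
  shows "Y (\<mu> - H / 2 ^ S) (r / 2) \<le> 2 * K * 2 powr (q / p) * (1 / real S) powr \<kappa>"
proof -
  define y where "y s = Y (\<mu> - H / 2 ^ s) (r / 2)" for s :: nat
  have anti: "y t \<le> y s" if "s \<le> t" for s t
    unfolding y_def using that H by (intro Y_antimono diff_left_mono divide_left_mono power_increasing) auto
  have y01: "0 \<le> y s" "y s \<le> 1" for s using Y_nonneg Y_le_1 by (auto simp: y_def)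
  obtain s where s: "s < S" "y s - y (Suc s) \<le> 1 / real S"
  proof -
    have "\<exists>s<S. y s - y (Suc s) \<le> 1 / real S"
    proof (rule ccontr)
      assume "\<not> ?thesis"
      then have "(\<Sum>s<S. 1 / real S) < (\<Sum>s<S. y s - y (Suc s))"
        using S by (intro sum_strict_mono) (auto simp: not_le)
      also have "(\<Sum>s<S. y s - y (Suc s)) = y 0 - y S" by (rule sum_lessThan_telescope')
      also have "\<dots> \<le> 1" using y01[of 0] y01[of S] by linarith
      finally show False using S by simp
    qed
    then show ?thesis using that by blast
  qed
  define k where "k = \<mu> - H / 2 ^ s"
  define l where "l = \<mu> - H / 2 ^ Suc s"
  \<comment> \<open>The depth is limited to S so that the height at step s is still at least r, as
    the energy inequality requires.\<close>
  have "H / 2 ^ S \<le> H / 2 ^ s" using H s by (intro divide_left_mono power_increasing) auto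
  then have rm: "r \<le> H / 2 ^ s" using S by linarith
  have "H / 2 ^ s \<le> H" "0 < H / 2 ^ s" using H by (auto simp: divide_le_eq)
  then have k: "\<bar>k\<bar> < M" "k < l"
    using \<mu> by (auto simp: k_def l_def abs_less_iff)
  have "(l - k) * Y l (r * (1 - 1/2)) powr (1 - \<theta>) \<le>
    K * (1/2) powr (- (q / p)) * (H / 2 ^ s) * Y k r powr (1 / p) *
      (Y k (r * (1 - 1/2)) - Y l (r * (1 - 1/2))) powr \<kappa>"
  proof (rule level_set_estimate[OF r k _ _ rm])
    show "AE_ball x0 r (\<lambda>x. u x \<le> k + H / 2 ^ s)" using ae by (simp add: k_def)
    show "Y k (r * (1 - 1/2)) \<le> 1 / 2" using anti[of 0 s] half by (simp add: y_def k_def)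
  qed auto
  also have "Y l (r * (1 - 1/2)) = y (Suc s)" by (simp add: y_def l_def)
  also have "Y k (r * (1 - 1/2)) = y s" by (simp add: y_def k_def)
  also have "l - k = H / 2 ^ s * (1 / 2)" by (simp add: k_def l_def field_simps)
  also have "K * (1/2) powr (- (q / p)) * (H / 2 ^ s) * Y k r powr (1 / p) * (y s - y (Suc s)) powr \<kappa> \<le>
      K * (1/2) powr (- (q / p)) * (H / 2 ^ s) * 1 * (1 / real S) powr \<kappa>"
  proof (rule mult_mono[OF mult_left_mono])
    show "Y k r powr (1 / p) \<le> 1" using Y_nonneg Y_le_1 p by (intro powr_le1) auto
    show "(y s - y (Suc s)) powr \<kappa> \<le> (1 / real S) powr \<kappa>"
      using s(2) anti[of s "Suc s"] \<kappa> by (intro powr_mono2) auto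
  qed (use K_pos H in auto)
  also have "(1/2::real) powr (- (q / p)) = 2 powr (q / p)" by (simp add: powr_divide powr_minus)
  finally have "2 * (H / 2 ^ s * (1 / 2) * y (Suc s) powr (1 - \<theta>)) \<le>
      2 * (K * 2 powr (q / p) * (H / 2 ^ s) * 1 * (1 / real S) powr \<kappa>)"
    by (intro mult_left_mono) auto
  then have "H / 2 ^ s * y (Suc s) powr (1 - \<theta>) \<le> H / 2 ^ s * (2 * K * 2 powr (q / p) * (1 / real S) powr \<kappa>)"
    by (simp add: mult_ac)
  then have le: "y (Suc s) powr (1 - \<theta>) \<le> 2 * K * 2 powr (q / p) * (1 / real S) powr \<kappa>"
    using H by (subst (asm) mult_le_cancel_left_pos) auto
  have "y S \<le> y (Suc s)" using s by (intro anti) auto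
  also have "\<dots> = y (Suc s) powr 1" using y01 by simp
  \<comment> \<open>Densities are at most 1, so lowering the exponent only increases them.\<close>
  also have "\<dots> \<le> y (Suc s) powr (1 - \<theta>)" using y01 \<theta> by (intro powr_mono') auto
  finally show ?thesis using le by (simp add: y_def)
qed

definition iterates :: "real \<Rightarrow> bool" where
  "iterates \<nu> \<longleftrightarrow> (\<forall>r H \<mu>. 0 < r \<longrightarrow> r \<le> r1 \<longrightarrow> r \<le> H \<longrightarrow> AE_ball x0 r (\<lambda>x. u x \<le> \<mu>) \<longrightarrow>
    - M < \<mu> - H \<longrightarrow> \<mu> \<le> M \<longrightarrow> Y (\<mu> - H) r \<le> \<nu> \<longrightarrow> AE_ball x0 (r / 2) (\<lambda>x. u x \<le> \<mu> - H / 2))"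

text \<open>Radii decrease from r to r/2 and levels rise from \<mu> - H to \<mu> - H/2, with steps
  halved each time. The densities tend to 0, so {u > \<mu> - H/2} is null in the half ball. The
  threshold is the same for all r, H and \<mu>, which allows its use at every scale.\<close>

lemma degiorgi_iteration: "\<exists>\<nu>>0. iterates \<nu>"
proof -
  let ?n = "DIM('a)"
  \<comment> \<open>A step divides by the level gap and by \<sigma>^(q/p), both governed by 2^(-j):
    a factor 2^(1 + q/p) per step.\<close>
  define B where "B = 2 powr (1 + q / p)"
  have B: "B \<ge> 1" using p q by (simp add: B_def ge_one_powr_ge_zero)
  \<comment> \<open>\<open>B ^ 2\<close> stems from the 4 in w j / 4, and 2^n from passing to the
    smaller ball.\<close>
  define A where "A = K * 2 ^ ?n * B ^ 2"
  have A: "A > 0" using K_pos B by (simp add: A_def)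
  \<comment> \<open>The cap 2^(-(n+1)) keeps the density on the next ball, at most 2^n times larger,
    below or at 1/2.\<close>
  obtain \<nu> where \<nu>: "0 < \<nu>" "\<nu> \<le> 1 / 2 ^ Suc ?n"
    and conv: "\<And>y :: nat \<Rightarrow> real. y 0 \<le> \<nu> \<Longrightarrow> (\<And>j. 0 \<le> y j) \<Longrightarrow>
      (\<And>j. y j \<le> \<nu> \<Longrightarrow> y (Suc j) powr (1 - \<theta>) \<le> A * B ^ j * y j powr (1 - \<theta> / 2)) \<Longrightarrow> y \<longlonglongrightarrow> 0"
    by (rule fast_geometric_convergence[OF A B \<theta>(1,2), of "1 / 2 ^ Suc ?n"]) auto
  show ?thesis
    unfolding iterates_def
  proof (intro exI[of _ \<nu>] conjI \<nu>(1) allI impI)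
    fix r H \<mu>
    assume r: "0 < r" "r \<le> r1" "r \<le> H" and ae: "AE_ball x0 r (\<lambda>x. u x \<le> \<mu>)"
      and \<mu>: "- M < \<mu> - H" "\<mu> \<le> M" and start: "Y (\<mu> - H) r \<le> \<nu>"
    have H: "H > 0" using r by linarith
    define w where "w j = (1 / 2 :: real) ^ j" for j
    have w: "0 < w j" "w j \<le> 1" "w (Suc j) = w j / 2" for j
      by (auto simp: w_def power_le_one)
    define \<rho> where "\<rho> j = r / 2 * (1 + w j)" for j
    define k where "k j = \<mu> - H / 2 - H / 2 * w j" for j
    define \<sigma> where "\<sigma> j = (w j / 2) / (1 + w j)" for j
    define y where "y j = Y (k j) (\<rho> j)" for j
    have \<rho>: "0 < \<rho> j" "\<rho> j \<le> r" "r / 2 \<le> \<rho> j" "\<rho> (Suc j) \<le> \<rho> j" "\<rho> j \<le> 2 * \<rho> (Suc j)" for j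
      using r w[of j] w[of "Suc j"] by (auto simp: \<rho>_def field_simps add_pos_pos)
    have \<sigma>: "0 < \<sigma> j" "\<sigma> j \<le> 1 / 2" "w j / 4 \<le> \<sigma> j" "\<rho> j * (1 - \<sigma> j) = \<rho> (Suc j)" for j
    proof -
      have pos: "1 + w j > 0" using w(1)[of j] by linarith
      show "0 < \<sigma> j" using w(1)[of j] pos by (simp add: \<sigma>_def)
      show "\<sigma> j \<le> 1 / 2" using w(1)[of j] pos by (simp add: \<sigma>_def field_simps)
      have "w j / 2 / 2 \<le> w j / 2 / (1 + w j)"
        using w(1,2)[of j] by (intro divide_left_mono) auto
      then show "w j / 4 \<le> \<sigma> j" by (simp add: \<sigma>_def)
      have "\<sigma> j = (w j / 2) / (1 + w j)" by (rule \<sigma>_def)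
      then have "(1 + w j) * \<sigma> j = w j / 2"
        using pos by (subst (asm) nonzero_eq_divide_eq) (auto simp: mult.commute)
      then have "(1 + w j) * (1 - \<sigma> j) = 1 + w j / 2" unfolding right_diff_distrib by simp
      then show "\<rho> j * (1 - \<sigma> j) = \<rho> (Suc j)" by (simp add: \<rho>_def w(3) mult.assoc)
    qed
    have kb: "\<mu> - H \<le> k j" "k j < \<mu> - H / 2" for j
    proof -
      have "H / 2 * w j \<le> H / 2 * 1" "0 < H / 2 * w j"
        using w[of j] H by (auto intro!: mult_left_mono)
      then show "\<mu> - H \<le> k j" "k j < \<mu> - H / 2" by (simp_all add: k_def)
    qed
    have y01: "0 \<le> y j" "y j \<le> 1" for j using Y_nonneg Y_le_1 by (auto simp: y_def)
    have step: "y (Suc j) powr (1 - \<theta>) \<le> A * B ^ j * y j powr (1 - \<theta> / 2)" if yj: "y j \<le> \<nu>" for j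
    proof -
      have kM: "\<bar>k j\<bar> < M" using kb[of j] \<mu> H by linarith
      have kl: "k j < k (Suc j)" using H w[of j] by (simp add: k_def w(3))
      have Y': "Y (k j) (\<rho> (Suc j)) \<le> 2 ^ ?n * y j"
        unfolding y_def by (rule Y_smaller_ball) (use \<rho> in auto)
      also have "\<dots> \<le> 2 ^ ?n * (1 / 2 ^ Suc ?n)" using yj \<nu> by (intro mult_left_mono) auto
      finally have half: "Y (k j) (\<rho> (Suc j)) \<le> 1 / 2" by simp
      have raw: "(k (Suc j) - k j) * Y (k (Suc j)) (\<rho> j * (1 - \<sigma> j)) powr (1 - \<theta>) \<le>
          K * \<sigma> j powr (- (q / p)) * H * Y (k j) (\<rho> j) powr (1 / p) *
          (Y (k j) (\<rho> j * (1 - \<sigma> j)) - Y (k (Suc j)) (\<rho> j * (1 - \<sigma> j))) powr \<kappa>"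
      proof (rule level_set_estimate[OF _ _ kM kl \<sigma>(1,2)])
        \<comment> \<open>The same height \<open>H\<close> serves every j, since \<mu> - k j \<le>
          H.\<close>
        show "AE_ball x0 (\<rho> j) (\<lambda>x. u x \<le> k j + H)"
          using ae by eventually_elim (use kb[of j] \<rho>(2)[of j] in auto)
      qed (use \<rho>[of j] r half \<sigma>(4)[of j] in auto)
      have eqs: "Y (k (Suc j)) (\<rho> j * (1 - \<sigma> j)) = y (Suc j)" "Y (k j) (\<rho> j) = y j"
        "k (Suc j) - k j = H * (w j / 4)"
        by (simp_all add: \<sigma>(4) y_def k_def w(3) field_simps)
      have "H * (w j / 4) * y (Suc j) powr (1 - \<theta>) \<le>
          K * \<sigma> j powr (- (q / p)) * H * y j powr (1 / p) *
          (Y (k j) (\<rho> j * (1 - \<sigma> j)) - y (Suc j)) powr \<kappa>"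
        using raw unfolding eqs .
      also have "K * \<sigma> j powr (- (q / p)) * H * y j powr (1 / p) *
          (Y (k j) (\<rho> j * (1 - \<sigma> j)) - y (Suc j)) powr \<kappa> \<le>
          K * (w j / 4) powr (- (q / p)) * H * y j powr (1 / p) * (2 ^ ?n * y j powr \<kappa>)"
      proof (rule mult_mono[OF mult_right_mono[OF mult_right_mono[OF mult_left_mono]]])
        show "\<sigma> j powr (- (q / p)) \<le> (w j / 4) powr (- (q / p))"
          using \<sigma>(3)[of j] w(1)[of j] p q by (intro powr_mono2') auto
        have "0 \<le> Y (k j) (\<rho> (Suc j)) - y (Suc j)"
          unfolding y_def using Y_antimono[of "k j" "k (Suc j)" "\<rho> (Suc j)"] kl by simp
        then have "(Y (k j) (\<rho> (Suc j)) - y (Suc j)) powr \<kappa> \<le> (2 ^ ?n * y j) powr \<kappa>"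
          using Y' y01[of "Suc j"] \<kappa> by (intro powr_mono2) auto
        also have "\<dots> = (2 ^ ?n) powr \<kappa> * y j powr \<kappa>" by (rule powr_mult)
        also have "(2 ^ ?n :: real) powr \<kappa> \<le> (2 ^ ?n) powr 1" using \<kappa> by (intro powr_mono) auto
        finally show "(Y (k j) (\<rho> j * (1 - \<sigma> j)) - y (Suc j)) powr \<kappa> \<le> 2 ^ ?n * y j powr \<kappa>"
          by (simp add: \<sigma>(4) mult_right_mono)
      qed (use K_pos H in auto)
      finally have "(H * (w j / 4)) * y (Suc j) powr (1 - \<theta>) \<le>
          (H * (w j / 4)) * (K * 2 ^ ?n * ((w j / 4) powr (- (q / p)) / (w j / 4)) * (y j powr (1 / p) * y j powr \<kappa>))"
        using w(1)[of j] by (simp add: field_simps)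
      then have "y (Suc j) powr (1 - \<theta>) \<le>
          K * 2 ^ ?n * ((w j / 4) powr (- (q / p)) / (w j / 4)) * (y j powr (1 / p) * y j powr \<kappa>)"
        using H w(1)[of j] by (subst (asm) mult_le_cancel_left_pos) auto
      also have "(w j / 4) powr (- (q / p)) / (w j / 4) = B ^ (j + 2)"
      proof -
        have "2 powr (- real (j + 2)) = 1 / (2::real) ^ (j + 2)"
          by (simp only: powr_minus_divide powr_realpow zero_less_numeral)
        then have wj: "w j / 4 = 2 powr (- real (j + 2))"
          by (simp add: w_def power_one_over power_add)
        have "(w j / 4) powr (- (q / p)) / (w j / 4) = 2 powr (- real (j + 2) * - (q / p) - - real (j + 2))"
          unfolding wj by (simp only: powr_powr powr_diff)
        also have "- real (j + 2) * - (q / p) - - real (j + 2) = (1 + q / p) * real (j + 2)"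
          unfolding minus_mult_minus by (simp only: distrib_right) (simp add: mult.commute)
        also have "2 powr ((1 + q / p) * real (j + 2)) = B powr real (j + 2)"
          by (simp only: B_def powr_powr)
        also have "\<dots> = B ^ (j + 2)" using B by (subst powr_realpow) auto
        finally show ?thesis .
      qed
      also have "y j powr (1 / p) * y j powr \<kappa> = y j powr (1 / p + \<kappa>)" by (simp add: powr_add)
      also have "K * 2 ^ ?n * B ^ (j + 2) * y j powr (1 / p + \<kappa>) \<le> K * 2 ^ ?n * B ^ (j + 2) * y j powr (1 - \<theta> / 2)"
        using K_pos B y01 \<kappa>(3) by (intro mult_left_mono powr_mono') auto
      also have "K * 2 ^ ?n * B ^ (j + 2) = A * B ^ j" by (simp add: A_def power_add power2_eq_square mult_ac)
      finally show ?thesis .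
    qed
    have "y 0 \<le> \<nu>" using start by (simp add: y_def k_def \<rho>_def w_def)
    then have lim: "y \<longlonglongrightarrow> 0" using y01 step by (intro conv) auto
    let ?N = "{x \<in> ball x0 (r / 2). \<mu> - H / 2 < u x}"
    let ?V = "vol (ball x0 r)"
    have "vol ?N \<le> y j * ?V" for j
    proof -
      have "vol ?N \<le> vol {x \<in> ball x0 (\<rho> j). k j < u x}"
        using \<rho>[of j] kb[of j] by (intro measure_mono_ball[of _ _ x0 "\<rho> j"]) auto
      also have "\<dots> = y j * vol (ball x0 (\<rho> j))"
        using V_pos[OF \<rho>(1)[of j]] by (simp add: y_def Y_def)
      also have "\<dots> \<le> y j * ?V"
        using y01 \<rho>(2)[of j] by (intro mult_left_mono measure_mono_ball[of _ _ x0 r]) auto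
      finally show ?thesis .
    qed
    then have "vol ?N \<le> 0 * ?V"
      by (intro LIMSEQ_le_const[OF tendsto_mult_right[OF lim]]) auto
    then have "vol ?N = 0" by (simp add: order_antisym)
    moreover have "emeasure lborel ?N = ennreal (vol ?N)"
      by (rule emeasure_subset_ball_eq[of _ x0 "r / 2"], blast, measurable)
    ultimately have "?N \<in> null_sets lborel" by (intro null_setsI) (simp, measurable)
    then have "AE x in lborel. x \<notin> ?N" by (rule AE_not_in)
    then show "AE_ball x0 (r / 2) (\<lambda>x. u x \<le> \<mu> - H / 2)"
      by eventually_elim auto
  qed
qed

definition decays :: "nat \<Rightarrow> bool" where
  "decays S \<longleftrightarrow> (\<forall>r H \<mu>. 0 < r \<longrightarrow> r \<le> r1 \<longrightarrow> r \<le> H / 2 ^ S \<longrightarrow> AE_ball x0 r (\<lambda>x. u x \<le> \<mu>) \<longrightarrow>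
    - M < \<mu> - H \<longrightarrow> \<mu> \<le> M \<longrightarrow> Y (\<mu> - H) (r / 2) \<le> 1 / 2 \<longrightarrow>
    AE_ball x0 (r / 4) (\<lambda>x. u x \<le> \<mu> - H / 2 ^ Suc S))"

text \<open>\<open>shrinking\<close> brings the density at level \<mu> - H/2^S below the threshold
  \<nu>; the iteration then starts on the ball of radius r/2 with height H/2^S and halves
  both.\<close>

lemma decay: "\<exists>S. decays S"
proof -
  obtain \<nu> where \<nu>: "0 < \<nu>" and "iterates \<nu>"
    using degiorgi_iteration by blast
  note iter = \<open>iterates \<nu>\<close>[unfolded iterates_def, rule_format]
  define C where "C = 2 * K * 2 powr (q / p)"
  have C: "C > 0" using K_pos by (simp add: C_def)
  obtain S where S: "S > 0" "C * (1 / real S) powr \<kappa> \<le> \<nu>"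
  proof -
    \<comment> \<open>Solves C S^(-\<kappa>) \<le> \<nu>; the successor makes S positive.\<close>
    define S where "S = Suc (nat \<lceil>(C / \<nu>) powr (1 / \<kappa>)\<rceil>)"
    have "(C / \<nu>) powr (1 / \<kappa>) \<le> real S" unfolding S_def by linarith
    then have "((C / \<nu>) powr (1 / \<kappa>)) powr \<kappa> \<le> real S powr \<kappa>" using \<kappa> by (intro powr_mono2) auto
    then have "C / \<nu> \<le> real S powr \<kappa>" using \<kappa> C \<nu> by (simp add: powr_powr)
    moreover have "real S > 0" by (simp only: S_def of_nat_0_less_iff zero_less_Suc)
    then have "real S powr \<kappa> > 0" by simp
    ultimately have "C * (1 / real S) powr \<kappa> \<le> \<nu>"
      using \<nu> by (simp add: powr_divide field_simps)
    then show ?thesis using that[of S] by (simp add: S_def)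
  qed
  show ?thesis
    unfolding decays_def
  proof (intro exI[of _ S] allI impI)
    fix r H \<mu>
    assume r: "0 < r" "r \<le> r1" "r \<le> H / 2 ^ S" and ae: "AE_ball x0 r (\<lambda>x. u x \<le> \<mu>)"
      and \<mu>: "- M < \<mu> - H" "\<mu> \<le> M" and half: "Y (\<mu> - H) (r / 2) \<le> 1 / 2"
    have HS: "H / 2 ^ S > 0" using r by linarith
    then have H: "H > 0" by (simp add: zero_less_divide_iff)
    then have "H / 2 ^ S \<le> H" by (simp add: divide_le_eq)
    moreover have "Y (\<mu> - H / 2 ^ S) (r / 2) \<le> \<nu>"
      using shrinking[OF r(1,2) H ae half \<mu> S(1) r(3)] S(2) unfolding C_def by linarith
    moreover have "AE_ball x0 (r / 2) (\<lambda>x. u x \<le> \<mu>)"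
      using ae by eventually_elim (use r in auto)
    moreover have "0 < r / 2" "r / 2 \<le> r1" "r / 2 \<le> H / 2 ^ S" using r by linarith+
    ultimately have "AE_ball x0 (r / 2 / 2) (\<lambda>x. u x \<le> \<mu> - H / 2 ^ S / 2)"
      using \<mu> by (intro iter[of "r / 2" "H / 2 ^ S" \<mu>]) (assumption | linarith)+
    then show "AE_ball x0 (r / 4) (\<lambda>x. u x \<le> \<mu> - H / 2 ^ Suc S)" by (simp add: mult.commute)
  qed
qed

end

section \<open>Decay of the oscillation\<close>

text \<open>Enclosing intervals replace essential suprema, so the statement composes across scales.
  The gain (b - a)/2^(S+2) is H/2^(S+1) for H = (b - a)/2.\<close>

definition contracts :: "('a::euclidean_space \<Rightarrow> real) \<Rightarrow> 'a \<Rightarrow> real \<Rightarrow> real \<Rightarrow> nat \<Rightarrow> bool" where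
  "contracts v x0 r1 M S \<longleftrightarrow> (\<forall>r a b. 0 < r \<longrightarrow> r \<le> r1 \<longrightarrow> - M \<le> a \<longrightarrow> b \<le> M \<longrightarrow>
    r \<le> (b - a) / 2 / 2 ^ S \<longrightarrow> AE_ball x0 r (\<lambda>x. a \<le> v x \<and> v x \<le> b) \<longrightarrow>
    (\<exists>a' b'. a \<le> a' \<and> a' \<le> b' \<and> b' \<le> b \<and> b' - a' \<le> (1 - 1 / 2 ^ (S + 2)) * (b - a) \<and>
      AE_ball x0 (r / 4) (\<lambda>x. a' \<le> v x \<and> v x \<le> b')))"

text \<open>Of the parts of the ball of radius r/2 where \<open>v\<close> is above or below the
  midpoint of [a, b], one fills at most half. In the first case decay for \<open>v\<close> lowers
  the upper bound, in the second decay for its negative raises the lower bound.\<close>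

lemma oscillation_step:
  fixes v :: "'a::euclidean_space \<Rightarrow> real"
  assumes pos: "degiorgi \<Omega> v g x0 r1 p q c M"
    and neg: "degiorgi \<Omega> (\<lambda>x. - v x) (\<lambda>x. - g x) x0 r1 p q c M"
  shows "\<exists>S. contracts v x0 r1 M S"
proof -
  interpret P: degiorgi \<Omega> v g x0 r1 p q c M by (rule pos)
  interpret N: degiorgi \<Omega> "\<lambda>x. - v x" "\<lambda>x. - g x" x0 r1 p q c M by (rule neg)
  obtain S1 S2 where "P.decays S1" "N.decays S2" using P.decay N.decay by blast
  note S1 = \<open>P.decays S1\<close>[unfolded P.decays_def, rule_format]
    and S2 = \<open>N.decays S2\<close>[unfolded N.decays_def, rule_format]
  \<comment> \<open>Enlarging S strengthens the smallness condition on r and weakens the gain, so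
    both decay statements stay applicable.\<close>
  define S where "S = max S1 S2"
  show ?thesis
    unfolding contracts_def
  proof (intro exI[of _ S] allI impI)
    fix r a b
    assume r: "0 < r" "r \<le> r1" "r \<le> (b - a) / 2 / 2 ^ S" and ab: "- M \<le> a" "b \<le> M"
      and ae: "AE_ball x0 r (\<lambda>x. a \<le> v x \<and> v x \<le> b)"
    define H where "H = (b - a) / 2"
    have "H / 2 ^ S > 0" using r by (simp add: H_def)
    then have H: "H > 0" by (simp add: zero_less_divide_iff)
    have pow: "H / 2 ^ Suc S \<le> H / 2 ^ Suc T" "H / 2 ^ S \<le> H / 2 ^ T" if "T \<le> S" for T
      using that H by (intro divide_left_mono power_increasing; simp)+
    have "H / 2 ^ Suc S \<le> H / 2 ^ 0" using H by (intro divide_left_mono power_increasing) auto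
    moreover have "b - a = 2 * H" by (simp add: H_def)
    ultimately have HS: "H / 2 ^ Suc S \<le> b - a" using H by simp
    have eq: "(1 - 1 / 2 ^ (S + 2)) * (b - a) = b - a - H / 2 ^ Suc S"
      by (simp add: H_def field_simps)
    \<comment> \<open>b - H and a + H are the same midpoint, so the two sets are disjoint.\<close>
    have sum: "P.Y (b - H) (r / 2) + N.Y (- a - H) (r / 2) \<le> 1"
    proof -
      let ?A = "{x \<in> ball x0 (r / 2). b - H < v x}" and ?B = "{x \<in> ball x0 (r / 2). - a - H < - v x}"
      have "emeasure lborel ?A = ennreal (vol ?A)" "emeasure lborel ?B = ennreal (vol ?B)"
        by (rule emeasure_subset_ball_eq[of _ x0 "r / 2"], blast, measurable)+
      then have fin: "emeasure lborel ?A \<noteq> \<infinity>" "emeasure lborel ?B \<noteq> \<infinity>" by (simp_all only: ennreal_neq_top infinity_ennreal_def not_False_eq_True)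
      have "?A \<inter> ?B = {}" by (auto simp: H_def field_simps)
      then have "vol ?A + vol ?B = vol (?A \<union> ?B)"
        by (intro measure_Union[OF fin, symmetric]) measurable
      also have "\<dots> \<le> vol (ball x0 (r / 2))"
        by (intro measure_mono_ball[of _ _ x0 "r / 2"]) auto
      finally have le: "vol ?A + vol ?B \<le> vol (ball x0 (r / 2))" .
      have V: "vol (ball x0 (r / 2)) > 0" using r by (intro P.V_pos) simp
      have "P.Y (b - H) (r / 2) + N.Y (- a - H) (r / 2) =
          (vol ?A + vol ?B) / vol (ball x0 (r / 2))"
        by (simp add: P.Y_def N.Y_def add_divide_distrib)
      also have "\<dots> \<le> 1" using le V by (subst divide_le_eq_1_pos) auto
      finally show ?thesis .
    qed
    have sub: "AE_ball x0 (r / 4) (\<lambda>x. a \<le> v x \<and> v x \<le> b)"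
      using ae by eventually_elim (use r in auto)
    show "\<exists>a' b'. a \<le> a' \<and> a' \<le> b' \<and> b' \<le> b \<and> b' - a' \<le> (1 - 1 / 2 ^ (S + 2)) * (b - a) \<and>
        (AE_ball x0 (r / 4) (\<lambda>x. a' \<le> v x \<and> v x \<le> b'))"
    proof (cases "P.Y (b - H) (r / 2) \<le> 1 / 2")
      case True
      have "AE_ball x0 (r / 4) (\<lambda>x. v x \<le> b - H / 2 ^ Suc S1)"
      proof (rule S1[OF r(1,2) _ _ _ ab(2) True])
        show "r \<le> H / 2 ^ S1" using r(3) pow(2)[of S1] by (simp add: H_def S_def)
        show "AE_ball x0 r (\<lambda>x. v x \<le> b)" using ae by eventually_elim auto
        show "- M < b - H" using ab H by (simp add: H_def field_simps)
      qed
      then have "AE_ball x0 (r / 4) (\<lambda>x. a \<le> v x \<and> v x \<le> b - H / 2 ^ Suc S)"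
        using sub by eventually_elim (use pow(1)[of S1] in \<open>auto simp: S_def\<close>)
      moreover have "0 \<le> H / 2 ^ Suc S" using H by simp
      ultimately show ?thesis
        unfolding eq using HS by (intro exI[of _ a] exI[of _ "b - H / 2 ^ Suc S"] conjI) (assumption | linarith)+
    next
      case False
      then have half: "N.Y (- a - H) (r / 2) \<le> 1 / 2" using sum by linarith
      have "AE_ball x0 (r / 4) (\<lambda>x. - v x \<le> - a - H / 2 ^ Suc S2)"
      proof (rule S2[OF r(1,2) _ _ _ _ half])
        show "r \<le> H / 2 ^ S2" using r(3) pow(2)[of S2] by (simp add: H_def S_def)
        show "AE_ball x0 r (\<lambda>x. - v x \<le> - a)" using ae by eventually_elim auto
        show "- M < - a - H" using ab H by (simp add: H_def field_simps)
        show "- a \<le> M" using ab by simp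
      qed
      then have "AE_ball x0 (r / 4) (\<lambda>x. a + H / 2 ^ Suc S \<le> v x \<and> v x \<le> b)"
        using sub by eventually_elim (use pow(1)[of S2] in \<open>auto simp: S_def\<close>)
      moreover have "0 \<le> H / 2 ^ Suc S" using H by simp
      ultimately show ?thesis
        unfolding eq using HS by (intro exI[of _ "a + H / 2 ^ Suc S"] exI[of _ b] conjI) (assumption | linarith)+
    qed
  qed
qed

text \<open>At radius r1/4^j either b - a is already below the next target and the interval is kept,
  or b - a is large against the radius and the contraction applies.\<close>

lemma oscillation_power_decay:
  fixes v :: "'a::euclidean_space \<Rightarrow> real"
  assumes pos: "degiorgi \<Omega> v g x0 r1 p q c M"
    and neg: "degiorgi \<Omega> (\<lambda>x. - v x) (\<lambda>x. - g x) x0 r1 p q c M"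
    and bound: "AE_ball x0 r1 (\<lambda>x. - M \<le> v x \<and> v x \<le> M)" and "0 \<le> M"
  obtains \<beta> C where "0 < \<beta>" "\<beta> < 1" "0 < C"
    "\<And>r. 0 < r \<Longrightarrow> r < r1 \<Longrightarrow> \<exists>a b. b - a \<le> C * r powr \<beta> \<and>
      (AE_ball x0 r (\<lambda>x. a \<le> v x \<and> v x \<le> b))"
proof -
  interpret P: degiorgi \<Omega> v g x0 r1 p q c M by (rule pos)
  note r1 = P.r1
  obtain S where "contracts v x0 r1 M S" using oscillation_step[OF pos neg] by blast
  note S = this[unfolded contracts_def, rule_format]
  define \<Lambda> :: real where "\<Lambda> = 1 - 1 / 2 ^ (S + 2)"
  have "(1::real) / 2 ^ (S + 2) \<le> 1 / 2 ^ 2" by (rule divide_left_mono) (auto simp: power_increasing)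
  moreover have "(0::real) < 1 / 2 ^ (S + 2)" by simp
  moreover have "(1::real) / 2 ^ 2 = 1 / 4" by simp
  ultimately have \<Lambda>: "1 / 4 < \<Lambda>" "\<Lambda> < 1" unfolding \<Lambda>_def by linarith+
  \<comment> \<open>2 M starts the induction. The second summand gives K \<Lambda> \<ge> r1 2^(S+1),
    so b - a > K \<Lambda>^(j+1) implies the smallness condition at radius r1/4^j, because 1/4 <
    \<Lambda>.\<close>
  define K where "K = 2 * M + r1 * 2 ^ Suc S / \<Lambda>"
  have rS: "r1 * 2 ^ Suc S / \<Lambda> > 0" using r1 \<Lambda> by (intro divide_pos_pos mult_pos_pos) auto
  have K: "K > 0" "2 * M \<le> K" using rS \<open>0 \<le> M\<close> by (auto simp: K_def)
  have KS: "r1 * 2 ^ Suc S \<le> K * \<Lambda>"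
  proof -
    have "r1 * 2 ^ Suc S = r1 * 2 ^ Suc S / \<Lambda> * \<Lambda>" using \<Lambda> by simp
    also have "\<dots> \<le> K * \<Lambda>" using \<Lambda> \<open>0 \<le> M\<close> by (intro mult_right_mono) (auto simp: K_def)
    finally show ?thesis .
  qed
  have iter: "\<exists>a b. - M \<le> a \<and> a \<le> b \<and> b \<le> M \<and> b - a \<le> K * \<Lambda> ^ j \<and>
      (AE_ball x0 (r1 / 4 ^ j) (\<lambda>x. a \<le> v x \<and> v x \<le> b))" for j
  proof (induction j)
    case 0
    show ?case using bound K \<open>0 \<le> M\<close> by (intro exI[of _ "- M"] exI[of _ M]) auto
  next
    case (Suc j)
    then obtain a b where ab: "- M \<le> a" "a \<le> b" "b \<le> M" "b - a \<le> K * \<Lambda> ^ j"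
      and ae: "AE_ball x0 (r1 / 4 ^ j) (\<lambda>x. a \<le> v x \<and> v x \<le> b)" by blast
    let ?r = "r1 / 4 ^ j"
    have r: "0 < ?r" "?r \<le> r1" "r1 / 4 ^ Suc j = ?r / 4"
      using r1 by (auto simp: divide_le_eq)
    show ?case
    proof (cases "b - a \<le> K * \<Lambda> ^ Suc j")
      case True
      have "AE_ball x0 (r1 / 4 ^ Suc j) (\<lambda>x. a \<le> v x \<and> v x \<le> b)"
        unfolding r(3) using ae by eventually_elim (use r(1) in auto)
      then show ?thesis using ab True by blast
    next
      case False
      have "?r * 2 ^ Suc S = (1 / 4) ^ j * (r1 * 2 ^ Suc S)" by (simp add: power_one_over)
      also have "\<dots> \<le> \<Lambda> ^ j * (K * \<Lambda>)"
        by (rule mult_mono[OF power_mono KS]) (use \<Lambda> r1 in auto)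
      also have "\<dots> \<le> b - a" using False by (simp add: mult_ac)
      finally have "?r \<le> (b - a) / 2 / 2 ^ S" by (simp add: field_simps)
      from S[OF r(1,2) ab(1,3) this ae] obtain a' b' where *: "a \<le> a'" "a' \<le> b'" "b' \<le> b"
        "b' - a' \<le> \<Lambda> * (b - a)" "AE_ball x0 (?r / 4) (\<lambda>x. a' \<le> v x \<and> v x \<le> b')"
        unfolding \<Lambda>_def by blast
      have "\<Lambda> * (b - a) \<le> \<Lambda> * (K * \<Lambda> ^ j)" using ab \<Lambda> by (intro mult_left_mono) auto
      then have "b' - a' \<le> K * \<Lambda> ^ Suc j" using *(4) by (simp add: mult_ac)
      then show ?thesis using * ab unfolding r(3) by (intro exI[of _ a'] exI[of _ b']) auto
    qed
  qed
  \<comment> \<open>Chosen with 4^(-\<beta>) = \<Lambda>; then \<Lambda> > 1/4 means \<beta> <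
    1.\<close>
  define \<beta> where "\<beta> = ln (1 / \<Lambda>) / ln 4"
  have "ln (1 / \<Lambda>) < ln 4" "0 < ln (1 / \<Lambda>)" using \<Lambda> by (auto simp: field_simps)
  then have \<beta>: "0 < \<beta>" "\<beta> < 1" by (auto simp: \<beta>_def)
  have \<Lambda>\<beta>: "(1 / 4) powr \<beta> = \<Lambda>"
    using \<Lambda> by (simp add: powr_def \<beta>_def ln_div)
  define C where "C = K / \<Lambda> / r1 powr \<beta>"
  have C: "C > 0" using K \<Lambda> r1 by (simp add: C_def)
  show ?thesis
  proof (rule that[OF \<beta> C])
    fix r assume r: "0 < r" "r < r1"
    obtain j0 where "(1 / 4) ^ j0 < r / r1"
      using real_arch_pow_inv[of "r / r1" "1 / 4"] r r1 by auto
    then have j0: "r1 / 4 ^ j0 < r" using r1 by (simp add: power_one_over field_simps)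
    \<comment> \<open>The ball one index earlier still contains the ball of radius r; this costs the
      factor 1/\<Lambda> in \<open>C\<close>.\<close>
    define j where "j = (LEAST j. r1 / 4 ^ j < r)"
    have jl: "r1 / 4 ^ j < r" unfolding j_def using j0 by (rule LeastI)
    have "j \<noteq> 0" using jl r by (intro notI) simp
    then obtain i where i: "j = Suc i" by (cases j) auto
    have "\<not> r1 / 4 ^ i < r" using not_less_Least[of i "\<lambda>j. r1 / 4 ^ j < r"] i by (simp add: j_def)
    then have ri: "r \<le> r1 / 4 ^ i" by simp
    obtain a b where ab: "b - a \<le> K * \<Lambda> ^ i"
      "AE_ball x0 (r1 / 4 ^ i) (\<lambda>x. a \<le> v x \<and> v x \<le> b)" using iter[of i] by blast
    have "\<Lambda> ^ j = ((1 / 4) ^ j) powr \<beta>"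
      unfolding \<Lambda>\<beta>[symmetric] by (simp add: powr_realpow[symmetric] powr_powr mult.commute)
    also have "\<dots> \<le> (r / r1) powr \<beta>"
      using jl r1 \<beta> by (intro powr_mono2) (auto simp: power_one_over field_simps)
    also have "\<dots> = r powr \<beta> / r1 powr \<beta>" using r r1 by (simp add: powr_divide)
    finally have "K / \<Lambda> * \<Lambda> ^ j \<le> K / \<Lambda> * (r powr \<beta> / r1 powr \<beta>)"
      using K \<Lambda> by (intro mult_left_mono) auto
    moreover have "K / \<Lambda> * (r powr \<beta> / r1 powr \<beta>) = C * r powr \<beta>" by (simp add: C_def)
    moreover have "K * \<Lambda> ^ i = K / \<Lambda> * \<Lambda> ^ j" using \<Lambda> i by simp
    ultimately have "K * \<Lambda> ^ i \<le> C * r powr \<beta>" by simp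
    moreover have "AE_ball x0 r (\<lambda>x. a \<le> v x \<and> v x \<le> b)"
      using ab(2) by eventually_elim (use ri in auto)
    ultimately show "\<exists>a b. b - a \<le> C * r powr \<beta> \<and>
      (AE_ball x0 r (\<lambda>x. a \<le> v x \<and> v x \<le> b))" using ab(1) by (intro exI[of _ a] exI[of _ b]) auto
  qed
qed

text \<open>With \<open>l = ln (1 / r)\<close> and \<open>t = ln (r / s)\<close> the exponents satisfy
  \<open>p(r) - p(s) \<le> L (ln l) t / (l (l + t))\<close>, while \<open>ln a \<le> 2 l\<close>; hence the weight \<open>a\<^bsup>p(s)\<^esup>\<close> loses
  at most the power \<open>2 L (ln l) / l\<close> of \<open>s / r\<close> relative to \<open>a\<^bsup>p(r)\<^esup>\<close>, which tends to zero.\<close>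

lemma var_exp_weight_bounds:
  fixes L M \<delta> :: real
  assumes "L > 0" "\<delta> > 0" "R > 0"
  obtains r1 where "0 < r1" "r1 \<le> R"
    "\<And>r s. 0 < r \<Longrightarrow> r \<le> r1 \<Longrightarrow> 0 \<le> s \<Longrightarrow> s \<le> r \<Longrightarrow> 0 \<le> var_exp L s \<and> var_exp L s \<le> var_exp L r"
    "\<And>r. 0 < r \<Longrightarrow> r \<le> r1 \<Longrightarrow> var_exp L r \<le> 1"
    "\<And>r s a. 0 < r \<Longrightarrow> r \<le> r1 \<Longrightarrow> 0 < s \<Longrightarrow> s \<le> r \<Longrightarrow> 1 \<le> a \<Longrightarrow> a * r \<le> M \<Longrightarrow>
      a powr var_exp L r * (s / r) powr \<delta> \<le> a powr var_exp L s"
proof -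
  have "((\<lambda>x::real. ln x / x) \<longlongrightarrow> 0) at_top" by (rule ln_x_over_x_tendsto_0)
  then have "eventually (\<lambda>x::real. ln x / x < min (1 / L) (\<delta> / (2 * L))) at_top"
    using assms by (intro order_tendstoD) auto
  then obtain l0 where l0: "\<And>x::real. x \<ge> l0 \<Longrightarrow> ln x / x < min (1 / L) (\<delta> / (2 * L))"
    by (auto simp: eventually_at_top_linorder)
  \<comment> \<open>Beyond \<open>l0\<close> the quotient ln x / x is small, beyond e it is
    monotone; ln (max M 1) yields ln a \<le> 2 l, and ln (1/R) yields r1 \<le> R.\<close>
  define l1 where "l1 = max (max l0 (exp 1)) (max (ln (max M 1)) (ln (1 / R)))"
  define r1 where "r1 = exp (- l1)"
  have ell: "l0 \<le> ln (1 / r)" "exp 1 \<le> ln (1 / r)" "ln (max M 1) \<le> ln (1 / r)" if "0 < r" "r \<le> r1" for r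
  proof -
    have "ln r \<le> - l1" using that ln_le_cancel_iff[of r r1] by (simp add: r1_def)
    then have "l1 \<le> ln (1 / r)" using that by (simp add: ln_div)
    then show "l0 \<le> ln (1 / r)" "exp 1 \<le> ln (1 / r)" "ln (max M 1) \<le> ln (1 / r)" by (auto simp: l1_def)
  qed
  have e1: "(1::real) < exp 1" by simp
  show ?thesis
  proof (rule that[of r1])
    show "0 < r1" by (simp add: r1_def)
    have "r1 \<le> exp (- ln (1 / R))" by (simp add: r1_def l1_def)
    then show "r1 \<le> R" using assms by (simp add: ln_div)
  next
    fix r s :: real assume r: "0 < r" "r \<le> r1" and s: "0 \<le> s" "s \<le> r"
    have quot: "0 \<le> ln (ln (1 / r)) / ln (1 / r)" if "0 < r" "r \<le> r1" for r
    proof (rule divide_nonneg_nonneg)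
      show "0 \<le> ln (1 / r)" using ell(2)[OF that] e1 by linarith
      show "0 \<le> ln (ln (1 / r))" by (rule ln_ge_zero) (use ell(2)[OF that] e1 in linarith)
    qed
    have nonneg: "0 \<le> var_exp L r"
      unfolding var_exp_def using assms quot[OF r] by (intro mult_nonneg_nonneg) auto
    show "0 \<le> var_exp L s \<and> var_exp L s \<le> var_exp L r"
    \<comment> \<open>At the centre, 1 / 0 = 0 and ln 0 = 0 give
      \<open>var_exp L 0 = 0\<close>.\<close>
    proof (cases "s = 0")
      case True
      then show ?thesis using nonneg by (simp add: var_exp_def)
    next
      case False
      then have s0: "0 < s" "s \<le> r1" using s r by auto
      have "ln (1 / r) \<le> ln (1 / s)" using s0 s r by (simp add: ln_div)
      then have "ln (ln (1 / s)) / ln (1 / s) \<le> ln (ln (1 / r)) / ln (1 / r)"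
        using ell[OF r] by (intro ln_x_over_x_mono)
      moreover have "0 \<le> ln (ln (1 / s)) / ln (1 / s)"
        by (rule quot[OF s0])
      ultimately show ?thesis
        unfolding var_exp_def using assms by (intro conjI mult_nonneg_nonneg mult_left_mono) simp_all
    qed
  next
    fix r :: real assume r: "0 < r" "r \<le> r1"
    have "ln (ln (1 / r)) / ln (1 / r) < 1 / L" using l0[OF ell(1)[OF r]] by simp
    then have "L * (ln (ln (1 / r)) / ln (1 / r)) \<le> L * (1 / L)" using assms by (intro mult_left_mono) auto
    then show "var_exp L r \<le> 1" using assms by (simp add: var_exp_def)
  next
    fix r s a :: real assume r: "0 < r" "r \<le> r1" and s: "0 < s" "s \<le> r" and a: "1 \<le> a" "a * r \<le> M"
    define l where "l = ln (1 / r)"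
    define t where "t = ln (r / s)"
    have l: "exp 1 \<le> l" "ln (max M 1) \<le> l" "ln l / l < \<delta> / (2 * L)"
      using ell[OF r] l0[OF ell(1)[OF r]] by (auto simp: l_def)
    have l1: "l > 1" using l(1) e1 by linarith
    have t: "t \<ge> 0" "ln (1 / s) = l + t" using r s by (auto simp: t_def l_def ln_div)
    have lna: "0 \<le> ln a" "ln a \<le> 2 * l"
    proof -
      show "0 \<le> ln a" using a by simp
      have "a \<le> max M 1 * (1 / r)" using a r by (simp add: field_simps max.coboundedI1)
      then have "ln a \<le> ln (max M 1 * (1 / r))" using a r by (subst ln_le_cancel_iff) auto
      also have "\<dots> = ln (max M 1) + l" using r by (simp add: ln_mult l_def ln_div)
      finally show "ln a \<le> 2 * l" using l(2) by linarith
    qed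
    have lnl: "ln l \<ge> 0" using l1 by simp
    have "var_exp L s \<ge> L * (ln l / (l + t))"
      unfolding var_exp_def t(2) using assms l1 t lnl by (intro mult_left_mono divide_right_mono) auto
    then have "var_exp L r - var_exp L s \<le> L * (ln l / l) - L * (ln l / (l + t))"
      by (simp add: var_exp_def l_def)
    also have "\<dots> = L * (ln l / l) * (t / (l + t))" using l1 t by (simp add: field_simps)
    also have "\<dots> \<le> L * (ln l / l) * (t / l)"
      using assms lnl l1 t by (intro mult_left_mono divide_left_mono) auto
    finally have diff: "var_exp L r - var_exp L s \<le> L * (ln l / l) * (t / l)" .
    have "(var_exp L r - var_exp L s) * ln a \<le> L * (ln l / l) * (t / l) * (2 * l)"
    proof (rule mult_mono[OF diff lna(2)])
      show "0 \<le> L * (ln l / l) * (t / l)" using assms lnl l1 t by (intro mult_nonneg_nonneg divide_nonneg_nonneg) auto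
    qed (rule lna(1))
    also have "\<dots> = 2 * L * (ln l / l) * t" using l1 by simp
    also have "\<dots> \<le> 2 * L * (\<delta> / (2 * L)) * t"
      using assms l(3) t by (intro mult_right_mono mult_left_mono) auto
    also have "\<dots> = \<delta> * t" using assms by simp
    finally have "(var_exp L r - var_exp L s) * ln a \<le> \<delta> * t" .
    then have "var_exp L r * ln a + \<delta> * - t \<le> var_exp L s * ln a" by (simp add: algebra_simps)
    moreover have "- t = ln (s / r)" using r s by (simp add: t_def ln_div)
    ultimately have "exp (var_exp L r * ln a + \<delta> * ln (s / r)) \<le> exp (var_exp L s * ln a)" by simp
    then show "a powr var_exp L r * (s / r) powr \<delta> \<le> a powr var_exp L s"
      using a r s by (simp add: powr_def exp_add)
  qed
qed

section \<open>Normalising the weight and passing to Borel representatives\<close>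

lemma AE_lebesgue_on_iff:
  "S \<in> sets lebesgue \<Longrightarrow> (AE x in lebesgue_on S. P x) \<longleftrightarrow> (AE x in lborel. x \<in> S \<longrightarrow> P x)"
  by (simp add: AE_restrict_space_iff AE_completion_iff)

text \<open>\<open>T\<close> and \<open>S\<close> may differ by a null set: level sets of the given
  \<open>u\<close> are Lebesgue measurable and get exchanged for Borel level sets of its
  representative.\<close>

lemma
  fixes h f :: "'a::euclidean_space \<Rightarrow> real"
  assumes T: "T \<in> sets lebesgue" and h: "h \<in> borel_measurable (lebesgue_on T)"
    and [measurable]: "S \<in> sets borel" "f \<in> borel_measurable borel"
    and ae: "AE x in lborel. (x \<in> T \<longleftrightarrow> x \<in> S) \<and> (x \<in> S \<longrightarrow> h x = f x)"
  shows integral_lebesgue_on_eq_lborel: "(LINT x|lebesgue_on T. h x) = (LINT x|lborel. indicator S x * f x)"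
    and integrable_lebesgue_on_iff_lborel: "integrable (lebesgue_on T) h \<longleftrightarrow> integrable lborel (\<lambda>x. indicator S x * f x)"
proof -
  let ?h = "\<lambda>x. indicator T x *\<^sub>R h x" and ?f = "\<lambda>x. indicator S x * f x"
  have SL: "T \<inter> space lebesgue \<in> sets lebesgue" using T by simp
  have m0: "?h \<in> borel_measurable lebesgue"
    using h unfolding borel_measurable_restrict_space_iff[OF SL] .
  have mb: "?f \<in> borel_measurable lborel" by measurable
  then have m: "?f \<in> borel_measurable lebesgue" by (rule measurable_completion)
  have ae': "AE x in lebesgue. ?h x = ?f x"
    unfolding AE_completion_iff using ae by eventually_elim (auto split: split_indicator)
  show "(LINT x|lebesgue_on T. h x) = (LINT x|lborel. ?f x)"
    using integral_cong_AE[OF m0 m ae'] integral_completion[OF mb] integral_restrict_space[OF SL, of h]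
    by simp
  show "integrable (lebesgue_on T) h \<longleftrightarrow> integrable lborel ?f"
    using integrable_cong_AE[OF m0 m ae'] integrable_completion[OF mb] integrable_restrict_space[OF SL, of h]
    by simp
qed

text \<open>Vanishing off \<open>B\<close> provides the extension by zero that turns integrals over
  the ball into integrals over the whole space.\<close>

lemma borel_representative:
  fixes f :: "'a::euclidean_space \<Rightarrow> 'b::euclidean_space"
  assumes B: "B \<in> sets borel" and f: "f \<in> borel_measurable (lebesgue_on B)"
  obtains f' where "f' \<in> borel_measurable borel" "AE x in lborel. x \<in> B \<longrightarrow> f' x = f x" "\<And>x. x \<notin> B \<Longrightarrow> f' x = 0"
proof -
  have BL: "B \<inter> space lebesgue \<in> sets lebesgue" using B by simp
  have "\<exists>h\<in>borel_measurable lborel. AE x in lborel. indicator B x * (f x \<bullet> i) = h x" for i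
  proof (rule completion_ex_borel_measurable_real)
    have "(\<lambda>x. f x \<bullet> i) \<in> borel_measurable (lebesgue_on B)" using f by measurable
    then show "(\<lambda>x. indicator B x * (f x \<bullet> i)) \<in> borel_measurable lebesgue"
      using borel_measurable_restrict_space_iff[OF BL, of "\<lambda>x. f x \<bullet> i"] by simp
  qed
  then have "\<forall>i. \<exists>h. h \<in> borel_measurable lborel \<and> (AE x in lborel. indicator B x * (f x \<bullet> i) = h x)"
    by blast
  from choice[OF this] obtain h where
    h: "\<forall>i. h i \<in> borel_measurable lborel \<and> (AE x in lborel. indicator B x * (f x \<bullet> i) = h i x)" ..
  have [measurable]: "h i \<in> borel_measurable borel" for i using h by simp
  show ?thesis
  proof (rule that[of "\<lambda>x. indicator B x *\<^sub>R (\<Sum>i\<in>Basis. h i x *\<^sub>R i)"])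
    have [measurable]: "B \<in> sets borel" by (rule B)
    show "(\<lambda>x. indicator B x *\<^sub>R (\<Sum>i\<in>Basis. h i x *\<^sub>R i)) \<in> borel_measurable borel" by measurable
    have "AE x in lborel. \<forall>i\<in>Basis. indicator B x * (f x \<bullet> i) = h i x"
      using h by (intro AE_finite_allI) auto
    then show "AE x in lborel. x \<in> B \<longrightarrow> indicator B x *\<^sub>R (\<Sum>i\<in>Basis. h i x *\<^sub>R i) = f x"
    proof eventually_elim
      case (elim x)
      show ?case
      proof
        assume "x \<in> B"
        then have "h i x = f x \<bullet> i" if "i \<in> Basis" for i using elim that by auto
        then show "indicator B x *\<^sub>R (\<Sum>i\<in>Basis. h i x *\<^sub>R i) = f x"
          using \<open>x \<in> B\<close> by (simp add: euclidean_representation)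
      qed
    qed
  qed simp
qed

lemma Lp_on_integrable:
  assumes "f \<in> Lp_on p B" "p \<ge> 1" "B \<in> lmeasurable"
  shows "integrable (lebesgue_on B) f"
proof -
  interpret finite_measure "lebesgue_on B" by (rule finite_measure_lebesgue_on) (rule assms)
  have "integrable (lebesgue_on B) (\<lambda>x. 1 + norm (f x) powr p)"
    using assms(1) by (intro Bochner_Integration.integrable_add) (auto simp: Lp_on_def)
  then show ?thesis
  proof (rule Bochner_Integration.integrable_bound)
    show "f \<in> borel_measurable (lebesgue_on B)" using assms(1) by (simp add: Lp_on_def)
    have "norm (f x) \<le> 1 + norm (f x) powr p" for x
    proof (cases "norm (f x) \<le> 1")
      case False
      then have "norm (f x) powr 1 \<le> norm (f x) powr p" using assms(2) by (intro powr_mono) auto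
      then show ?thesis by simp
    qed (simp add: add_increasing2)
    then show "AE x in lebesgue_on B. norm (f x) \<le> norm (1 + norm (f x) powr p)"
      by (intro AE_I2) (simp add: abs_of_nonneg add_nonneg_nonneg)
  qed
qed

lemma var_exp_norm_measurable:
  "(\<lambda>x::'a::euclidean_space. var_exp L (norm (x - x0))) \<in> borel_measurable borel"
proof -
  have n: "(\<lambda>x::'a. norm (x - x0)) \<in> borel_measurable borel"
    by (intro borel_measurable_continuous_onI continuous_intros)
  have "var_exp L \<in> borel_measurable borel" unfolding var_exp_def[abs_def] by measurable
  from measurable_compose[OF n this] show ?thesis .
qed

text \<open>Dividing the class inequality by the reference weight \<open>T\<close> removes the
  variable exponent. \<open>m0\<close> plays the role of the essential supremum of the truncation,
  \<open>m\<close> is a larger height that is also at least r. For m0 < r the weight lies between T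
  and 1, and m \<ge> r pays for that gap.\<close>

lemma energy_from_DG:
  fixes v :: "'a::euclidean_space \<Rightarrow> real" and g :: "'a \<Rightarrow> 'a"
  assumes v [measurable]: "v \<in> borel_measurable borel" and g [measurable]: "g \<in> borel_measurable borel"
    and gp: "integrable lborel (\<lambda>x. norm (g x) powr p)" and p: "1 < p" and q: "0 \<le> q" and c: "0 < c"
    and \<zeta>: "\<zeta> \<in> cutoffs \<gamma> x0 r \<sigma>" and r: "0 < r" and \<sigma>: "0 < \<sigma>" "\<sigma> < 1" and m: "0 \<le> m0" "m0 \<le> m" "r \<le> m" "m0 \<le> M'"
    and ae: "AE_ball x0 r (\<lambda>x. v x \<le> k + m0)"
    and P: "\<And>s. 0 \<le> s \<Longrightarrow> s \<le> r \<Longrightarrow> 0 \<le> var_exp L s \<and> var_exp L s \<le> var_exp L r" "var_exp L r \<le> 1"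
    and weight: "\<And>s a. 0 < s \<Longrightarrow> s \<le> r \<Longrightarrow> 1 \<le> a \<Longrightarrow> a * r \<le> M' \<Longrightarrow>
      a powr var_exp L r * (s / r) powr ((p - 1) / 4) \<le> a powr var_exp L s"
    and DG: "(LINT x|lborel. indicator {x \<in> ball x0 r. k < v x} x *
        ((m0 / r) powr var_exp L (norm (x - x0)) * norm (g x) powr p * \<zeta> x powr q)) \<le>
      c * \<sigma> powr (- q) * (m0 / r) powr p * (LINT x|lborel. indicator {x \<in> ball x0 r. k < v x} x *
        (m0 / r) powr var_exp L (norm (x - x0)))"
  shows "(\<integral>\<^sup>+x. indicator {x \<in> ball x0 (r * (1 - \<sigma>)). k < v x} x *
        ennreal ((norm (x - x0) / r) powr ((p - 1) / 4) * norm (g x) powr p) \<partial>lborel) \<le>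
      ennreal (c * \<sigma> powr (- q) * (m / r) powr p * vol {x \<in> ball x0 r. k < v x})"
    (is "(\<integral>\<^sup>+x. ?e x \<partial>lborel) \<le> _")
proof (cases "m0 = 0")
  case True
  have "r * (1 - \<sigma>) \<le> r" using r \<sigma> by (simp add: algebra_simps)
  then have "AE x in lborel. ?e x = 0"
    using ae True by (auto elim!: eventually_mono split: split_indicator)
  then have "(\<integral>\<^sup>+x. ?e x \<partial>lborel) = (\<integral>\<^sup>+x. 0 \<partial>(lborel :: 'a measure))"
    by (rule nn_integral_cong_AE)
  then show ?thesis by simp
next
  case False
  define a where "a = m0 / r"
  have a: "a > 0" using False m r by (simp add: a_def)
  let ?A = "{x \<in> ball x0 r. k < v x}"
  let ?P = "\<lambda>x. var_exp L (norm (x - x0))"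
  let ?W = "\<lambda>x. (norm (x - x0) / r) powr ((p - 1) / 4)"
  have W1: "?W x \<le> 1" if "x \<in> ball x0 r" for x
    using that r p by (intro powr_le1) (auto simp: dist_norm norm_minus_commute)
  have PB: "0 \<le> ?P x" "?P x \<le> var_exp L r" if "x \<in> ball x0 r" for x
    using P(1)[of "norm (x - x0)"] that by (auto simp: dist_norm norm_minus_commute)
  \<comment> \<open>\<open>T\<close> is the weight at |x - x0| = r; its companion \<open>U\<close>
    bounds the weight on the ball and equals T if a \<ge> 1 and 1 otherwise.\<close>
  define T where "T = a powr var_exp L r"
  define U where "U = max 1 a powr var_exp L r"
  have T: "T > 0" using a by (simp add: T_def)
  have U: "U > 0" by (simp add: U_def)
  have upper: "a powr ?P x \<le> U" if "x \<in> ball x0 r" for x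
  proof -
    have "a powr ?P x \<le> max 1 a powr ?P x" using a PB[OF that] by (intro powr_mono2) auto
    also have "\<dots> \<le> U" unfolding U_def using PB[OF that] by (intro powr_mono) auto
    finally show ?thesis .
  qed
  have lower: "T * ?W x \<le> a powr ?P x" if x: "x \<in> ball x0 r" "x \<noteq> x0" for x
  proof (cases "a \<ge> 1")
    case True
    then show ?thesis
      unfolding T_def using x m r by (intro weight) (auto simp: a_def dist_norm norm_minus_commute)
  next
    case False
    have "T * ?W x \<le> T * 1" using T W1[OF x(1)] by (intro mult_left_mono) auto
    also have "\<dots> \<le> a powr ?P x" unfolding T_def using PB[OF x(1)] a False by (simp add: powr_mono')
    finally show ?thesis .
  qed
  \<comment> \<open>For a < 1, the exponent at r is at most 1 < p, hence a^p \<le> T, while m \<ge>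
    r makes (m/r)^p at least 1.\<close>
  have scale: "a powr p * U \<le> (m / r) powr p * T"
  proof (cases "a \<ge> 1")
    case True
    then have "U = T" by (simp add: U_def T_def)
    moreover have "a powr p \<le> (m / r) powr p"
      using a m r p by (intro powr_mono2) (auto simp: a_def divide_right_mono)
    ultimately show ?thesis using T by simp
  next
    case False
    then have "U = 1" by (simp add: U_def)
    moreover have "a powr p \<le> T" unfolding T_def using False a P(2) p by (intro powr_mono') auto
    moreover have "1 \<le> (m / r) powr p" using m r p by (intro ge_one_powr_ge_zero) auto
    ultimately show ?thesis using T by (auto intro: order_trans[of _ T])
  qed
  have [measurable]: "?P \<in> borel_measurable borel" by (rule var_exp_norm_measurable)
  have [measurable]: "\<zeta> \<in> borel_measurable borel"
    using \<zeta> by (auto simp: cutoffs_def intro: test_function_measurable)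
  have \<zeta>01: "0 \<le> \<zeta> x" "\<zeta> x \<le> 1" and \<zeta>1: "x \<in> ball x0 (r * (1 - \<sigma>)) \<Longrightarrow> \<zeta> x = 1" for x
    using \<zeta> by (auto simp: cutoffs_def)
  let ?f = "\<lambda>x. indicator ?A x * (a powr ?P x * norm (g x) powr p * \<zeta> x powr q)"
  have [measurable]: "ball x0 r \<in> sets borel" by simp
  have A: "?A \<in> sets borel" by measurable
  have fA: "emeasure lborel ?A = ennreal (vol ?A)"
    by (rule emeasure_subset_ball_eq[OF _ A, of x0 r]) blast
  have intA: "integrable lborel (\<lambda>x. indicator ?A x :: real)"
    by (rule integrable_real_indicator) (use A fA in auto)
  have intf: "integrable lborel ?f"
  proof (rule Bochner_Integration.integrable_bound)
    show "integrable lborel (\<lambda>x. U * norm (g x) powr p)" using gp by simp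
    have "a powr ?P x * norm (g x) powr p * \<zeta> x powr q \<le> U * norm (g x) powr p * 1" if "x \<in> ball x0 r" for x
      using upper[OF that] \<zeta>01[of x] U q by (intro mult_mono powr_le1) auto
    then show "AE x in lborel. norm (?f x) \<le> norm (U * norm (g x) powr p)"
      using U by (intro AE_I2) (auto split: split_indicator)
  qed measurable
  have "(LINT x|lborel. indicator ?A x * a powr ?P x) \<le> (LINT x|lborel. U * indicator ?A x)"
  proof (rule integral_mono)
    show i: "integrable lborel (\<lambda>x. U * indicator ?A x)" using intA by simp
    show "integrable lborel (\<lambda>x. indicator ?A x * a powr ?P x)"
      by (rule Bochner_Integration.integrable_bound[OF i])
        (measurable, use upper U in \<open>auto intro!: AE_I2 split: split_indicator\<close>)
    show "indicator ?A x * a powr ?P x \<le> U * indicator ?A x" for x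
      using upper by (auto split: split_indicator)
  qed
  also have "\<dots> = U * vol ?A" by simp
  finally have I2: "(LINT x|lborel. indicator ?A x * a powr ?P x) \<le> U * vol ?A" .
  have "(LINT x|lborel. ?f x) \<le> c * \<sigma> powr (- q) * a powr p * (LINT x|lborel. indicator ?A x * a powr ?P x)"
    using DG unfolding a_def .
  also have "\<dots> \<le> c * \<sigma> powr (- q) * a powr p * (U * vol ?A)"
    using I2 c by (intro mult_left_mono) auto
  also have "\<dots> = c * \<sigma> powr (- q) * vol ?A * (a powr p * U)" by (simp add: mult_ac)
  also have "\<dots> \<le> c * \<sigma> powr (- q) * vol ?A * ((m / r) powr p * T)"
    using scale c by (intro mult_left_mono) auto
  finally have I1: "(LINT x|lborel. ?f x) / T \<le> c * \<sigma> powr (- q) * (m / r) powr p * vol ?A"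
    using T by (simp add: divide_le_eq mult_ac)
  have "r * (1 - \<sigma>) \<le> r" using r \<sigma> by (simp add: algebra_simps)
  then have sub: "ball x0 (r * (1 - \<sigma>)) \<subseteq> ball x0 r" by (rule subset_ball)
  have "(\<integral>\<^sup>+x. ?e x \<partial>lborel)
      \<le> (\<integral>\<^sup>+x. ennreal (?f x / T) \<partial>lborel)"
  proof (rule nn_integral_mono_AE)
    show "AE x in lborel. ?e x
        \<le> ennreal (?f x / T)"
      using AE_lborel_singleton[of x0]
    proof eventually_elim
      case (elim x)
      show ?case
      proof (cases "x \<in> ball x0 (r * (1 - \<sigma>)) \<and> k < v x")
        case True
        then have x: "x \<in> ball x0 r" using sub by auto
        have "T * (?W x * norm (g x) powr p) \<le> a powr ?P x * norm (g x) powr p"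
          using lower[OF x elim] by (simp add: mult.assoc[symmetric] mult_right_mono)
        then have "?W x * norm (g x) powr p \<le> ?f x / T"
          using True x T \<zeta>1[of x] by (simp add: le_divide_eq mult.commute[of T])
        then show ?thesis using True by (simp add: ennreal_leI)
      qed auto
    qed
  qed
  also have "\<dots> = ennreal (LINT x|lborel. ?f x / T)"
    by (rule nn_integral_eq_integral) (use intf T in \<open>auto intro!: AE_I2\<close>)
  also have "\<dots> \<le> ennreal (c * \<sigma> powr (- q) * (m / r) powr p * vol ?A)"
    using I1 by (intro ennreal_leI) simp
  finally show ?thesis .
qed

lemma borel_measurable_imp_lebesgue_on:
  "f \<in> borel_measurable borel \<Longrightarrow> f \<in> borel_measurable (lebesgue_on S)"
  by (intro measurable_restrict_space1 measurable_completion) simp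

lemma weak_gradient_uminus:
  assumes "weak_gradient \<Omega> u g"
  shows "weak_gradient \<Omega> (\<lambda>x. - u x) (\<lambda>x. - g x)"
proof -
  interpret weak_gradient \<Omega> u g by (rule assms)
  show ?thesis by unfold_locales (use u_integrable g_integrable weak in simp_all)
qed

text \<open>\<open>real_of_ereal\<close> is meaningful only for a finite essential supremum: it is
  at most \<open>m\<close>, and at least 0 because the truncation is nonnegative on a ball of
  positive measure.\<close>

lemma M_trunc_properties:
  fixes u :: "'a::euclidean_space \<Rightarrow> real"
  assumes u: "u \<in> borel_measurable (lebesgue_on (ball x0 r))" and "0 < r" "0 \<le> m"
    and le: "AE_ball x0 r (\<lambda>x. s * (u x - k) \<le> m)"
  shows "0 \<le> M_trunc s x0 u k r" "M_trunc s x0 u k r \<le> m"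
    "AE_ball x0 r (\<lambda>x. s * (u x - k) \<le> M_trunc s x0 u k r)"
proof -
  let ?N = "lebesgue_on (ball x0 r)"
  let ?f = "\<lambda>x. ereal (trunc s u k x)"
  have S: "ball x0 r \<in> sets lebesgue" by simp
  have f: "?f \<in> borel_measurable ?N" unfolding trunc_def using u by measurable
  have "AE x in ?N. ?f x \<le> ereal m"
    unfolding AE_lebesgue_on_iff[OF S] using le by eventually_elim (use \<open>0 \<le> m\<close> in \<open>auto simp: trunc_def\<close>)
  then have 1: "esssup ?N ?f \<le> ereal m" using f by (intro esssup_I)
  have "emeasure ?N (space ?N) = emeasure lborel (ball x0 r)"
    by (simp add: emeasure_restrict_space)
  also have "\<dots> \<noteq> 0" using \<open>0 < r\<close> by (simp add: emeasure_ball_eq)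
  finally have "esssup ?N (\<lambda>x. 0 :: ereal) = 0" by (rule esssup_const)
  moreover have "esssup ?N (\<lambda>x. 0 :: ereal) \<le> esssup ?N ?f"
  proof (rule esssup_mono)
    have "0 \<le> trunc s u k x" for x by (simp add: trunc_def)
    then show "(0::ereal) \<le> ?f x" for x by simp
  qed simp
  ultimately have 2: "0 \<le> esssup ?N ?f" by simp
  obtain m0 where m0: "esssup ?N ?f = ereal m0" using 1 2 by (cases "esssup ?N ?f") auto
  then have M: "M_trunc s x0 u k r = m0" by (simp add: M_trunc_def ess_sup_on_def)
  show "0 \<le> M_trunc s x0 u k r" "M_trunc s x0 u k r \<le> m" using 1 2 m0 M by auto
  have "AE x in ?N. ?f x \<le> esssup ?N ?f" by (rule esssup_AE)
  then show "AE_ball x0 r (\<lambda>x. s * (u x - k) \<le> M_trunc s x0 u k r)"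
    unfolding AE_lebesgue_on_iff[OF S] m0 M by eventually_elim (auto simp: trunc_def)
qed

text \<open>Since s (u - s k) = s u - k for s = 1 or -1, the class inequality of sign s at level s k
  is the one for s u above level k. So \<open>v\<close> and its negative satisfy the same energy
  inequality with the same constants.\<close>

lemma degiorgi_of_DG:
  fixes u :: "'a::euclidean_space \<Rightarrow> real"
  assumes dim: "DIM('a) \<ge> 2" and L: "L > 0" and R: "R > 0" and u: "u \<in> DG_class L M x0 R"
  obtains v g r1 p q c where
    "degiorgi (ball x0 R) v g x0 r1 p q c M"
    "degiorgi (ball x0 R) (\<lambda>x. - v x) (\<lambda>x. - g x) x0 r1 p q c M"
    "AE_ball x0 R (\<lambda>x. v x = u x)" "r1 \<le> R"
    "AE_ball x0 R (\<lambda>x. \<bar>v x\<bar> \<le> M)"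
proof -
  let ?B = "ball x0 R"
  obtain p q c \<gamma> g' where p: "1 < p" and pq: "p < q" and c: "0 < c" and \<gamma>: "1 < \<gamma>"
    and W1p: "W1p_with_gradient p ?B u g'"
    and DG: "\<And>r k \<sigma> \<zeta> s. \<zeta> \<in> cutoffs \<gamma> x0 r \<sigma> \<Longrightarrow> s \<in> {1, -1} \<Longrightarrow>
      0 < r \<and> ball x0 (8 * r) \<subseteq> ?B \<and> \<bar>k\<bar> < M \<and> 0 < \<sigma> \<and> \<sigma> < 1 \<Longrightarrow>
           (LINT x|lebesgue_on (level_set s x0 u k r).
              (M_trunc s x0 u k r / r) powr var_exp L (norm (x - x0)) *
              norm (g' x) powr p * \<zeta> x powr q)
           \<le> c * \<sigma> powr (- q) * (M_trunc s x0 u k r / r) powr p *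
              (LINT x|lebesgue_on (level_set s x0 u k r).
                 (M_trunc s x0 u k r / r) powr var_exp L (norm (x - x0)))"
    using u unfolding DG_class_def by blast
  have Lp: "u \<in> Lp_on p ?B" "g' \<in> Lp_on p ?B"
    and weak0: "\<And>\<phi> i. \<phi> \<in> test_functions ?B \<Longrightarrow> i \<in> Basis \<Longrightarrow>
        (LINT x|lebesgue_on ?B. u x * frechet_derivative \<phi> (at x) i) =
        - (LINT x|lebesgue_on ?B. (g' x \<bullet> i) * \<phi> x)"
    using W1p by (auto simp: W1p_with_gradient_def)
  then have um: "u \<in> borel_measurable (lebesgue_on ?B)" and gm: "g' \<in> borel_measurable (lebesgue_on ?B)"
    by (auto simp: Lp_on_def)
  have Bb: "?B \<in> sets borel" "?B \<in> sets lebesgue" "?B \<in> lmeasurable" by auto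
  obtain v where v [measurable]: "v \<in> borel_measurable borel" and vu: "AE x in lborel. x \<in> ?B \<longrightarrow> v x = u x"
    and v0: "\<And>x. x \<notin> ?B \<Longrightarrow> v x = 0" by (rule borel_representative[OF Bb(1) um]) blast
  obtain g where g [measurable]: "g \<in> borel_measurable borel" and gg: "AE x in lborel. x \<in> ?B \<longrightarrow> g x = g' x"
    and g0: "\<And>x. x \<notin> ?B \<Longrightarrow> g x = 0" by (rule borel_representative[OF Bb(1) gm]) blast
  have indv: "indicator ?B x * (v x * y) = v x * y" for x y using v0 by (auto split: split_indicator)
  have indg: "indicator ?B x * norm (g x) = norm (g x)"
    "indicator ?B x * norm (g x) powr p = norm (g x) powr p"
    "indicator ?B x * ((g x \<bullet> i) * y) = (g x \<bullet> i) * y" for x i y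
    using g0 p by (auto split: split_indicator)
  have wg: "weak_gradient ?B v g"
  proof
    have "integrable lborel (\<lambda>x. indicator ?B x * v x)"
      using Lp_on_integrable[OF Lp(1) _ Bb(3)] p vu
      by (subst integrable_lebesgue_on_iff_lborel[symmetric, OF Bb(2) um Bb(1) v])
        (auto elim!: eventually_mono)
    moreover have "(\<lambda>x. indicator ?B x * v x) = v"
      by (rule ext) (use v0 in \<open>auto split: split_indicator\<close>)
    ultimately show "integrable lborel v" by simp
    have "integrable lborel (\<lambda>x. indicator ?B x * norm (g x))"
      using integrable_norm[OF Lp_on_integrable[OF Lp(2) _ Bb(3)]] p gg
      by (subst integrable_lebesgue_on_iff_lborel[symmetric, where h="\<lambda>x. norm (g' x)", OF Bb(2) _ Bb(1)])
        (use gm in \<open>auto elim!: eventually_mono\<close>)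
    then show "integrable lborel g" unfolding indg by (subst (asm) integrable_norm_iff) auto
    fix \<phi> and i :: 'a assume \<phi>: "\<phi> \<in> test_functions ?B" and i: "i \<in> Basis"
    let ?d = "\<lambda>x. frechet_derivative \<phi> (at x) i"
    have "continuous_on UNIV \<phi>" "continuous_on UNIV ?d"
      by (rule test_function_bounded[OF \<phi>, of i]; blast)+
    then have [measurable]: "\<phi> \<in> borel_measurable borel" "?d \<in> borel_measurable borel"
      by (auto intro: borel_measurable_continuous_onI)
    then have [measurable]: "\<phi> \<in> borel_measurable (lebesgue_on ?B)"
      "?d \<in> borel_measurable (lebesgue_on ?B)"
      by (simp_all add: borel_measurable_imp_lebesgue_on)
    have [measurable]: "u \<in> borel_measurable (lebesgue_on ?B)" "g' \<in> borel_measurable (lebesgue_on ?B)"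
      by (rule um gm)+
    have "(LINT x|lebesgue_on ?B. u x * ?d x) =
        (LINT x|lborel. indicator ?B x * (v x * ?d x))"
    proof (rule integral_lebesgue_on_eq_lborel[OF Bb(2) _ Bb(1)])
      show "AE x in lborel. (x \<in> ?B \<longleftrightarrow> x \<in> ?B) \<and> (x \<in> ?B \<longrightarrow>
          u x * ?d x = v x * ?d x)"
        using vu by eventually_elim auto
    qed measurable
    moreover have "(LINT x|lebesgue_on ?B. (g' x \<bullet> i) * \<phi> x) =
        (LINT x|lborel. indicator ?B x * ((g x \<bullet> i) * \<phi> x))"
    proof (rule integral_lebesgue_on_eq_lborel[OF Bb(2) _ Bb(1)])
      show "AE x in lborel. (x \<in> ?B \<longleftrightarrow> x \<in> ?B) \<and> (x \<in> ?B \<longrightarrow> (g' x \<bullet> i) * \<phi> x = (g x \<bullet> i) * \<phi> x)"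
        using gg by eventually_elim auto
    qed measurable
    ultimately show "(LINT x|lborel. v x * ?d x) = - (LINT x|lborel. (g x \<bullet> i) * \<phi> x)"
      using weak0[OF \<phi> i] unfolding indv indg by simp
  qed
  have gp: "integrable lborel (\<lambda>x. norm (g x) powr p)"
  proof -
    have "integrable lborel (\<lambda>x. indicator ?B x * norm (g x) powr p)"
      using Lp(2) gg
      by (subst integrable_lebesgue_on_iff_lborel[symmetric, where h="\<lambda>x. norm (g' x) powr p", OF Bb(2) _ Bb(1)])
        (use gm in \<open>auto elim!: eventually_mono simp: Lp_on_def\<close>)
    then show ?thesis unfolding indg .
  qed
  have uM: "AE x in lborel. x \<in> ?B \<longrightarrow> \<bar>u x\<bar> \<le> M"
  proof -
    have le: "ess_sup_on ?B (\<lambda>x. \<bar>u x\<bar>) \<le> ereal M" using u by (simp add: DG_class_def)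
    have "AE x in lebesgue_on ?B. ereal \<bar>u x\<bar> \<le> ess_sup_on ?B (\<lambda>x. \<bar>u x\<bar>)"
      unfolding ess_sup_on_def by (rule esssup_AE)
    then have "AE x in lebesgue_on ?B. ereal \<bar>u x\<bar> \<le> ereal M"
      by eventually_elim (rule order_trans[OF _ le])
    then show ?thesis unfolding AE_lebesgue_on_iff[OF Bb(2)] by simp
  qed
  \<comment> \<open>R/8 admits the balls of radius 8 r of the class condition; 2 M bounds every
    truncation, as |u| \<le> M a.e. and |k| < M.\<close>
  obtain r1 where r1: "0 < r1" "r1 \<le> R / 8"
    and P: "\<And>r s. 0 < r \<Longrightarrow> r \<le> r1 \<Longrightarrow> 0 \<le> s \<Longrightarrow> s \<le> r \<Longrightarrow> 0 \<le> var_exp L s \<and> var_exp L s \<le> var_exp L r"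
    "\<And>r. 0 < r \<Longrightarrow> r \<le> r1 \<Longrightarrow> var_exp L r \<le> 1"
    and weight: "\<And>r s a. 0 < r \<Longrightarrow> r \<le> r1 \<Longrightarrow> 0 < s \<Longrightarrow> s \<le> r \<Longrightarrow> 1 \<le> a \<Longrightarrow> a * r \<le> 2 * M \<Longrightarrow>
      a powr var_exp L r * (s / r) powr ((p - 1) / 4) \<le> a powr var_exp L s"
    by (rule var_exp_weight_bounds[of L "(p - 1) / 4" "R / 8" "2 * M"]) (use L p R in auto)
  have energy: "(\<integral>\<^sup>+x. indicator {x \<in> ball x0 (r * (1 - \<sigma>)). k < s * v x} x *
        ennreal ((norm (x - x0) / r) powr ((p - 1) / 4) * norm (g x) powr p) \<partial>lborel) \<le>
      ennreal (c * \<sigma> powr (- q) * (m / r) powr p * vol {x \<in> ball x0 r. k < s * v x})"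
    if s: "s \<in> {1, -1}" and r: "0 < r" "r \<le> r1" and k: "\<bar>k\<bar> < M" and \<sigma>: "0 < \<sigma>" "\<sigma> < 1" and m: "r \<le> m"
      and ae: "AE_ball x0 r (\<lambda>x. s * v x \<le> k + m)" for s r k m \<sigma>
  proof -
    have ss: "s * s = 1" "s * (y - s * k) = s * y - k" "\<bar>s * k\<bar> < M" "\<bar>s * y\<bar> = \<bar>y\<bar>" for y
      using s k by auto
    have sub: "ball x0 r \<subseteq> ?B" "ball x0 (8 * r) \<subseteq> ?B" using r r1 by (auto intro!: subset_ball)
    have ur: "u \<in> borel_measurable (lebesgue_on (ball x0 r))" "g' \<in> borel_measurable (lebesgue_on (ball x0 r))"
      using um gm sub(1) by (auto intro: measurable_restrict_mono)
    define m0 where "m0 = M_trunc s x0 u (s * k) r"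
    have "AE_ball x0 r (\<lambda>x. s * (u x - s * k) \<le> m)"
      using ae vu by eventually_elim (use sub(1) ss(2) in auto)
    from M_trunc_properties[OF ur(1) r(1) _ this]
    have m0: "0 \<le> m0" "m0 \<le> m" and ae0: "AE_ball x0 r (\<lambda>x. s * (u x - s * k) \<le> m0)"
      using m r by (auto simp: m0_def)
    have "AE_ball x0 r (\<lambda>x. s * (u x - s * k) \<le> 2 * M)"
      using uM
    proof eventually_elim
      case (elim x)
      then show ?case unfolding ss(2) using sub(1) k ss(4)[of "u x"] by (auto simp: abs_le_iff abs_less_iff)
    qed
    from M_trunc_properties(2)[OF ur(1) r(1) _ this] have mM: "m0 \<le> 2 * M" using k by (simp add: m0_def)
    have aev: "AE_ball x0 r (\<lambda>x. s * v x \<le> k + m0)"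
      using ae0 vu by eventually_elim (use sub(1) ss(2) in auto)
    obtain \<zeta> where \<zeta>: "\<zeta> \<in> cutoffs \<gamma> x0 r \<sigma>" using cutoffs_nonempty[OF \<gamma> r(1) \<sigma>] by blast
    have \<zeta>m [measurable]: "\<zeta> \<in> borel_measurable borel"
      using \<zeta> by (auto simp: cutoffs_def intro: test_function_measurable)
    let ?Lev = "level_set s x0 u (s * k) r" and ?A = "{x \<in> ball x0 r. k < s * v x}"
    have A: "?A \<in> sets borel" by measurable
    have A0: "?Lev \<in> sets lebesgue" "?Lev \<subseteq> ball x0 r"
    proof -
      have "(\<lambda>x. trunc s u (s * k) x) \<in> borel_measurable (lebesgue_on (ball x0 r))"
        unfolding trunc_def using ur(1) by measurable
      then have "{x \<in> space (lebesgue_on (ball x0 r)). 0 < trunc s u (s * k) x} \<in> sets (lebesgue_on (ball x0 r))"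
        by measurable
      then show "?Lev \<in> sets lebesgue" "?Lev \<subseteq> ball x0 r"
        by (auto simp: level_set_def sets_restrict_space_iff)
    qed
    have aeA: "AE x in lborel. (x \<in> ?Lev \<longleftrightarrow> x \<in> ?A) \<and> (x \<in> ?A \<longrightarrow> g' x = g x)"
      using vu gg
    proof eventually_elim
      case (elim x)
      then show ?case using sub(1) by (auto simp: level_set_def trunc_def ss(2))
    qed
    have gA0: "g' \<in> borel_measurable (lebesgue_on ?Lev)"
      using ur(2) A0(2) by (rule measurable_restrict_mono)
    let ?w = "\<lambda>x. (m0 / r) powr var_exp L (norm (x - x0))"
    have wm [measurable]: "?w \<in> borel_measurable borel"
      using var_exp_norm_measurable[of L x0] by measurable
    have "(LINT x|lebesgue_on ?Lev. ?w x * norm (g' x) powr p * \<zeta> x powr q) =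
        (LINT x|lborel. indicator ?A x * (?w x * norm (g x) powr p * \<zeta> x powr q))"
    proof (rule integral_lebesgue_on_eq_lborel[OF A0(1) _ A])
      have [measurable]: "?w \<in> borel_measurable (lebesgue_on ?Lev)" "\<zeta> \<in> borel_measurable (lebesgue_on ?Lev)"
        "g' \<in> borel_measurable (lebesgue_on ?Lev)"
        using gA0 wm \<zeta>m by (auto intro: borel_measurable_imp_lebesgue_on)
      show "(\<lambda>x. ?w x * norm (g' x) powr p * \<zeta> x powr q) \<in> borel_measurable (lebesgue_on ?Lev)" by measurable
      show "(\<lambda>x. ?w x * norm (g x) powr p * \<zeta> x powr q) \<in> borel_measurable borel" by measurable
      show "AE x in lborel. (x \<in> ?Lev \<longleftrightarrow> x \<in> ?A) \<and>
          (x \<in> ?A \<longrightarrow> ?w x * norm (g' x) powr p * \<zeta> x powr q = ?w x * norm (g x) powr p * \<zeta> x powr q)"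
        using aeA by eventually_elim auto
    qed
    moreover have "(LINT x|lebesgue_on ?Lev. ?w x) = (LINT x|lborel. indicator ?A x * ?w x)"
    proof (rule integral_lebesgue_on_eq_lborel[OF A0(1) _ A wm])
      show "?w \<in> borel_measurable (lebesgue_on ?Lev)" by (rule borel_measurable_imp_lebesgue_on[OF wm])
      show "AE x in lborel. (x \<in> ?Lev \<longleftrightarrow> x \<in> ?A) \<and> (x \<in> ?A \<longrightarrow> ?w x = ?w x)"
        using aeA by eventually_elim auto
    qed
    ultimately have DG': "(LINT x|lborel. indicator ?A x * (?w x * norm (g x) powr p * \<zeta> x powr q)) \<le>
        c * \<sigma> powr (- q) * (m0 / r) powr p * (LINT x|lborel. indicator ?A x * ?w x)"
      using DG[OF \<zeta> s, of "s * k"] r sub(2) ss(3) \<sigma> unfolding m0_def[symmetric] by simp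
    have sv: "(\<lambda>x. s * v x) \<in> borel_measurable borel" by measurable
    have q0: "0 \<le> q" using p pq by simp
    show ?thesis
      by (rule energy_from_DG[OF sv g gp p q0 c \<zeta> r(1) \<sigma> m0 m mM aev P(1)[OF r] P(2)[OF r] weight[OF r] DG'])
  qed
  have sub: "ball x0 r1 \<subseteq> ?B" using r1 R by (intro subset_ball) simp
  have q0: "0 < q" using p pq by simp
  show ?thesis
  proof (rule that[of v g r1 p q c])
    show "degiorgi ?B v g x0 r1 p q c M"
      using energy[of 1] by (intro degiorgi.intro degiorgi_axioms.intro wg dim p q0 c r1 sub) simp_all
    show "degiorgi ?B (\<lambda>x. - v x) (\<lambda>x. - g x) x0 r1 p q c M"
      using energy[of "-1"]
      by (intro degiorgi.intro degiorgi_axioms.intro weak_gradient_uminus wg dim p q0 c r1 sub) simp_all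
    show "r1 \<le> R" using r1 R by simp
    show "AE x in lborel. x \<in> ?B \<longrightarrow> \<bar>v x\<bar> \<le> M" using uM vu by eventually_elim auto
  qed (rule vu)
qed

lemma ess_osc_le:
  fixes u :: "'a::euclidean_space \<Rightarrow> real"
  assumes u: "u \<in> borel_measurable (lebesgue_on (ball x0 r))"
    and ae: "AE_ball x0 r (\<lambda>x. a \<le> u x \<and> u x \<le> b)"
  shows "ess_sup_on (ball x0 r) u - ess_inf_on (ball x0 r) u \<le> ereal (b - a)"
proof -
  let ?N = "lebesgue_on (ball x0 r)"
  have S: "ball x0 r \<in> sets lebesgue" by simp
  have "ess_sup_on (ball x0 r) u \<le> ereal b"
    unfolding ess_sup_on_def
  proof (rule esssup_I)
    show "(\<lambda>x. ereal (u x)) \<in> borel_measurable ?N" using u by measurable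
    show "AE x in ?N. ereal (u x) \<le> ereal b"
      unfolding AE_lebesgue_on_iff[OF S] using ae by eventually_elim auto
  qed
  moreover have "ess_sup_on (ball x0 r) (\<lambda>x. - u x) \<le> ereal (- a)"
    unfolding ess_sup_on_def
  proof (rule esssup_I)
    show "(\<lambda>x. ereal (- u x)) \<in> borel_measurable ?N" using u by measurable
    show "AE x in ?N. ereal (- u x) \<le> ereal (- a)"
      unfolding AE_lebesgue_on_iff[OF S] using ae by eventually_elim auto
  qed
  then have "- ereal (- a) \<le> - ess_sup_on (ball x0 r) (\<lambda>x. - u x)" by (simp only: ereal_minus_le_minus)
  then have "ereal a \<le> ess_inf_on (ball x0 r) u" by (simp add: ess_inf_on_def)
  ultimately have "ess_sup_on (ball x0 r) u - ess_inf_on (ball x0 r) u \<le> ereal b - ereal a"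
    by (rule ereal_minus_mono)
  then show ?thesis by simp
qed

theorem theorem2p1:
  fixes x\<^sub>0 :: "'a::euclidean_space" and L M R :: real and u :: "'a \<Rightarrow> real"
  assumes "DIM('a) \<ge> 2"
    and "L > 0"
    and "0 < R" and "R < 1 / exp 1"
    and "u \<in> DG_class L M x\<^sub>0 R"
  shows "ess_holder_at u x\<^sub>0"
proof -
  obtain v g r1 p q c where pos: "degiorgi (ball x\<^sub>0 R) v g x\<^sub>0 r1 p q c M"
    and neg: "degiorgi (ball x\<^sub>0 R) (\<lambda>x. - v x) (\<lambda>x. - g x) x\<^sub>0 r1 p q c M"
    and vu: "AE_ball x\<^sub>0 R (\<lambda>x. v x = u x)" and r1R: "r1 \<le> R"
    and vM: "AE_ball x\<^sub>0 R (\<lambda>x. \<bar>v x\<bar> \<le> M)"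
    by (rule degiorgi_of_DG[OF assms(1,2,3,5)]) blast
  interpret degiorgi "ball x\<^sub>0 R" v g x\<^sub>0 r1 p q c M by (rule pos)
  \<comment> \<open>A negative M would make the ball null.\<close>
  have "0 \<le> M"
  proof (rule ccontr)
    assume M: "\<not> 0 \<le> M"
    from vM have "AE x in lborel. x \<notin> ball x\<^sub>0 R" by eventually_elim (use M in auto)
    then have "ball x\<^sub>0 R \<in> null_sets lborel" by (simp add: AE_iff_null_sets)
    then show False using V_pos[OF assms(3)] by (simp add: null_sets_def emeasure_ball_eq)
  qed
  have "AE_ball x\<^sub>0 r1 (\<lambda>x. - M \<le> v x \<and> v x \<le> M)"
    using vM by eventually_elim (use r1R in auto)
  then obtain \<beta> C where \<beta>C: "0 < \<beta>" "\<beta> < 1" "0 < C"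
    and osc: "\<And>r. 0 < r \<Longrightarrow> r < r1 \<Longrightarrow> \<exists>a b. b - a \<le> C * r powr \<beta> \<and>
      (AE_ball x\<^sub>0 r (\<lambda>x. a \<le> v x \<and> v x \<le> b))"
    by (rule oscillation_power_decay[OF pos neg _ \<open>0 \<le> M\<close>]) blast
  have "ess_sup_on (ball x\<^sub>0 r) u - ess_inf_on (ball x\<^sub>0 r) u \<le> ereal (C * r powr \<beta>)" if r: "0 < r" "r < r1" for r
  proof -
    obtain a b where ab: "b - a \<le> C * r powr \<beta>" "AE_ball x\<^sub>0 r (\<lambda>x. a \<le> v x \<and> v x \<le> b)"
      using osc[OF r] by blast
    have "ball x\<^sub>0 r \<subseteq> ball x\<^sub>0 R" using r r1R by (intro subset_ball) simp
    moreover have "u \<in> borel_measurable (lebesgue_on (ball x\<^sub>0 R))" using assms(5) by (simp add: DG_class_def)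
    ultimately have u: "u \<in> borel_measurable (lebesgue_on (ball x\<^sub>0 r))"
      by (rule measurable_restrict_mono[rotated])
    have "AE_ball x\<^sub>0 r (\<lambda>x. a \<le> u x \<and> u x \<le> b)"
      using ab(2) vu by eventually_elim (use r r1R in auto)
    from ess_osc_le[OF u this] show ?thesis using ab(1) by (meson ereal_less_eq(3) order_trans)
  qed
  then show ?thesis unfolding ess_holder_at_def using \<beta>C r1 by blast
qed

end
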